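(* Let $G=(V,E)$ be a connected undirected $(D,c)$-uniform graph with $n=|V|$ vertices and $\delta$-mixing time $T(n)$ for $\delta=\frac{1}{(2cn)^2}$; assume $T(n)$ stays bounded as $n\to\infty$ and the minimum degree $D$ grows with $n$. Let $A$ be the $m\times|E|$ measurement matrix generated by $m=O(T(n)k\log n)$ independent "good start" regularized random walks of length $t=O(|E|/k)$. Then with probability $1-o(1)$, $\ell_1$ minimization, i.e. solving $\min \|\tilde{\mathbf{x}}\|_1$ subject to $A\tilde{\mathbf{x}}=A\mathbf{x}$, recovers every $\Theta(k)$-sparse edge vector $\mathbf{x}\in\mathbb{R}^{E}$ exactly.
   Context: An undirected graph is $(D,c)$-uniform if every vertex has degree between $D$ and $cD$. A standard random walk moves at each step to a uniformly random neighbor; its stationary distribution is $\mu(v)=d_v/(2|E|)$. The $\delta$-mixing time is the smallest $t'$ such that for every starting vertex the distribution $\mu'$ after $t'$ steps satisfies $\|\mu-\mu'\|_\infty\le\delta$. A "good start" random walk of length $t$ starts at vertex $v$ with probability $d_v/(2|E|)$ and then performs $t$ steps of the standard random walk. A regularized walk adapted from a walk $W$ is a walk traversing exactly the same set of edges as $W$ but traversing each such edge at most twice (such a walk always exists). The measurement matrix has rows indexed by the walks and columns by the edges of $G$; its $(i,j)$ entry is the number of times the $i$-th regularized walk traverses edge $j$ (so entries lie in $\{0,1,2\}$). A vector is $s$-sparse if it has at most $s$ nonzero entries. *)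

theory Defs
  imports "HOL-Probability.Probability"
begin

text \<open>Finite simple undirected graph: vertex set V, edges are 2-element subsets of V.\<close>
definition graph :: "'a set \<Rightarrow> 'a set set \<Rightarrow> bool" where
  "graph V E \<longleftrightarrow> finite V \<and> (\<forall>e\<in>E. \<exists>u v. e = {u, v} \<and> u \<noteq> v \<and> u \<in> V \<and> v \<in> V)"

definition nbrs :: "'a set \<Rightarrow> 'a set set \<Rightarrow> 'a \<Rightarrow> 'a set" where
  "nbrs V E v = {u \<in> V. {v, u} \<in> E}"

definition deg :: "'a set \<Rightarrow> 'a set set \<Rightarrow> 'a \<Rightarrow> nat" where
  "deg V E v = card (nbrs V E v)"

definition connected_graph :: "'a set \<Rightarrow> 'a set set \<Rightarrow> bool" where
  "connected_graph V E \<longleftrightarrow> (\<forall>u\<in>V. \<forall>v\<in>V. (u, v) \<in> {(x, y). {x, y} \<in> E}\<^sup>*)"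

text \<open>(D,c)-uniform: every vertex has degree between D and cD.\<close>
definition uniform_graph :: "'a set \<Rightarrow> 'a set set \<Rightarrow> real \<Rightarrow> real \<Rightarrow> bool" where
  "uniform_graph V E D c \<longleftrightarrow> (\<forall>v\<in>V. D \<le> real (deg V E v) \<and> real (deg V E v) \<le> c * D)"

text \<open>Stationary distribution mu(v) = d_v / (2|E|).\<close>
definition stat_dist :: "'a set \<Rightarrow> 'a set set \<Rightarrow> 'a \<Rightarrow> real" where
  "stat_dist V E v = real (deg V E v) / (2 * real (card E))"

text \<open>Distribution of the standard random walk after t steps, started at v.\<close>
fun step_dist :: "'a set \<Rightarrow> 'a set set \<Rightarrow> 'a \<Rightarrow> nat \<Rightarrow> 'a \<Rightarrow> real" where
  "step_dist V E v 0 w = (if w = v then 1 else 0)"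
| "step_dist V E v (Suc t) w =
     (\<Sum>u\<in>V. step_dist V E v t u * (if {u, w} \<in> E then 1 / real (deg V E u) else 0))"

definition mixes :: "'a set \<Rightarrow> 'a set set \<Rightarrow> real \<Rightarrow> nat \<Rightarrow> bool" where
  "mixes V E \<delta> t \<longleftrightarrow> (\<forall>v\<in>V. \<forall>w\<in>V. \<bar>stat_dist V E w - step_dist V E v t w\<bar> \<le> \<delta>)"

text \<open>delta-mixing time: smallest t' such that every start is delta-close in sup norm.\<close>
definition mixing_time :: "'a set \<Rightarrow> 'a set set \<Rightarrow> real \<Rightarrow> nat" where
  "mixing_time V E \<delta> = (LEAST t. mixes V E \<delta> t)"

text \<open>Random walk of t steps from v, as the list of the t+1 visited vertices.\<close>
fun walk_from :: "'a set \<Rightarrow> 'a set set \<Rightarrow> 'a \<Rightarrow> nat \<Rightarrow> 'a list pmf" where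
  "walk_from V E v 0 = return_pmf [v]"
| "walk_from V E v (Suc t) =
     bind_pmf (pmf_of_set (nbrs V E v)) (\<lambda>u. map_pmf (\<lambda>p. v # p) (walk_from V E u t))"

definition start_pmf :: "'a set \<Rightarrow> 'a set set \<Rightarrow> 'a pmf" where
  "start_pmf V E = embed_pmf (\<lambda>v. if v \<in> V then stat_dist V E v else 0)"

text \<open>Good start random walk of length t.\<close>
definition good_start_walk :: "'a set \<Rightarrow> 'a set set \<Rightarrow> nat \<Rightarrow> 'a list pmf" where
  "good_start_walk V E t = bind_pmf (start_pmf V E) (\<lambda>v. walk_from V E v t)"

text \<open>m independent samples.\<close>
fun iid_pmf :: "'b pmf \<Rightarrow> nat \<Rightarrow> 'b list pmf" where
  "iid_pmf p 0 = return_pmf []"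
| "iid_pmf p (Suc m) = bind_pmf p (\<lambda>x. map_pmf (\<lambda>xs. x # xs) (iid_pmf p m))"

definition is_walk :: "'a set set \<Rightarrow> 'a list \<Rightarrow> bool" where
  "is_walk E p \<longleftrightarrow> p \<noteq> [] \<and> (\<forall>i. Suc i < length p \<longrightarrow> {p ! i, p ! Suc i} \<in> E)"

definition walk_edges :: "'a list \<Rightarrow> 'a set set" where
  "walk_edges p = {{p ! i, p ! Suc i} | i. Suc i < length p}"

text \<open>Number of times walk p traverses edge e.\<close>
definition traversals :: "'a list \<Rightarrow> 'a set \<Rightarrow> nat" where
  "traversals p e = card {i. Suc i < length p \<and> {p ! i, p ! Suc i} = e}"

definition regularized_walk :: "'a set set \<Rightarrow> 'a list \<Rightarrow> 'a list \<Rightarrow> bool" where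
  "regularized_walk E w r \<longleftrightarrow>
     is_walk E r \<and> walk_edges r = walk_edges w \<and> (\<forall>e. traversals r e \<le> 2)"

text \<open>Measurement matrix: row i = regularized walk rs!i, column e \<in> E, entry = traversals.
  l1 minimisation recovers every s-sparse edge vector x exactly: x is the unique minimiser
  of the l1 norm among edge vectors y with A y = A x.\<close>
definition meas :: "'a set set \<Rightarrow> 'a list list \<Rightarrow> ('a set \<Rightarrow> real) \<Rightarrow> nat \<Rightarrow> real" where
  "meas E rs x i = (\<Sum>e\<in>E. real (traversals (rs ! i) e) * x e)"

definition l1_recovers :: "'a set set \<Rightarrow> 'a list list \<Rightarrow> real \<Rightarrow> bool" where
  "l1_recovers E rs s \<longleftrightarrow>
     (\<forall>x. (\<forall>e. e \<notin> E \<longrightarrow> x e = 0) \<and> real (card {e\<in>E. x e \<noteq> 0}) \<le> s \<longrightarrow>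
        (\<forall>y. (\<forall>e. e \<notin> E \<longrightarrow> y e = 0) \<and> y \<noteq> x \<and>
              (\<forall>i<length rs. meas E rs y i = meas E rs x i) \<longrightarrow>
              (\<Sum>e\<in>E. \<bar>x e\<bar>) < (\<Sum>e\<in>E. \<bar>y e\<bar>)))"

definition mix_delta :: "real \<Rightarrow> 'a set \<Rightarrow> real" where
  "mix_delta c V = 1 / (2 * c * real (card V))\<^sup>2"

end

theory Submission
  imports Defs
begin

text \<open>
  It suffices to show that every nonzero null vector \<open>y\<close> of the measurement matrix puts less than
  half of its \<open>\<ell>\<^sub>1\<close> mass on any set \<open>S\<close> of at most \<open>\<gamma> k\<close> edges.

  As \<open>T\<close> stays bounded while \<open>\<delta>\<close> is of order \<open>n\<^sup>-\<^sup>2\<close>, all nontrivial eigenvalues of the walk tend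
  to \<open>0\<close>. Hence a walk that has met a small edge set \<open>Q\<close> is unlikely to meet it again two or more steps
  later, and a union bound makes this uniform in \<open>Q\<close>. Consecutive edges, however, may well lie in the
  same small set (the star of a vertex), so the matrix is not an expander. They are handled by signs:
  a step through \<open>e\<close> is useful if neither neighbouring step \<open>f\<close> has \<open>y\<^sub>f\<close> of sign opposite to \<open>y\<^sub>e\<close>
  and \<open>|y\<^sub>f| > |y\<^sub>e| / 10\<close>. Edges with too few useful steps are outnumbered by large entries of the
  opposite sign, so they carry little mass; for the others the row equation of a useful step bounds
  \<open>|y\<^sub>e|\<close> by entries met far from \<open>e\<close> along the walk, whose total contribution is small.
\<close>

section \<open>Edge sequences\<close>

text \<open>The walk is reversible, so an error of at most \<open>1 / (4 * c * n)\<close> after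
  \<open>2 ^ i\<close> steps, with \<open>i\<close> fixed, forces the norm of a single step on
  mean-zero functions below any prescribed \<kappa> once \<open>n\<close> is large. A regularized
  walk is arbitrary apart from its support and the cap 2 on its entries, so a row equation yields
  only inequalities with coefficients 1 or 2 on the edges met. This explains the tolerance 1/10: two
  neighbours with coefficient at most 2 cancel at most 4/10 of \<open>|y e|\<close>. The blocking
  ratio 40 against that factor 10 confines the obstructed edges to a quarter of the mass; if
  \<open>S\<close> holds half of it, a quarter remains on edges with many useful steps. The blocking
  set is chosen by the adversary, so the union bound runs over pairs \<open>(A, B)\<close>. As
  \<open>B\<close> is at most 40 times as large as \<open>A\<close>, up to constants there are at
  most \<open>n ^ (82 * card A)\<close> pairs for a given size of \<open>A\<close>; a failure
  probability exponential in \<open>card A * ln n\<close> suffices, and this is what the factor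
  \<open>ln n\<close> in the number of walks pays for.\<close>

definition hits :: "'e set \<Rightarrow> 'e list \<Rightarrow> nat" where
  "hits Q fs = length (filter (\<lambda>f. f \<in> Q) fs)"

text \<open>Counts the pairs of positions at distance at least two that both carry an element of \<open>Q\<close>.\<close>

fun far_pairs :: "'e set \<Rightarrow> 'e list \<Rightarrow> nat" where
  "far_pairs Q [] = 0"
| "far_pairs Q (f # fs) = (if f \<in> Q then hits Q (tl fs) else 0) + far_pairs Q fs"

text \<open>Adjacent hits alone are discarded, since they are not rare. Once one far pair exists all
  hits count, because each of them may then be far from another one.\<close>

definition far_hits :: "'e set \<Rightarrow> 'e list \<Rightarrow> nat" where
  "far_hits Q fs = (if far_pairs Q fs = 0 then 0 else hits Q fs)"

text \<open>Counts the interior positions in \<open>A\<close> neither of whose neighbours is in \<open>B\<close>.\<close>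

fun isolated :: "'e set \<Rightarrow> 'e set \<Rightarrow> 'e list \<Rightarrow> nat" where
  "isolated A B (f # g # h # fs) =
     (if f \<notin> B \<and> g \<in> A \<and> h \<notin> B then 1 else 0) + isolated A B (g # h # fs)"
| "isolated A B _ = 0"

definition far :: "nat \<Rightarrow> nat \<Rightarrow> bool" where
  "far l l' \<longleftrightarrow> l + 2 \<le> l' \<or> l' + 2 \<le> l"

lemma hits_Nil [simp]: "hits Q [] = 0"
  by (simp add: hits_def)

lemma hits_Cons [simp]: "hits Q (f # fs) = (if f \<in> Q then 1 else 0) + hits Q fs"
  by (simp add: hits_def)

lemma hits_tl: "hits Q fs \<le> hits Q (tl fs) + 1"
  by (cases fs) auto

text \<open>Among \<open>h\<close> hits at most \<open>h - 1\<close> pairs occupy adjacent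
  positions, so at least \<open>h * (h - 1) / 2 - (h - 1)\<close> pairs are far.\<close>

lemma hits_far_pairs:
  "hits Q fs > 0 \<Longrightarrow> (int (hits Q fs) - 1) * (int (hits Q fs) - 2) \<le> 2 * int (far_pairs Q fs)"
proof (induction fs)
  case (Cons f fs)
  have "int (hits Q fs) \<le> int (hits Q (tl fs)) + 1" using hits_tl[of Q fs] by linarith
  with Cons show ?case by (cases "hits Q fs = 0") (auto simp: algebra_simps)
qed simp

text \<open>The constant 3 is attained by three consecutive hits, which contain a single far pair;
  from four hits on the quadratic bound is stronger.\<close>

lemma hits_le_far_pairs:
  assumes "far_pairs Q fs > 0" shows "hits Q fs \<le> 3 * far_pairs Q fs"
proof (cases "hits Q fs \<le> 3")
  case True then show ?thesis using assms by linarith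
next
  case False
  define h where "h = int (hits Q fs)"
  have h: "h \<ge> 4" using False unfolding h_def by linarith
  have "0 \<le> (h - 4) * (3 * h + 1)" using h by simp
  then have "2 * h \<le> 3 * ((h - 1) * (h - 2))" using h by (simp add: algebra_simps)
  moreover have "(h - 1) * (h - 2) \<le> 2 * int (far_pairs Q fs)"
    using hits_far_pairs[of Q fs] False by (simp add: h_def)
  ultimately have "h \<le> 3 * int (far_pairs Q fs)" by linarith
  then show ?thesis unfolding h_def by linarith
qed

lemma hits_le_2:
  assumes "far_pairs Q fs = 0" shows "hits Q fs \<le> 2"
proof (rule ccontr)
  assume h: "\<not> ?thesis"
  then have "(int (hits Q fs) - 1) * (int (hits Q fs) - 2) > 0" by simp
  moreover have "(int (hits Q fs) - 1) * (int (hits Q fs) - 2) \<le> 0"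
    using hits_far_pairs[of Q fs] assms h by simp
  ultimately show False by linarith
qed

lemma far_hits_le_hits: "far_hits Q fs \<le> hits Q fs"
  by (simp add: far_hits_def)

lemma far_hits_le_far_pairs: "far_hits Q fs \<le> 3 * far_pairs Q fs"
  using hits_le_far_pairs[of Q fs] by (simp add: far_hits_def)

lemma isolated_le_hits_tl: "isolated A B fs \<le> hits A (tl fs)"
proof (induction A B fs rule: isolated.induct)
  case (1 A B f g h fs)
  then show ?case by auto
qed auto

lemma isolated_le_hits: "isolated A B fs \<le> hits A fs"
proof -
  have "hits A (tl fs) \<le> hits A fs" by (cases fs) auto
  then show ?thesis using isolated_le_hits_tl[of A B fs] by linarith
qed

text \<open>A truncated inclusion-exclusion: without far pairs there are at most two hits, and
  otherwise the left side is not positive. It bounds the indicator below by counts whose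
  expectations are computable.\<close>

lemma isolated_indicator:
  "real (isolated A B fs) - 3 * real (far_pairs A fs) \<le> 2 * (if isolated A B fs > 0 then 1 else 0)"
proof (cases "far_pairs A fs = 0")
  case True
  then show ?thesis using hits_le_2[OF True] isolated_le_hits[of A B fs] by auto
next
  case False
  then have "isolated A B fs \<le> 3 * far_pairs A fs"
    using hits_le_far_pairs[of A fs] isolated_le_hits[of A B fs] by linarith
  then show ?thesis by auto
qed

lemma isolated_pos_nth:
  "isolated A B fs > 0 \<Longrightarrow>
    \<exists>l\<ge>1. l + 1 < length fs \<and> fs ! (l - 1) \<notin> B \<and> fs ! l \<in> A \<and> fs ! (l + 1) \<notin> B"
proof (induction A B fs rule: isolated.induct)
  case (1 A B f g h fs)
  show ?case
  proof (cases "f \<notin> B \<and> g \<in> A \<and> h \<notin> B")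
    case True
    then show ?thesis by (intro exI[of _ 1]) auto
  next
    case False
    then have "isolated A B (g # h # fs) > 0" using 1(2) by auto
    from 1(1)[OF this] obtain l where "l \<ge> 1" "l + 1 < length (g # h # fs)"
      "(g # h # fs) ! (l - 1) \<notin> B" "(g # h # fs) ! l \<in> A" "(g # h # fs) ! (l + 1) \<notin> B" by blast
    then show ?thesis by (intro exI[of _ "Suc l"]) (auto simp: nth_Cons')
  qed
qed auto

lemma hits_pos: "i < length fs \<Longrightarrow> fs ! i \<in> Q \<Longrightarrow> hits Q fs > 0"
  by (auto simp: hits_def filter_empty_conv)

lemma far_pairs_pos:
  "l + 2 \<le> l' \<Longrightarrow> l' < length fs \<Longrightarrow> fs ! l \<in> Q \<Longrightarrow> fs ! l' \<in> Q \<Longrightarrow> far_pairs Q fs > 0"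
proof (induction fs arbitrary: l l')
  case (Cons f fs)
  show ?case
  proof (cases l)
    case 0
    obtain j where j: "l' = Suc (Suc j)" using Cons.prems(1) 0 by (metis add_0 add_2_eq_Suc le_Suc_ex)
    have "hits Q (tl fs) > 0"
      by (rule hits_pos[of j]) (use Cons.prems in \<open>auto simp: j nth_tl\<close>)
    then show ?thesis using Cons.prems 0 by auto
  next
    case (Suc j)
    then show ?thesis using Cons.IH[of j "l' - 1"] Cons.prems by (auto simp: nth_Cons')
  qed
qed simp

lemma card_Int_le_hits: "card (set fs \<inter> Q) \<le> hits Q fs"
proof -
  have "set fs \<inter> Q = set (filter (\<lambda>f. f \<in> Q) fs)" by auto
  then show ?thesis unfolding hits_def by (metis card_length)
qed

definition met_far :: "'e set \<Rightarrow> 'e list \<Rightarrow> 'e set" where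
  "met_far Q fs = {e. \<exists>l l'. l < length fs \<and> l' < length fs \<and> far l l' \<and> fs ! l = e \<and> fs ! l' \<in> Q}"

text \<open>One far encounter between \<open>S\<close> and \<open>Q\<close> is a far pair of the
  union, after which every hit of the union is counted. The right side is symmetric in
  \<open>S\<close> and \<open>Q\<close>, so the bound serves for either set in either role.\<close>

lemma card_met_far:
  "card (S \<inter> met_far Q fs) \<le> far_hits (S \<union> Q) fs"
proof (cases "S \<inter> met_far Q fs = {}")
  case False
  then obtain l l' where l: "l < length fs" "l' < length fs" "far l l'" "fs ! l \<in> S" "fs ! l' \<in> Q"
    unfolding met_far_def by blast
  have "far_pairs (S \<union> Q) fs > 0"
    using l far_pairs_pos[of l l' fs "S \<union> Q"] far_pairs_pos[of l' l fs "S \<union> Q"] by (auto simp: far_def)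
  moreover have "S \<inter> met_far Q fs \<subseteq> set fs \<inter> (S \<union> Q)" by (auto simp: met_far_def)
  then have "card (S \<inter> met_far Q fs) \<le> hits (S \<union> Q) fs"
    using card_mono[of "set fs \<inter> (S \<union> Q)" "S \<inter> met_far Q fs"] card_Int_le_hits[of fs "S \<union> Q"]
    by simp
  ultimately show ?thesis by (simp add: far_hits_def)
qed simp

section \<open>Integration over levels and decomposition into blocks\<close>

lemma layer_cake:
  fixes u a :: "'i \<Rightarrow> real" and v b :: "'j \<Rightarrow> real"
  assumes fin: "finite I" "finite J"
    and nn: "\<And>i. i \<in> I \<Longrightarrow> 0 \<le> u i" "\<And>j. j \<in> J \<Longrightarrow> 0 \<le> v j"
    and le: "\<And>x. 0 \<le> x \<Longrightarrow> (\<Sum>i\<in>{i\<in>I. x < u i}. a i) \<le> (\<Sum>j\<in>{j\<in>J. x < v j}. b j)"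
  shows "(\<Sum>i\<in>I. a i * u i) \<le> (\<Sum>j\<in>J. b j * v j)"
proof -
  \<comment> \<open>\<open>M\<close> exceeds every value of \<open>u\<close> and \<open>v\<close>,
    so all indicator integrals can be taken over the same interval.\<close>
  define M where "M = (\<Sum>i\<in>I. u i) + (\<Sum>j\<in>J. v j)"
  have Mu: "u i \<le> M" if "i \<in> I" for i
    using member_le_sum[OF that, of u] fin nn sum_nonneg[of J v] that unfolding M_def by fastforce
  have Mv: "v j \<le> M" if "j \<in> J" for j
    using member_le_sum[OF that, of v] fin nn sum_nonneg[of I u] that unfolding M_def by fastforce
  have step: "((\<lambda>x. c * (if x < w then 1 else 0)) has_integral c * w) {0..M}"
    if "0 \<le> w" "w \<le> M" for c w :: real
  proof -
    have "((\<lambda>x. 1::real) has_integral w) {0..w}" using has_integral_const_real[of "1::real" 0 w] that by (simp add: scaleR_conv_of_real)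
    then have "((\<lambda>x. if x \<in> {0..w} then 1 else 0 :: real) has_integral w) {0..M}"
      using has_integral_restrict_closed_subinterval[of "\<lambda>x. 1::real" w 0 w 0 M] that by auto
    then have "((\<lambda>x. if x < w then 1 else 0 :: real) has_integral w) {0..M}"
      by (rule has_integral_spike_finite[of "{w}", rotated 2]) auto
    then show ?thesis by (rule has_integral_mult_right)
  qed
  have I: "((\<lambda>x. \<Sum>i\<in>I. a i * (if x < u i then 1 else 0)) has_integral (\<Sum>i\<in>I. a i * u i)) {0..M}"
    by (intro has_integral_sum fin step nn Mu)
  have J: "((\<lambda>x. \<Sum>j\<in>J. b j * (if x < v j then 1 else 0)) has_integral (\<Sum>j\<in>J. b j * v j)) {0..M}"
    by (intro has_integral_sum fin step nn Mv)
  show ?thesis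
  proof (rule has_integral_le[OF I J])
    fix x assume "x \<in> {0..M}"
    then have "0 \<le> x" by simp
    from le[OF this] show "(\<Sum>i\<in>I. a i * (if x < u i then 1 else 0)) \<le> (\<Sum>j\<in>J. b j * (if x < v j then 1 else 0))"
      by (simp add: fin if_distrib sum.If_cases Int_def cong: if_cong)
  qed
qed

text \<open>The extra \<open>real s\<close> pays for the last, incomplete block. Nonnegativity of
  \<open>C\<close> comes from subadditivity at the empty set.\<close>

lemma subadditive_blocks:
  fixes F :: "'e set \<Rightarrow> real"
  assumes "finite Q" and s: "s > 0"
    and sub: "\<And>A B. F (A \<union> B) \<le> F A + F B"
    and blk: "\<And>B. B \<subseteq> Q \<Longrightarrow> card B \<le> s \<Longrightarrow> F B \<le> C * real s"
  shows "F Q \<le> C * (real (card Q) + real s)"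
  using \<open>finite Q\<close> blk
proof (induction "card Q" arbitrary: Q rule: less_induct)
  case less
  have C: "0 \<le> C * real s"
  proof -
    have "F {} \<le> C * real s" using less(3)[of "{}"] by simp
    moreover have "0 \<le> F {}" using sub[of "{}" "{}"] by simp
    ultimately show ?thesis by linarith
  qed
  show ?case
  proof (cases "card Q \<le> s")
    case True
    have "0 \<le> C" using C s by (simp add: zero_le_mult_iff)
    then have "0 \<le> C * real (card Q)" by simp
    then show ?thesis using less(3)[OF subset_refl True] by (simp add: distrib_left)
  next
    case False
    then obtain B where B: "B \<subseteq> Q" "card B = s"
      by (meson nat_le_linear obtain_subset_with_card_n)
    have fB: "finite B" using B less(2) finite_subset by blast
    have c: "card (Q - B) = card Q - s" using B fB by (simp add: card_Diff_subset)
    have "F (Q - B) \<le> C * (real (card (Q - B)) + real s)"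
      by (rule less(1)) (use c False s less in auto)
    moreover have "F B \<le> C * real s" using less(3)[of B] B by simp
    moreover have "F Q \<le> F B + F (Q - B)" using sub[of B "Q - B"] B by (simp add: Un_absorb1)
    moreover have "real (card (Q - B)) = real (card Q) - real s" using c False by (simp add: of_nat_diff)
    ultimately show ?thesis by (simp add: algebra_simps)
  qed
qed

section \<open>The null space property\<close>

text \<open>The quadratic inequalities say that the neighbouring entries are at least \<open>- |y e| / 10\<close> after
  multiplication by the sign of \<open>y e\<close>; in this form they are invariant under \<open>y \<mapsto> - y\<close>.\<close>

definition agreeable :: "('e \<Rightarrow> real) \<Rightarrow> 'e \<Rightarrow> 'e list \<Rightarrow> nat \<Rightarrow> bool" where
  "agreeable y e fs l \<longleftrightarrow> 1 \<le> l \<and> l + 1 < length fs \<and> fs ! l = e \<and>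
     - (y e)\<^sup>2 \<le> 10 * y e * y (fs ! (l - 1)) \<and> - (y e)\<^sup>2 \<le> 10 * y e * y (fs ! (l + 1))"

text \<open>For every level \<open>x\<close>, the edges with few agreeable steps and \<open>y e > x\<close> must be blocked by more than
  \<open>40\<close> times as many edges with \<open>y f < - x / 10\<close>; integrate over \<open>x\<close>.\<close>

lemma obstructed_mass:
  fixes y :: "'e \<Rightarrow> real" and fs :: "nat \<Rightarrow> 'e list"
  assumes fin: "finite E" "S \<subseteq> E"
    and rows: "\<And>i. i < m \<Longrightarrow> set (fs i) \<subseteq> E"
    and iso: "\<And>A B. A \<subseteq> S \<Longrightarrow> B \<subseteq> E \<Longrightarrow> A \<noteq> {} \<Longrightarrow> A \<inter> B = {} \<Longrightarrow>
      card B \<le> 40 * card A \<Longrightarrow> b * real (card A) \<le> real (card {i. i < m \<and> isolated A B (fs i) > 0})"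
    and bad: "\<And>e. e \<in> S \<Longrightarrow> real (card {i. i < m \<and> (\<exists>l. agreeable y e (fs i) l)}) < b"
  shows "40 * (\<Sum>e\<in>{e\<in>S. y e > 0}. y e) \<le> 10 * (\<Sum>f\<in>{f\<in>E. y f < 0}. - y f)"
proof -
  have fS: "finite S" using fin finite_subset by blast
  have "(\<Sum>e\<in>{e\<in>S. y e > 0}. 40 * y e) \<le> (\<Sum>f\<in>{f\<in>E. y f < 0}. 1 * (10 * (- y f)))"
  proof (rule layer_cake[where a = "\<lambda>_. 40" and u = y and b = "\<lambda>_. 1" and v = "\<lambda>f. 10 * (- y f)"])
    fix x :: real assume x: "0 \<le> x"
    define A where "A = {e\<in>S. x < y e}"
    define B where "B = {f\<in>E. x < 10 * (- y f)}"
    have A: "{e \<in> {e\<in>S. y e > 0}. x < y e} = A" using x by (auto simp: A_def)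
    have B: "{f \<in> {f\<in>E. y f < 0}. x < 10 * (- y f)} = B" using x by (auto simp: B_def)
    define R where "R e = {i. i < m \<and> (\<exists>l. agreeable y e (fs i) l)}" for e
    have fA: "finite A" using fS by (simp add: A_def)
    \<comment> \<open>Otherwise many walks pass \<open>A\<close> isolated from \<open>B\<close>.
      Neighbours outside \<open>B\<close> have entries at least \<open>- x / 10\<close>, and entries
      in \<open>A\<close> exceed \<open>x\<close>, so each such walk is useful for some edge of
      \<open>A\<close>; but every edge of \<open>A\<close> has fewer than \<open>b\<close> useful
      walks.\<close>
    have "40 * card A \<le> card B"
    proof (rule ccontr)
      assume neg: "\<not> ?thesis"
      then have ne: "A \<noteq> {}" by auto
      have "A \<inter> B = {}" using x by (auto simp: A_def B_def)
      then have "b * real (card A) \<le> real (card {i. i < m \<and> isolated A B (fs i) > 0})"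
        by (intro iso ne) (use neg in \<open>auto simp: A_def B_def\<close>)
      also have "real (card {i. i < m \<and> isolated A B (fs i) > 0}) \<le> real (card (\<Union>e\<in>A. R e))"
      proof -
        have "{i. i < m \<and> isolated A B (fs i) > 0} \<subseteq> (\<Union>e\<in>A. R e)"
        proof
        fix i assume "i \<in> {i. i < m \<and> isolated A B (fs i) > 0}"
        then have i: "i < m" and "isolated A B (fs i) > 0" by auto
        from isolated_pos_nth[OF this(2)] obtain l where l: "1 \<le> l" "l + 1 < length (fs i)"
          "fs i ! (l - 1) \<notin> B" "fs i ! l \<in> A" "fs i ! (l + 1) \<notin> B" by blast
        have ok: "- (y e)\<^sup>2 \<le> 10 * y e * y f" if "e \<in> A" "y f \<ge> - x / 10" for e f
        proof -
          have e: "x < y e" using that by (simp add: A_def)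
          have "10 * y f + y e \<ge> 0" using that(2) e x by linarith
          then have "0 \<le> y e * (10 * y f + y e)" using e x by (intro mult_nonneg_nonneg) linarith+
          then show ?thesis by (simp add: algebra_simps power2_eq_square)
        qed
        have "fs i ! j \<in> E" if "j < length (fs i)" for j
          using rows[OF i] nth_mem[OF that] by blast
        then have "fs i ! (l - 1) \<in> E" "fs i ! (l + 1) \<in> E" using l(2) by simp_all
        then have "y (fs i ! (l - 1)) \<ge> - x / 10" "y (fs i ! (l + 1)) \<ge> - x / 10"
          using l(3,5) by (auto simp: B_def)
        then have "agreeable y (fs i ! l) (fs i) l"
          using l ok by (simp add: agreeable_def)
        then show "i \<in> (\<Union>e\<in>A. R e)"
          using l(4) i unfolding R_def by blast
        qed
        moreover have "(\<Union>e\<in>A. R e) \<subseteq> {..<m}" unfolding R_def by blast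
        then have "finite (\<Union>e\<in>A. R e)" by (rule finite_subset) simp
        ultimately show ?thesis by (intro of_nat_mono card_mono)
      qed
      also have "real (card (\<Union>e\<in>A. R e)) \<le> (\<Sum>e\<in>A. real (card (R e)))"
        using of_nat_mono[OF card_UN_le[OF fA, of R], where 'a = real] by simp
      also have "(\<Sum>e\<in>A. real (card (R e))) < (\<Sum>e\<in>A. b)"
      proof (rule sum_strict_mono[OF fA ne])
        show "real (card (R e)) < b" if "e \<in> A" for e
          using bad[of e] that unfolding R_def A_def by blast
      qed
      finally show False by (simp add: mult.commute)
    qed
    then have "40 * real (card A) \<le> real (card B)" by linarith
    then show "(\<Sum>i\<in>{e \<in> {e\<in>S. y e > 0}. x < y e}. 40 :: real) \<le> (\<Sum>j\<in>{f \<in> {f\<in>E. y f < 0}. x < 10 * (- y f)}. 1 :: real)"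
      unfolding A B by simp
  qed (use fin fS in auto)
  then show ?thesis by (simp add: sum_distrib_left)
qed


section \<open>Far encounters summed over the rows\<close>

lemma met_far_Un: "met_far (A \<union> B) fs = met_far A fs \<union> met_far B fs"
  by (auto simp: met_far_def)

lemma met_far_subset: "met_far Q fs \<subseteq> set fs"
  by (auto simp: met_far_def)

text \<open>Only sets of size at most \<open>2 s\<close> are controlled; a larger \<open>Q\<close> is cut into blocks of size \<open>s\<close>,
  each of which is joined with \<open>S\<close>.\<close>

lemma met_far_bound:
  fixes C :: real and fs :: "nat \<Rightarrow> 'e list"
  assumes fin: "finite Q" "S \<subseteq> Q" "card S \<le> s" "s > 0" "C \<ge> 0"
    and few: "\<And>R. R \<subseteq> Q \<Longrightarrow> R \<noteq> {} \<Longrightarrow> card R \<le> 2 * s \<Longrightarrow>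
      (\<Sum>i<m. real (far_hits R (fs i))) \<le> C * real (card R)"
  shows "(\<Sum>i<m. real (card (S \<inter> met_far Q (fs i)))) \<le> 3 * C * real (card Q)"
    and "(\<Sum>i<m. real (card (Q \<inter> met_far S (fs i)))) \<le> 3 * C * real (card Q)"
proof -
  have fS: "finite S" using fin finite_subset by blast
  have small: "(\<Sum>i<m. real (card (S \<inter> met_far B (fs i)))) \<le> C * real (card (S \<union> B))"
     "(\<Sum>i<m. real (card (B \<inter> met_far S (fs i)))) \<le> C * real (card (S \<union> B))"
    if "B \<subseteq> Q" "card (S \<union> B) \<le> 2 * s" for B
  proof -
    have *: "(\<Sum>i<m. real (far_hits (S \<union> B) (fs i))) \<le> C * real (card (S \<union> B))"
    proof (cases "S \<union> B = {}")
      case True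
      have "far_hits {} xs = 0" for xs :: "'e list" by (simp add: far_hits_def hits_def)
      then show ?thesis unfolding True by simp
    next
      case False
      then show ?thesis using few[of "S \<union> B"] that fin(2) by simp
    qed
    show "(\<Sum>i<m. real (card (S \<inter> met_far B (fs i)))) \<le> C * real (card (S \<union> B))"
      by (rule order_trans[OF sum_mono *]) (rule of_nat_mono[OF card_met_far])
    show "(\<Sum>i<m. real (card (B \<inter> met_far S (fs i)))) \<le> C * real (card (S \<union> B))"
      by (rule order_trans[OF sum_mono *], subst Un_commute) (rule of_nat_mono[OF card_met_far])
  qed
  have "(\<Sum>i<m. real (card (S \<inter> met_far Q (fs i)))) \<le> 3 * C * real (card Q) \<and>
    (\<Sum>i<m. real (card (Q \<inter> met_far S (fs i)))) \<le> 3 * C * real (card Q)"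
  proof (cases "card Q \<le> 2 * s")
    case True
    have "S \<union> Q = Q" using fin by auto
    moreover have "C * real (card Q) \<le> 3 * C * real (card Q)" using fin by simp
    ultimately show ?thesis using small[of Q] True by simp
  next
    case False
    have blk: "C * real (card (S \<union> B)) \<le> 2 * C * real s" "card (S \<union> B) \<le> 2 * s"
      if "card B \<le> s" for B
    proof -
      have *: "card (S \<union> B) \<le> 2 * s" using card_Un_le[of S B] that fin by linarith
      then have "real (card (S \<union> B)) \<le> 2 * real s" by linarith
      then show "C * real (card (S \<union> B)) \<le> 2 * C * real s"
        using mult_left_mono[of "real (card (S \<union> B))" "2 * real s" C] fin by simp
      show "card (S \<union> B) \<le> 2 * s" by fact
    qed
    have "(\<Sum>i<m. real (card (S \<inter> met_far Q (fs i)))) \<le> 2 * C * (real (card Q) + real s)"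
    proof (rule subadditive_blocks[OF \<open>finite Q\<close> \<open>s > 0\<close>,
          where F = "\<lambda>Q. \<Sum>i<m. real (card (S \<inter> met_far Q (fs i)))"])
      fix A B
      have "real (card (S \<inter> met_far (A \<union> B) (fs i))) \<le>
        real (card (S \<inter> met_far A (fs i))) + real (card (S \<inter> met_far B (fs i)))" for i
        using card_Un_le[of "S \<inter> met_far A (fs i)" "S \<inter> met_far B (fs i)"]
        unfolding met_far_Un Int_Un_distrib of_nat_add[symmetric] by (rule of_nat_mono)
      then show "(\<Sum>i<m. real (card (S \<inter> met_far (A \<union> B) (fs i)))) \<le>
        (\<Sum>i<m. real (card (S \<inter> met_far A (fs i)))) + (\<Sum>i<m. real (card (S \<inter> met_far B (fs i))))"
        unfolding sum.distrib[symmetric] by (intro sum_mono)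
    next
      fix B assume "B \<subseteq> Q" "card B \<le> s"
      then show "(\<Sum>i<m. real (card (S \<inter> met_far B (fs i)))) \<le> 2 * C * real s"
        using small(1)[of B] blk[of B] by linarith
    qed
    moreover have "(\<Sum>i<m. real (card (Q \<inter> met_far S (fs i)))) \<le> 2 * C * (real (card Q) + real s)"
    proof (rule subadditive_blocks[OF \<open>finite Q\<close> \<open>s > 0\<close>,
          where F = "\<lambda>Q. \<Sum>i<m. real (card (Q \<inter> met_far S (fs i)))"])
      fix A B
      have "real (card ((A \<union> B) \<inter> met_far S (fs i))) \<le>
        real (card (A \<inter> met_far S (fs i))) + real (card (B \<inter> met_far S (fs i)))" for i
        using card_Un_le[of "A \<inter> met_far S (fs i)" "B \<inter> met_far S (fs i)"]
        unfolding Int_Un_distrib2 of_nat_add[symmetric] by (rule of_nat_mono)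
      then show "(\<Sum>i<m. real (card ((A \<union> B) \<inter> met_far S (fs i)))) \<le>
        (\<Sum>i<m. real (card (A \<inter> met_far S (fs i)))) + (\<Sum>i<m. real (card (B \<inter> met_far S (fs i))))"
        unfolding sum.distrib[symmetric] by (intro sum_mono)
    next
      fix B assume "B \<subseteq> Q" "card B \<le> s"
      then show "(\<Sum>i<m. real (card (B \<inter> met_far S (fs i)))) \<le> 2 * C * real s"
        using small(2)[of B] blk[of B] by linarith
    qed
    moreover have "2 * C * (real (card Q) + real s) \<le> 3 * C * real (card Q)"
    proof -
      have "2 * (real (card Q) + real s) \<le> 3 * real (card Q)"
        using of_nat_mono[of "2 * s" "card Q", where 'a = real] False by simp
      from mult_left_mono[OF this \<open>C \<ge> 0\<close>] show ?thesis by (simp add: algebra_simps)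
    qed
    ultimately show ?thesis by linarith
  qed
  then show "(\<Sum>i<m. real (card (S \<inter> met_far Q (fs i)))) \<le> 3 * C * real (card Q)"
    and "(\<Sum>i<m. real (card (Q \<inter> met_far S (fs i)))) \<le> 3 * C * real (card Q)" by auto
qed

lemma sum_swap_rows:
  fixes z :: "'e \<Rightarrow> real" and m :: nat
  assumes "finite E"
  shows "(\<Sum>i<m. \<Sum>e\<in>{e\<in>E. R i e}. z e) = (\<Sum>e\<in>E. real (card {i. i < m \<and> R i e}) * z e)"
proof -
  have "(\<Sum>i<m. \<Sum>e\<in>{e\<in>E. R i e}. z e) = (\<Sum>i<m. \<Sum>e\<in>E. if R i e then z e else 0)"
    using assms by (simp add: sum.inter_filter)
  also have "\<dots> = (\<Sum>e\<in>E. \<Sum>i<m. if R i e then z e else 0)" by (rule sum.swap)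
  also have "\<dots> = (\<Sum>e\<in>E. real (card {i. i < m \<and> R i e}) * z e)"
  proof (rule sum.cong[OF refl])
    fix e
    have "(\<Sum>i<m. if R i e then z e else 0) = (\<Sum>i\<in>{i\<in>{..<m}. R i e}. z e)"
      by (rule sum.inter_filter[symmetric]) simp
    then show "(\<Sum>i<m. if R i e then z e else 0) = real (card {i. i < m \<and> R i e}) * z e" by simp
  qed
  finally show ?thesis .
qed

lemma card_rows_eq:
  fixes m :: nat
  assumes "finite E"
  shows "(\<Sum>e\<in>{e\<in>E. P e}. real (card {i. i < m \<and> R i e})) = (\<Sum>i<m. real (card {e\<in>E. P e \<and> R i e}))"
  using sum_swap_rows[where E = "{e\<in>E. P e}" and R = R and z = "\<lambda>_. 1" and m = m] assms by simp

text \<open>Double counting of \<open>|y e|\<close> over the rows in which \<open>e\<close> in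
  \<open>S\<close> has a useful step. If \<open>S\<close> held half of the mass, the edges outside
  \<open>bad\<close> would hold a quarter, each in at least \<open>b\<close> rows; the row equations
  allow a total of only \<open>23 * C * Y\<close>, while \<open>b\<close> is
  \<open>400 * C\<close>.\<close>

lemma null_space_property:
  fixes y :: "'e \<Rightarrow> real" and fs :: "nat \<Rightarrow> 'e list" and a :: "nat \<Rightarrow> 'e \<Rightarrow> nat"
  assumes fin: "finite E" "S \<subseteq> E" "card S \<le> s" and d: "d > 0"
    and rows: "\<And>i. i < m \<Longrightarrow> set (fs i) \<subseteq> E"
    and a2: "\<And>i e. i < m \<Longrightarrow> a i e \<le> 2"
    and a0: "\<And>i e. i < m \<Longrightarrow> a i e > 0 \<longleftrightarrow> e \<in> set (fs i)"
    and null: "\<And>i. i < m \<Longrightarrow> (\<Sum>e\<in>E. real (a i e) * y e) = 0"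
    and iso: "\<And>A B. A \<subseteq> E \<Longrightarrow> B \<subseteq> E \<Longrightarrow> A \<noteq> {} \<Longrightarrow> A \<inter> B = {} \<Longrightarrow> card A \<le> s \<Longrightarrow>
      card B \<le> 40 * card A \<Longrightarrow>
      4 / 10^7 * d * real (card A) \<le> real (card {i. i < m \<and> isolated A B (fs i) > 0})"
    and few: "\<And>R. R \<subseteq> E \<Longrightarrow> R \<noteq> {} \<Longrightarrow> card R \<le> 2 * s \<Longrightarrow>
      (\<Sum>i<m. real (far_hits R (fs i))) \<le> 1 / 10^9 * d * real (card R)"
    and nz: "\<exists>e\<in>E. y e \<noteq> 0"
  shows "2 * (\<Sum>e\<in>S. \<bar>y e\<bar>) < (\<Sum>e\<in>E. \<bar>y e\<bar>)"
proof (rule ccontr)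
  assume big: "\<not> ?thesis"
  define Y where "Y = (\<Sum>e\<in>E. \<bar>y e\<bar>)"
  obtain e0 where e0: "e0 \<in> E" "y e0 \<noteq> 0" using nz by blast
  have "\<bar>y e0\<bar> \<le> Y" unfolding Y_def using member_le_sum[OF e0(1), of "\<lambda>e. \<bar>y e\<bar>"] fin(1) by simp
  then have Ypos: "Y > 0" using e0(2) by linarith
  have fS: "finite S" by (rule finite_subset[OF fin(2,1)])
  have bigS: "(\<Sum>e\<in>S. \<bar>y e\<bar>) \<ge> Y / 2" using big unfolding Y_def by linarith
  have "S \<noteq> {}" using bigS Ypos by auto
  then have s: "s > 0" using fin fS card_gt_0_iff[of S] by linarith
  define b where "b = 4 / 10^7 * d"
  define C where "C = 1 / 10^9 * d"
  have C0: "C \<ge> 0" using d by (simp add: C_def)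
  define ok where "ok i e \<longleftrightarrow> (\<exists>l. agreeable y e (fs i) l)" for i e
  define bad where "bad = {e\<in>S. real (card {i. i < m \<and> ok i e}) < b}"
  have badS: "bad \<subseteq> S" by (auto simp: bad_def)
  have isoS: "b * real (card A) \<le> real (card {i. i < m \<and> isolated A B (fs i) > 0})"
    if "A \<subseteq> bad" "B \<subseteq> E" "A \<noteq> {}" "A \<inter> B = {}" "card B \<le> 40 * card A" for A B
  proof -
    have AS: "A \<subseteq> S" using that(1) badS by blast
    then have "A \<subseteq> E" "card A \<le> s" using fin card_mono[OF fS AS] by auto
    then show ?thesis unfolding b_def using iso that by blast
  qed
  have bad_pos: "40 * (\<Sum>e\<in>{e\<in>bad. y e > 0}. y e) \<le> 10 * (\<Sum>f\<in>{f\<in>E. y f < 0}. - y f)"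
    by (rule obstructed_mass[where b = b and m = m and fs = fs])
      (use fin badS rows isoS in \<open>auto simp: bad_def ok_def\<close>)
  have agree_neg: "agreeable (\<lambda>e. - y e) e xs l = agreeable y e xs l" for e xs l
    by (simp add: agreeable_def)
  have bad_neg: "40 * (\<Sum>e\<in>{e\<in>bad. - y e > 0}. - y e) \<le> 10 * (\<Sum>f\<in>{f\<in>E. - y f < 0}. - (- y f))"
    by (rule obstructed_mass[where b = b and m = m and fs = fs and y = "\<lambda>e. - y e"])
      (use fin badS rows isoS in \<open>auto simp: bad_def ok_def agree_neg\<close>)
  have split: "(\<Sum>e\<in>X. \<bar>y e\<bar>) = (\<Sum>e\<in>{e\<in>X. y e > 0}. y e) + (\<Sum>e\<in>{e\<in>X. y e < 0}. - y e)"
    if "finite X" for X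
  proof -
    have "(\<Sum>e\<in>X. \<bar>y e\<bar>) = (\<Sum>e\<in>X. (if y e > 0 then y e else 0) + (if y e < 0 then - y e else 0))"
      by (rule sum.cong) auto
    then show ?thesis using that by (simp add: sum.distrib sum.inter_filter)
  qed
  have fbad: "finite bad" by (rule finite_subset[OF badS fS])
  \<comment> \<open>The positive bad mass is at most a quarter of the negative mass of
    \<open>y\<close>, and conversely; the two bounds add up to \<open>Y / 4\<close>.\<close>
  have badmass: "(\<Sum>e\<in>bad. \<bar>y e\<bar>) \<le> Y / 4"
    using bad_pos bad_neg split[OF fbad] split[OF fin(1)] by (simp add: Y_def)
  \<comment> \<open>\<open>WL\<close> marks edges of \<open>S\<close> met far from an entry at least
    as large; these are charged to themselves. \<open>WR\<close> marks edges met far from a strictly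
    larger entry in \<open>S\<close>; they absorb the row equation of an edge not in
    \<open>L i\<close>. In both cases the marked edge is the smaller of the two, so its partner lies
    in every strict level set containing it and the far-hit bounds apply level by level.\<close>
  define WL where "WL i e \<longleftrightarrow> e \<in> S \<and> (\<exists>l l'. l < length (fs i) \<and> l' < length (fs i) \<and> far l l' \<and>
    fs i ! l = e \<and> \<bar>y e\<bar> \<le> \<bar>y (fs i ! l')\<bar>)" for i e
  define WR where "WR i g \<longleftrightarrow> (\<exists>l l'. l < length (fs i) \<and> l' < length (fs i) \<and> far l l' \<and>
    fs i ! l = g \<and> fs i ! l' \<in> S \<and> \<bar>y g\<bar> < \<bar>y (fs i ! l')\<bar>)" for i g
  define L where "L i = {e\<in>E. WL i e}" for i
  define R where "R i = {e\<in>E. WR i e}" for i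
  have inE: "fs i ! l \<in> E" if "i < m" "l < length (fs i)" for i l
    using rows[OF that(1)] nth_mem[OF that(2)] by blast
  have layers: "(\<Sum>i<m. real (card (S \<inter> {e\<in>E. x < \<bar>y e\<bar>} \<inter> met_far {e\<in>E. x < \<bar>y e\<bar>} (fs i)))) \<le> 3 * C * real (card {e\<in>E. x < \<bar>y e\<bar>})"
    "(\<Sum>i<m. real (card ({e\<in>E. x < \<bar>y e\<bar>} \<inter> met_far (S \<inter> {e\<in>E. x < \<bar>y e\<bar>}) (fs i)))) \<le> 3 * C * real (card {e\<in>E. x < \<bar>y e\<bar>})"
    for x
  proof -
    have cS: "card (S \<inter> {e\<in>E. x < \<bar>y e\<bar>}) \<le> s"
      using card_mono[OF fS, of "S \<inter> {e\<in>E. x < \<bar>y e\<bar>}"] fin(3) by simp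
    have few': "(\<Sum>i<m. real (far_hits R (fs i))) \<le> C * real (card R)"
      if "R \<subseteq> {e\<in>E. x < \<bar>y e\<bar>}" "R \<noteq> {}" "card R \<le> 2 * s" for R
      unfolding C_def by (rule few) (use that in auto)
    show "(\<Sum>i<m. real (card (S \<inter> {e\<in>E. x < \<bar>y e\<bar>} \<inter> met_far {e\<in>E. x < \<bar>y e\<bar>} (fs i)))) \<le> 3 * C * real (card {e\<in>E. x < \<bar>y e\<bar>})"
     "(\<Sum>i<m. real (card ({e\<in>E. x < \<bar>y e\<bar>} \<inter> met_far (S \<inter> {e\<in>E. x < \<bar>y e\<bar>}) (fs i)))) \<le> 3 * C * real (card {e\<in>E. x < \<bar>y e\<bar>})"
      using met_far_bound[where Q = "{e\<in>E. x < \<bar>y e\<bar>}" and m = m and fs = fs, OF _ _ cS s C0 few']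
        fin(1) by simp_all
  qed
  have mass: "(\<Sum>i<m. \<Sum>e\<in>{e\<in>E. W i e}. \<bar>y e\<bar>) \<le> 3 * C * Y"
    if W: "\<And>x. 0 \<le> x \<Longrightarrow> (\<Sum>i<m. real (card {e\<in>E. x < \<bar>y e\<bar> \<and> W i e})) \<le> 3 * C * real (card {e\<in>E. x < \<bar>y e\<bar>})"
    for W
  proof -
    have "(\<Sum>e\<in>E. real (card {i. i < m \<and> W i e}) * \<bar>y e\<bar>) \<le> (\<Sum>e\<in>E. 3 * C * \<bar>y e\<bar>)"
    proof (rule layer_cake[where u = "\<lambda>e. \<bar>y e\<bar>" and v = "\<lambda>e. \<bar>y e\<bar>" and b = "\<lambda>_. 3 * C"])
      fix x :: real assume "0 \<le> x"
      from W[OF this] show "(\<Sum>e\<in>{e\<in>E. x < \<bar>y e\<bar>}. real (card {i. i < m \<and> W i e})) \<le> (\<Sum>e\<in>{e\<in>E. x < \<bar>y e\<bar>}. 3 * C)"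
        by (simp add: card_rows_eq[OF fin(1)] mult.commute)
    qed (use fin in auto)
    then show ?thesis by (simp add: sum_swap_rows[OF fin(1)] Y_def sum_distrib_left)
  qed
  have Lmass: "(\<Sum>i<m. \<Sum>e\<in>L i. \<bar>y e\<bar>) \<le> 3 * C * Y"
    unfolding L_def
  proof (rule mass[where W = WL])
    fix x :: real assume "0 \<le> x"
    show "(\<Sum>i<m. real (card {e\<in>E. x < \<bar>y e\<bar> \<and> WL i e})) \<le> 3 * C * real (card {e\<in>E. x < \<bar>y e\<bar>})"
    proof (rule order_trans[OF sum_mono layers(1)[of x]], intro of_nat_mono card_mono)
      fix i assume i: "i \<in> {..<m}"
      show "{e\<in>E. x < \<bar>y e\<bar> \<and> WL i e} \<subseteq> S \<inter> {e\<in>E. x < \<bar>y e\<bar>} \<inter> met_far {e\<in>E. x < \<bar>y e\<bar>} (fs i)"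
      proof
        fix e assume e: "e \<in> {e\<in>E. x < \<bar>y e\<bar> \<and> WL i e}"
        then obtain l l' where l: "l < length (fs i)" "l' < length (fs i)" "far l l'" "fs i ! l = e"
          "\<bar>y e\<bar> \<le> \<bar>y (fs i ! l')\<bar>" by (auto simp: WL_def)
        have l'E: "fs i ! l' \<in> E" using inE[of i l'] i l by simp
        have x': "x < \<bar>y (fs i ! l')\<bar>" using e l by auto
        have mf: "e \<in> met_far X (fs i)" if "fs i ! l' \<in> X" for X
          unfolding met_far_def using l that by blast
        show "e \<in> S \<inter> {e\<in>E. x < \<bar>y e\<bar>} \<inter> met_far {e\<in>E. x < \<bar>y e\<bar>} (fs i)"
          using e l(5) x' l'E mf[of "{e\<in>E. x < \<bar>y e\<bar>}"] mf[of "S \<inter> {e\<in>E. x < \<bar>y e\<bar>}"]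
          by (simp add: WL_def)
      qed
    qed (use fin in auto)
  qed
  have Rmass: "(\<Sum>i<m. \<Sum>e\<in>R i. \<bar>y e\<bar>) \<le> 3 * C * Y"
    unfolding R_def
  proof (rule mass[where W = WR])
    fix x :: real assume "0 \<le> x"
    show "(\<Sum>i<m. real (card {e\<in>E. x < \<bar>y e\<bar> \<and> WR i e})) \<le> 3 * C * real (card {e\<in>E. x < \<bar>y e\<bar>})"
    proof (rule order_trans[OF sum_mono layers(2)[of x]], intro of_nat_mono card_mono)
      fix i assume i: "i \<in> {..<m}"
      show "{e\<in>E. x < \<bar>y e\<bar> \<and> WR i e} \<subseteq> {e\<in>E. x < \<bar>y e\<bar>} \<inter> met_far (S \<inter> {e\<in>E. x < \<bar>y e\<bar>}) (fs i)"
      proof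
        fix e assume e: "e \<in> {e\<in>E. x < \<bar>y e\<bar> \<and> WR i e}"
        then obtain l l' where l: "l < length (fs i)" "l' < length (fs i)" "far l l'" "fs i ! l = e"
          "fs i ! l' \<in> S \<and> \<bar>y e\<bar> < \<bar>y (fs i ! l')\<bar>" by (auto simp: WR_def)
        have l'E: "fs i ! l' \<in> E" using inE[of i l'] i l by simp
        have x': "x < \<bar>y (fs i ! l')\<bar>" using e l by auto
        have mf: "e \<in> met_far X (fs i)" if "fs i ! l' \<in> X" for X
          unfolding met_far_def using l that by blast
        show "e \<in> {e\<in>E. x < \<bar>y e\<bar>} \<inter> met_far (S \<inter> {e\<in>E. x < \<bar>y e\<bar>}) (fs i)"
          using e l(5) x' l'E mf[of "{e\<in>E. x < \<bar>y e\<bar>}"] mf[of "S \<inter> {e\<in>E. x < \<bar>y e\<bar>}"]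
          by (simp add: WL_def)
      qed
    qed (use fin in auto)
  qed
  have row: "6 / 10 * (\<Sum>e\<in>{e\<in>S. ok i e} - L i. \<bar>y e\<bar>) \<le> 4 * (\<Sum>g\<in>R i. \<bar>y g\<bar>)" if i: "i < m" for i
  proof -
    define P where "P = {l. l < length (fs i) \<and> fs i ! l \<in> S \<and> agreeable y (fs i ! l) (fs i) l \<and> fs i ! l \<notin> L i}"
    have fP: "finite P" by (rule finite_subset[of _ "{..<length (fs i)}"]) (auto simp: P_def)
    \<comment> \<open>A useful step outside \<open>L i\<close> strictly dominates all far entries of
      its row. Two such steps cannot be far apart, as each would dominate the other; hence at most
      two positions remain, and the mass of \<open>R i\<close> is spent at most twice.\<close>
    have dom: "\<bar>y (fs i ! l')\<bar> < \<bar>y (fs i ! l)\<bar>" if "l \<in> P" "l' < length (fs i)" "far l l'" for l l'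
    proof (rule ccontr)
      assume "\<not> ?thesis"
      then have "fs i ! l \<in> L i" using that inE[OF i] unfolding L_def WL_def P_def by force
      then show False using that by (simp add: P_def)
    qed
    have near: "\<not> far l l'" if "l \<in> P" "l' \<in> P" for l l'
      using dom[of l l'] dom[of l' l] that by (force simp: P_def far_def)
    have cP: "card P \<le> 2"
    proof (cases "P = {}")
      case False
      have "P \<subseteq> {Min P, Suc (Min P)}"
      proof
        fix l assume "l \<in> P"
        then have "Min P \<le> l" "\<not> far (Min P) l" using near fP False by auto
        then show "l \<in> {Min P, Suc (Min P)}" by (auto simp: far_def)
      qed
      from card_mono[OF _ this] show ?thesis by simp
    qed simp
    have one: "6 / 10 * \<bar>y (fs i ! l)\<bar> \<le> 2 * (\<Sum>g\<in>R i. \<bar>y g\<bar>)" if l: "l \<in> P" for l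
    proof (cases "y (fs i ! l) = 0")
      case True
      then show ?thesis by (simp add: sum_nonneg)
    next
      case False
      define e where "e = fs i ! l"
      define f where "f = fs i ! (l - 1)"
      define g where "g = fs i ! (l + 1)"
      have y0: "y e \<noteq> 0" using False by (simp add: e_def)
      have ll: "l < length (fs i)" and eS: "e \<in> S" and ag: "agreeable y e (fs i) l"
        using l by (auto simp: P_def e_def)
      have eE: "e \<in> E" using inE[OF i ll] by (simp add: e_def)
      have nb: "- (sgn (y e) * y h) \<le> \<bar>y e\<bar> / 10" if "h = f \<or> h = g" for h
      proof -
        have "- (y e)\<^sup>2 \<le> 10 * y e * y h" using ag that by (auto simp: agreeable_def f_def g_def)
        then have "y e * (10 * y h + y e) \<ge> 0" by (simp add: power2_eq_square algebra_simps)
        then show ?thesis using y0 by (cases "y e > 0") (auto simp: zero_le_mult_iff)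
      qed
      \<comment> \<open>An edge may be met several times; any one occurrence decides. Next to
        \<open>l\<close>, coefficient 2 times the tolerance \<open>|y e| / 10\<close> gives
        \<open>|y e| / 5\<close>; far from \<open>l\<close>, domination puts \<open>h\<close> into
        \<open>R i\<close>. Summation leaves \<open>6 / 10\<close> of \<open>|y e|\<close> against
        \<open>R i\<close>.\<close>
      have entry: "- (real (a i h) * (sgn (y e) * y h)) \<le>
          (if h = f then \<bar>y e\<bar> / 5 else 0) + (if h = g then \<bar>y e\<bar> / 5 else 0) + (if h \<in> R i then 2 * \<bar>y h\<bar> else 0)"
        if h: "h \<in> E - {e}" for h
      proof (cases "h \<in> set (fs i)")
        case False
        then have "a i h = 0" using a0[OF i, of h] by simp
        then show ?thesis by simp
      next
        case True
        have a: "0 \<le> real (a i h)" "real (a i h) \<le> 2" using a2[OF i, of h] by auto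
        obtain l' where l': "l' < length (fs i)" "fs i ! l' = h" using True by (auto simp: in_set_conv_nth)
        have "l' \<noteq> l" using l' h by (auto simp: e_def)
        then have "l' = l - 1 \<or> l' = l + 1 \<or> far l l'" unfolding far_def by linarith
        then consider "h = f \<or> h = g" | "far l l'"
          using l'(2) unfolding f_def g_def by blast
        then show ?thesis
        proof cases
          case 1
          have "real (a i h) * (- (sgn (y e) * y h)) \<le> 2 * (\<bar>y e\<bar> / 10)"
          proof (cases "- (sgn (y e) * y h) \<le> 0")
            case True
            then have "real (a i h) * (- (sgn (y e) * y h)) \<le> 0" using a by (intro mult_nonneg_nonpos)
            then show ?thesis by (smt (verit) abs_ge_zero divide_nonneg_nonneg)
          next
            case False
            then show ?thesis using a nb[OF 1] by (intro mult_mono) auto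
          qed
          moreover have "0 \<le> (if h \<in> R i then 2 * \<bar>y h\<bar> else 0)" "0 \<le> \<bar>y e\<bar> / 5" by auto
          moreover have "\<bar>y e\<bar> / 5 \<le> (if h = f then \<bar>y e\<bar> / 5 else 0) + (if h = g then \<bar>y e\<bar> / 5 else 0)"
            using 1 by auto
          ultimately show ?thesis by linarith
        next
          case 2
          have "\<bar>y h\<bar> < \<bar>y e\<bar>" using dom[OF l l'(1) 2] l' by (simp add: e_def)
          then have "h \<in> R i" unfolding R_def WR_def using h l' ll 2 eS
            by (auto simp: e_def far_def)
          moreover have "- (real (a i h) * (sgn (y e) * y h)) \<le> \<bar>real (a i h) * (sgn (y e) * y h)\<bar>"
            by linarith
          moreover have "\<bar>real (a i h) * (sgn (y e) * y h)\<bar> = real (a i h) * \<bar>y h\<bar>"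
            using y0 by (simp add: abs_mult abs_sgn_eq)
          moreover have "real (a i h) * \<bar>y h\<bar> \<le> 2 * \<bar>y h\<bar>" using a by (intro mult_right_mono) auto
          moreover have "0 \<le> \<bar>y e\<bar> / 5" by simp
          ultimately show ?thesis by (auto simp: if_splits)
        qed
      qed
      have "a i e > 0" using a0[OF i] ll by (auto simp: e_def)
      then have "\<bar>y e\<bar> \<le> real (a i e) * \<bar>y e\<bar>"
        using mult_right_mono[of 1 "real (a i e)" "\<bar>y e\<bar>"] by simp
      also have "\<dots> = (\<Sum>h\<in>E - {e}. - (real (a i h) * (sgn (y e) * y h)))"
      proof -
        have "0 = sgn (y e) * (\<Sum>h\<in>E. real (a i h) * y h)" using null[OF i] by simp
        also have "\<dots> = (\<Sum>h\<in>E. real (a i h) * (sgn (y e) * y h))"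
          by (simp add: sum_distrib_left mult.left_commute)
        also have "\<dots> = real (a i e) * (sgn (y e) * y e) + (\<Sum>h\<in>E - {e}. real (a i h) * (sgn (y e) * y h))"
          using eE fin(1) by (rule sum.remove[rotated])
        also have "sgn (y e) * y e = \<bar>y e\<bar>" by (simp add: abs_sgn mult.commute)
        finally show ?thesis by (simp add: sum_negf)
      qed
      also have "\<dots> \<le> (\<Sum>h\<in>E - {e}. (if h = f then \<bar>y e\<bar> / 5 else 0) + (if h = g then \<bar>y e\<bar> / 5 else 0)
          + (if h \<in> R i then 2 * \<bar>y h\<bar> else 0))"
        by (rule sum_mono[OF entry])
      also have "\<dots> \<le> (\<Sum>h\<in>E. (if h = f then \<bar>y e\<bar> / 5 else 0) + (if h = g then \<bar>y e\<bar> / 5 else 0)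
          + (if h \<in> R i then 2 * \<bar>y h\<bar> else 0))"
        by (rule sum_mono2) (use fin in auto)
      also have "\<dots> = (\<Sum>h\<in>E. if h = f then \<bar>y e\<bar> / 5 else 0) + (\<Sum>h\<in>E. if h = g then \<bar>y e\<bar> / 5 else 0)
          + (\<Sum>h\<in>E. if h \<in> R i then 2 * \<bar>y h\<bar> else 0)"
        by (simp add: sum.distrib)
      also have "(\<Sum>h\<in>E. if h \<in> R i then 2 * \<bar>y h\<bar> else 0) = 2 * (\<Sum>h\<in>R i. \<bar>y h\<bar>)"
      proof -
        have "{h\<in>E. h \<in> R i} = R i" by (auto simp: R_def)
        then show ?thesis using sum.inter_filter[OF fin(1), of "\<lambda>h. 2 * \<bar>y h\<bar>" "\<lambda>h. h \<in> R i"]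
          by (simp add: sum_distrib_left)
      qed
      finally have "\<bar>y e\<bar> \<le> \<bar>y e\<bar> / 5 + \<bar>y e\<bar> / 5 + 2 * (\<Sum>h\<in>R i. \<bar>y h\<bar>)"
        using fin(1) by (simp split: if_splits)
      then show ?thesis by (simp add: e_def)
    qed
    have sub: "{e\<in>S. ok i e} - L i \<subseteq> (\<lambda>l. fs i ! l) ` P"
    proof
      fix e assume e: "e \<in> {e\<in>S. ok i e} - L i"
      then obtain l where l: "agreeable y e (fs i) l" by (auto simp: ok_def)
      then have "fs i ! l = e" "l < length (fs i)" by (auto simp: agreeable_def)
      then have "l \<in> P" using e l by (auto simp: P_def)
      then show "e \<in> (\<lambda>l. fs i ! l) ` P" using \<open>fs i ! l = e\<close> by blast
    qed
    have "(\<Sum>e\<in>{e\<in>S. ok i e} - L i. \<bar>y e\<bar>) \<le> (\<Sum>e\<in>(\<lambda>l. fs i ! l) ` P. \<bar>y e\<bar>)"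
      by (rule sum_mono2[OF _ sub]) (use fP in auto)
    also have "\<dots> \<le> (\<Sum>l\<in>P. \<bar>y (fs i ! l)\<bar>)"
      using sum_image_le[OF fP, of "\<lambda>e. \<bar>y e\<bar>" "\<lambda>l. fs i ! l"] by (simp add: o_def)
    finally have "6 / 10 * (\<Sum>e\<in>{e\<in>S. ok i e} - L i. \<bar>y e\<bar>) \<le> (\<Sum>l\<in>P. 6 / 10 * \<bar>y (fs i ! l)\<bar>)"
      unfolding sum_distrib_left[symmetric] by simp
    also have "\<dots> \<le> (\<Sum>l\<in>P. 2 * (\<Sum>g\<in>R i. \<bar>y g\<bar>))" by (rule sum_mono[OF one])
    also have "\<dots> = real (card P) * (2 * (\<Sum>g\<in>R i. \<bar>y g\<bar>))" by simp
    also have "\<dots> \<le> 2 * (2 * (\<Sum>g\<in>R i. \<bar>y g\<bar>))"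
      using cP by (intro mult_right_mono) (auto simp: sum_nonneg)
    finally show ?thesis by simp
  qed
  have "(\<Sum>i<m. 6 / 10 * (\<Sum>e\<in>{e\<in>S. ok i e} - L i. \<bar>y e\<bar>)) \<le> (\<Sum>i<m. 4 * (\<Sum>g\<in>R i. \<bar>y g\<bar>))"
    by (intro sum_mono row) simp
  then have rowsum: "6 / 10 * (\<Sum>i<m. \<Sum>e\<in>{e\<in>S. ok i e} - L i. \<bar>y e\<bar>) \<le> 12 * C * Y"
    using Rmass unfolding sum_distrib_left[symmetric] by simp
  have "(\<Sum>i<m. \<Sum>e\<in>{e\<in>S. ok i e}. \<bar>y e\<bar>) \<le> (\<Sum>i<m. (\<Sum>e\<in>{e\<in>S. ok i e} - L i. \<bar>y e\<bar>) + (\<Sum>e\<in>L i. \<bar>y e\<bar>))"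
  proof (rule sum_mono)
    fix i
    have fL: "finite (L i)" using fin by (simp add: L_def)
    have "(\<Sum>e\<in>{e\<in>S. ok i e}. \<bar>y e\<bar>) \<le> (\<Sum>e\<in>({e\<in>S. ok i e} - L i) \<union> L i. \<bar>y e\<bar>)"
      by (rule sum_mono2) (use fL fS in auto)
    also have "\<dots> = (\<Sum>e\<in>{e\<in>S. ok i e} - L i. \<bar>y e\<bar>) + (\<Sum>e\<in>L i. \<bar>y e\<bar>)"
      by (rule sum.union_disjoint) (use fL fS in auto)
    finally show "(\<Sum>e\<in>{e\<in>S. ok i e}. \<bar>y e\<bar>) \<le> (\<Sum>e\<in>{e\<in>S. ok i e} - L i. \<bar>y e\<bar>) + (\<Sum>e\<in>L i. \<bar>y e\<bar>)" .
  qed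
  then have oksum: "(\<Sum>i<m. \<Sum>e\<in>{e\<in>S. ok i e}. \<bar>y e\<bar>) \<le> 23 * C * Y"
    using rowsum Lmass by (simp add: sum.distrib)
  \<comment> \<open>The \<open>23\<close> is \<open>20 + 3\<close>: the row equations give
    \<open>12 * C * Y / (6 / 10)\<close>, and the edges charged to themselves give
    \<open>3 * C * Y\<close>.\<close>
  have "b * (Y / 4) \<le> b * ((\<Sum>e\<in>S. \<bar>y e\<bar>) - (\<Sum>e\<in>bad. \<bar>y e\<bar>))"
    using bigS badmass d by (intro mult_left_mono) (auto simp: b_def)
  also have "\<dots> = (\<Sum>e\<in>S - bad. b * \<bar>y e\<bar>)"
    using badS fS by (simp add: sum_diff sum_distrib_left right_diff_distrib)
  also have "\<dots> \<le> (\<Sum>e\<in>S - bad. real (card {i. i < m \<and> ok i e}) * \<bar>y e\<bar>)"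
    by (intro sum_mono mult_right_mono) (auto simp: bad_def)
  also have "\<dots> \<le> (\<Sum>e\<in>S. real (card {i. i < m \<and> ok i e}) * \<bar>y e\<bar>)"
    using fS by (intro sum_mono2) auto
  also have "\<dots> \<le> 23 * C * Y" using oksum sum_swap_rows[OF fS, where R = ok and z = "\<lambda>e. \<bar>y e\<bar>" and m = m] by simp
  finally have "b / 4 \<le> 23 * C" using Ypos by (simp add: field_simps)
  then show False using d by (simp add: b_def C_def field_simps)
qed

section \<open>The walk operator\<close>

definition walk_op :: "'a set \<Rightarrow> 'a set set \<Rightarrow> ('a \<Rightarrow> real) \<Rightarrow> 'a \<Rightarrow> real" where
  "walk_op V E g v = (\<Sum>u\<in>nbrs V E v. g u) / real (deg V E v)"

text \<open>The expectation of a functional of the traversed edge sequence, by conditioning on the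
  first step. This keeps all moment computations finite and algebraic; measures enter only through
  \<open>expectation_walk_from\<close>.\<close>

fun walk_exp :: "'a set \<Rightarrow> 'a set set \<Rightarrow> nat \<Rightarrow> 'a \<Rightarrow> ('a set list \<Rightarrow> real) \<Rightarrow> real" where
  "walk_exp V E 0 v g = g []"
| "walk_exp V E (Suc t) v g = walk_op V E (\<lambda>u. walk_exp V E t u (\<lambda>fs. g ({v, u} # fs))) v"

locale walk_graph =
  fixes V :: "'a set" and E :: "'a set set"
  assumes graph: "graph V E" and nbrs_ne: "\<And>v. v \<in> V \<Longrightarrow> nbrs V E v \<noteq> {}" and V_ne: "V \<noteq> {}"
begin

abbreviation "P \<equiv> walk_op V E"
abbreviation "nb \<equiv> nbrs V E"
abbreviation "dg \<equiv> deg V E"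
abbreviation "\<mu> \<equiv> stat_dist V E"

definition mean :: "('a \<Rightarrow> real) \<Rightarrow> real" where
  "mean g = (\<Sum>v\<in>V. \<mu> v * g v)"

definition ip :: "('a \<Rightarrow> real) \<Rightarrow> ('a \<Rightarrow> real) \<Rightarrow> real" where
  "ip f g = mean (\<lambda>v. f v * g v)"

lemma finV [simp]: "finite V" using graph by (simp add: graph_def)

lemma E_sub: "E \<subseteq> Pow V" using graph by (auto simp: graph_def)

lemma finE [simp]: "finite E" using E_sub finV by (meson finite_Pow_iff finite_subset)

lemma fin_nb [simp]: "finite (nb v)" by (simp add: nbrs_def)

lemma nb_iff: "u \<in> nb v \<longleftrightarrow> {v, u} \<in> E"
  using E_sub by (auto simp: nbrs_def)

lemma nb_sub: "u \<in> nb v \<Longrightarrow> u \<in> V" by (simp add: nbrs_def)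

lemma nb_sym: "u \<in> nb v \<longleftrightarrow> v \<in> nb u"
  by (simp add: nb_iff insert_commute)

lemma dg_pos: "v \<in> V \<Longrightarrow> dg v > 0"
  using nbrs_ne[of v] by (simp add: deg_def card_gt_0_iff)

lemma card_nb: "card (nb v) = dg v" by (simp add: deg_def)

lemma edge_card: assumes "e \<in> E" shows "card e = 2" "e \<subseteq> V"
proof -
  obtain a b where "e = {a, b}" "a \<noteq> b" "a \<in> V" "b \<in> V" using graph assms unfolding graph_def by blast
  then show "card e = 2" "e \<subseteq> V" by auto
qed

lemma swap_nb: "(\<Sum>v\<in>V. \<Sum>u\<in>nb v. \<phi> v u) = (\<Sum>u\<in>V. \<Sum>v\<in>nb u. \<phi> v u)" for \<phi> :: "'a \<Rightarrow> 'a \<Rightarrow> real"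
proof -
  have eq: "(\<Sum>u\<in>nb v. \<psi> u) = (\<Sum>u\<in>V. if u \<in> nb v then \<psi> u else 0)" for v and \<psi> :: "'a \<Rightarrow> real"
  proof -
    have "nb v = {u\<in>V. u \<in> nb v}" using nb_sub by blast
    then show ?thesis using sum.inter_filter[OF finV, of \<psi> "\<lambda>u. u \<in> nb v"] by simp
  qed
  show ?thesis unfolding eq by (subst sum.swap) (simp add: nb_sym)
qed

lemma handshake: "(\<Sum>v\<in>V. \<Sum>u\<in>nb v. \<phi> {v, u}) = 2 * (\<Sum>e\<in>E. \<phi> e)" for \<phi> :: "'a set \<Rightarrow> real"
proof -
  have "(\<Sum>u\<in>nb v. \<phi> {v, u}) = (\<Sum>e\<in>{e\<in>E. v \<in> e}. \<phi> e)" for v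
  proof (rule sum.reindex_bij_betw)
    have "inj_on (\<lambda>u. {v, u}) (nb v)" by (auto simp: inj_on_def doubleton_eq_iff)
    moreover have "(\<lambda>u. {v, u}) ` nb v = {e\<in>E. v \<in> e}"
    proof
      show "{e\<in>E. v \<in> e} \<subseteq> (\<lambda>u. {v, u}) ` nb v"
      proof
        fix e assume "e \<in> {e\<in>E. v \<in> e}"
        then have e: "e \<in> E" "v \<in> e" by auto
        obtain a b where "e = {a, b}" using graph e(1) unfolding graph_def by blast
        then have "e = {v, a} \<or> e = {v, b}" using e(2) by auto
        then show "e \<in> (\<lambda>u. {v, u}) ` nb v" using e(1) nb_iff by blast
      qed
    qed (auto simp: nb_iff)
    ultimately show "bij_betw (\<lambda>u. {v, u}) (nb v) {e\<in>E. v \<in> e}" by (simp add: bij_betw_def)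
  qed
  then have "(\<Sum>v\<in>V. \<Sum>u\<in>nb v. \<phi> {v, u}) = (\<Sum>v\<in>V. \<Sum>e\<in>E. if v \<in> e then \<phi> e else 0)"
    by (simp add: sum.inter_filter)
  also have "\<dots> = (\<Sum>e\<in>E. \<Sum>v\<in>V. if v \<in> e then \<phi> e else 0)" by (rule sum.swap)
  also have "\<dots> = (\<Sum>e\<in>E. 2 * \<phi> e)"
  proof (rule sum.cong[OF refl])
    fix e assume e: "e \<in> E"
    have "{v\<in>V. v \<in> e} = e" using edge_card(2)[OF e] by auto
    then show "(\<Sum>v\<in>V. if v \<in> e then \<phi> e else 0) = 2 * \<phi> e"
      using sum.inter_filter[OF finV, of "\<lambda>_. \<phi> e" "\<lambda>v. v \<in> e"] edge_card(1)[OF e] by simp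
  qed
  finally show ?thesis by (simp add: sum_distrib_left)
qed

lemma card_E_pos: "card E > 0"
proof -
  obtain v where "v \<in> V" using V_ne by blast
  then obtain u where "u \<in> nb v" using nbrs_ne by blast
  then have "E \<noteq> {}" using nb_iff by blast
  then show ?thesis by (simp add: card_gt_0_iff)
qed

lemma sum_deg: "(\<Sum>v\<in>V. real (dg v)) = 2 * real (card E)"
  using handshake[of "\<lambda>_. 1"] by (simp add: card_nb)

lemma \<mu>_nonneg: "\<mu> v \<ge> 0" by (simp add: stat_dist_def)

lemma sum_\<mu>: "(\<Sum>v\<in>V. \<mu> v) = 1"
  using card_E_pos sum_deg by (auto simp: stat_dist_def card_gt_0_iff simp flip: sum_divide_distrib)

lemma mean_const [simp]: "mean (\<lambda>_. k) = k"
  by (simp add: mean_def sum_\<mu> flip: sum_distrib_right)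

lemma mean_add: "mean (\<lambda>v. f v + g v) = mean f + mean g"
  by (simp add: mean_def distrib_left sum.distrib)

lemma mean_diff: "mean (\<lambda>v. f v - g v) = mean f - mean g"
  by (simp add: mean_def right_diff_distrib sum_subtractf)

lemma mean_cmult: "mean (\<lambda>v. k * f v) = k * mean f"
  by (simp add: mean_def sum_distrib_left mult.left_commute)

lemma mean_sum: "mean (\<lambda>v. \<Sum>j\<in>J. f j v) = (\<Sum>j\<in>J. mean (f j))"
  unfolding mean_def by (subst sum.swap) (simp add: sum_distrib_left)

lemma mean_mono: "(\<And>v. v \<in> V \<Longrightarrow> f v \<le> g v) \<Longrightarrow> mean f \<le> mean g"
  unfolding mean_def by (intro sum_mono mult_left_mono \<mu>_nonneg)

lemma mean_cong: "(\<And>v. v \<in> V \<Longrightarrow> f v = g v) \<Longrightarrow> mean f = mean g"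
  unfolding mean_def by simp

lemma \<mu>_P: "v \<in> V \<Longrightarrow> \<mu> v * P g v = (\<Sum>u\<in>nb v. g u) / (2 * real (card E))"
  using dg_pos[of v] by (simp add: stat_dist_def walk_op_def)

lemma ip_P: "ip f (P g) = (\<Sum>v\<in>V. \<Sum>u\<in>nb v. f v * g u) / (2 * real (card E))"
proof -
  have "\<mu> v * (f v * P g v) = (\<Sum>u\<in>nb v. f v * g u) / (2 * real (card E))" if "v \<in> V" for v
  proof -
    have "\<mu> v * (f v * P g v) = f v * (\<mu> v * P g v)" by simp
    also have "\<dots> = (\<Sum>u\<in>nb v. f v * g u) / (2 * real (card E))" unfolding \<mu>_P[OF that] by (simp add: sum_distrib_left)
    finally show ?thesis .
  qed
  then show ?thesis by (simp add: ip_def mean_def sum_divide_distrib)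
qed

lemma ip_commute: "ip f g = ip g f" by (simp add: ip_def mult.commute)

text \<open>Reversibility: both sides are sums over ordered adjacent pairs with the constant weight
  \<open>1 / (2 * real (card E))\<close>.\<close>

lemma ip_P_sym: "ip f (P g) = ip (P f) g"
  unfolding ip_commute[of "P f"] ip_P by (subst swap_nb) (simp add: mult.commute)

lemma P_const: "v \<in> V \<Longrightarrow> P (\<lambda>_. k) v = k"
  using dg_pos[of v] by (simp add: walk_op_def card_nb)

lemma mean_P: "mean (P g) = mean g"
proof -
  have "mean (P g) = ip (\<lambda>_. 1) (P g)" by (simp add: ip_def)
  also have "\<dots> = ip (P (\<lambda>_. 1)) g" by (rule ip_P_sym)
  also have "\<dots> = mean g" unfolding ip_def by (rule mean_cong) (simp add: P_const)
  finally show ?thesis .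
qed

lemma P_mono: "(\<And>u. u \<in> V \<Longrightarrow> f u \<le> g u) \<Longrightarrow> P f v \<le> P g v"
  unfolding walk_op_def by (intro divide_right_mono sum_mono) (auto dest: nb_sub)

lemma P_cong: "(\<And>u. u \<in> V \<Longrightarrow> f u = g u) \<Longrightarrow> P f v = P g v"
  unfolding walk_op_def using nb_sub by (metis (mono_tags, lifting) sum.cong)

lemma P_add: "P (\<lambda>u. f u + g u) v = P f v + P g v"
  by (simp add: walk_op_def sum.distrib add_divide_distrib)

lemma P_cmult: "P (\<lambda>u. k * f u) v = k * P f v"
  by (simp add: walk_op_def flip: sum_distrib_left)

lemma P_sum: "P (\<lambda>u. \<Sum>j\<in>J. f j u) v = (\<Sum>j\<in>J. P (f j) v)"
  unfolding walk_op_def by (subst sum.swap) (simp add: sum_divide_distrib)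

lemma P_diff_const: "v \<in> V \<Longrightarrow> P (\<lambda>u. f u - k) v = P f v - k"
  using P_add[of f "\<lambda>_. - k" v] P_const[of v "- k"] by simp

lemma P_sq: "(P f v)\<^sup>2 \<le> P (\<lambda>u. (f u)\<^sup>2) v"
proof (cases "dg v = 0")
  case False
  have "(\<Sum>u\<in>nb v. f u)\<^sup>2 \<le> real (dg v) * (\<Sum>u\<in>nb v. (f u)\<^sup>2)"
    using Cauchy_Schwarz_ineq_sum[of "\<lambda>_. 1" f "nb v"] by (simp add: card_nb)
  then show ?thesis using False
    by (simp add: walk_op_def power_divide field_simps power2_eq_square)
qed (simp add: walk_op_def)

lemma ip_P_le: "ip (P f) (P f) \<le> ip f f"
proof -
  have "ip (P f) (P f) \<le> mean (P (\<lambda>u. f u * f u))"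
    unfolding ip_def by (rule mean_mono) (use P_sq[of f] in \<open>simp add: power2_eq_square\<close>)
  then show ?thesis by (simp add: mean_P ip_def)
qed

lemma ip_nonneg: "0 \<le> ip f f"
  unfolding ip_def mean_def by (intro sum_nonneg mult_nonneg_nonneg[OF \<mu>_nonneg] zero_le_square)

lemma ip_CS: "(ip f g)\<^sup>2 \<le> ip f f * ip g g"
proof -
  have "(\<Sum>v\<in>V. (sqrt (\<mu> v) * f v) * (sqrt (\<mu> v) * g v))\<^sup>2
      \<le> (\<Sum>v\<in>V. (sqrt (\<mu> v) * f v)\<^sup>2) * (\<Sum>v\<in>V. (sqrt (\<mu> v) * g v)\<^sup>2)"
    by (rule Cauchy_Schwarz_ineq_sum)
  moreover have "(sqrt (\<mu> v) * f v) * (sqrt (\<mu> v) * h v) = \<mu> v * (f v * h v)" for v h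
    using \<mu>_nonneg[of v] by (simp add: mult.assoc mult.left_commute)
  moreover have "(sqrt (\<mu> v) * h v)\<^sup>2 = \<mu> v * (h v * h v)" for v h
    using \<mu>_nonneg[of v] by (simp add: power_mult_distrib power2_eq_square)
  ultimately show ?thesis by (simp add: ip_def mean_def)
qed

lemma ip_pow_sym: "ip f ((P ^^ (i + j)) g) = ip ((P ^^ i) f) ((P ^^ j) g)"
proof (induction i arbitrary: f)
  case (Suc i)
  have "ip f ((P ^^ (Suc i + j)) g) = ip (P f) ((P ^^ (i + j)) g)" by (simp add: ip_P_sym)
  also have "\<dots> = ip ((P ^^ i) (P f)) ((P ^^ j) g)" by (rule Suc)
  finally show ?case by (simp add: funpow_swap1)
qed simp

lemma ip_pow_le: "j \<ge> 1 \<Longrightarrow> ip ((P ^^ j) f) ((P ^^ j) f) \<le> ip (P f) (P f)"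
proof (induction j rule: dec_induct)
  case (step j)
  then show ?case using ip_P_le[of "(P ^^ j) f"] by simp
qed simp

text \<open>Since \<open>i \<mapsto> ip f (P\<^sup>i f)\<close> is log-convex along powers of two, contraction after many
  steps forces a contraction already after a single step.\<close>

lemma one_step_contraction:
  assumes "ip ((P ^^ (2 ^ i)) f) ((P ^^ (2 ^ i)) f) \<le> \<kappa> ^ (2 ^ Suc i) * ip f f" "\<kappa> \<ge> 0"
  shows "ip (P f) (P f) \<le> \<kappa>\<^sup>2 * ip f f"
  using assms(1)
proof (induction i)
  case (Suc i)
  let ?b = "ip ((P ^^ (2 ^ i)) f) ((P ^^ (2 ^ i)) f)"
  let ?c = "ip ((P ^^ (2 ^ Suc i)) f) ((P ^^ (2 ^ Suc i)) f)"
  \<comment> \<open>The induction lowers the exponent: \<open>?b\<close> is an autocorrelation of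
    \<open>f\<close> at lag \<open>2 ^ Suc i\<close>, so Cauchy-Schwarz bounds its square by
    \<open>ip f f\<close> times the norm one doubling later.\<close>
  have "?b = ip f ((P ^^ (2 ^ Suc i)) f)"
    using ip_pow_sym[of f "2 ^ i" "2 ^ i" f] by (simp add: mult_2)
  then have "?b\<^sup>2 \<le> ip f f * ?c" using ip_CS by simp
  also have "\<dots> \<le> ip f f * (\<kappa> ^ (2 ^ Suc (Suc i)) * ip f f)"
    by (rule mult_left_mono[OF Suc.prems ip_nonneg])
  also have "\<dots> = (\<kappa> ^ (2 ^ Suc i) * ip f f)\<^sup>2"
    by (simp add: power2_eq_square mult_2 power_add)
  finally have "?b \<le> \<kappa> ^ (2 ^ Suc i) * ip f f"
    by (rule power2_le_imp_le) (use assms(2) ip_nonneg in auto)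
  then show ?case by (rule Suc.IH)
qed simp

lemma step_dist_P:
  "v \<in> V \<Longrightarrow> (P ^^ t) g v = (\<Sum>w\<in>V. step_dist V E v t w * g w)"
proof (induction t arbitrary: g)
  case 0
  then show ?case by (simp add: if_distrib[of "\<lambda>x. x * _"] cong: if_cong)
next
  case (Suc t)
  have Pg: "P g u = (\<Sum>w\<in>V. (if {u, w} \<in> E then 1 / real (dg u) else 0) * g w)" for u
  proof -
    have "nb u = {w\<in>V. {u, w} \<in> E}" by (simp add: nbrs_def)
    then show ?thesis unfolding walk_op_def
      by (auto simp: sum_divide_distrib sum.inter_filter intro!: sum.cong)
  qed
  have "(P ^^ Suc t) g v = (P ^^ t) (P g) v" by (simp add: funpow_swap1)
  also have "\<dots> = (\<Sum>u\<in>V. step_dist V E v t u * P g u)" using Suc by simp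
  also have "\<dots> = (\<Sum>w\<in>V. step_dist V E v (Suc t) w * g w)"
    unfolding Pg by (simp add: sum_distrib_left sum_distrib_right mult.assoc) (rule sum.swap)
  finally show ?case .
qed

text \<open>The bound is assumed only at time \<open>T\<close>, but it persists: \<open>P\<close>
  averages values and keeps them in the interval around \<open>mean g\<close>, whose endpoints it
  fixes.\<close>

lemma mixing:
  assumes "mixes V E \<delta> T" "T \<le> j" "v \<in> V"
  shows "\<bar>(P ^^ j) g v - mean g\<bar> \<le> \<delta> * (\<Sum>w\<in>V. \<bar>g w\<bar>)"
  using assms(2,3)
proof (induction j arbitrary: v rule: dec_induct)
  case base
  have "(P ^^ T) g v - mean g = (\<Sum>w\<in>V. (step_dist V E v T w - \<mu> w) * g w)"
    using base by (simp add: step_dist_P mean_def left_diff_distrib sum_subtractf)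
  also have "\<bar>\<dots>\<bar> \<le> (\<Sum>w\<in>V. \<bar>step_dist V E v T w - \<mu> w\<bar> * \<bar>g w\<bar>)"
    using sum_abs[of "\<lambda>w. (step_dist V E v T w - \<mu> w) * g w" V] by (simp add: abs_mult)
  also have "\<dots> \<le> (\<Sum>w\<in>V. \<delta> * \<bar>g w\<bar>)"
    using assms(1) base by (intro sum_mono mult_right_mono) (auto simp: mixes_def abs_minus_commute)
  finally show ?case by (simp add: sum_distrib_left)
next
  case (step j)
  define b where "b = \<delta> * (\<Sum>w\<in>V. \<bar>g w\<bar>)"
  have *: "mean g - b \<le> (P ^^ j) g u" "(P ^^ j) g u \<le> mean g + b" if "u \<in> V" for u
    using step.IH[OF that] by (auto simp: b_def abs_le_iff)
  have "P (\<lambda>_. mean g - b) v \<le> P ((P ^^ j) g) v" "P ((P ^^ j) g) v \<le> P (\<lambda>_. mean g + b) v"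
    using * by (auto intro!: P_mono)
  then show ?case using P_const[OF step.prems] by (simp add: b_def abs_le_iff)
qed

lemma pow_diff_const: "v \<in> V \<Longrightarrow> (P ^^ j) (\<lambda>u. f u - k) v = (P ^^ j) f v - k"
proof (induction j arbitrary: v)
  case (Suc j)
  have "P ((P ^^ j) (\<lambda>u. f u - k)) v = P (\<lambda>u. (P ^^ j) f u - k) v"
    by (rule P_cong) (rule Suc.IH)
  then show ?case using P_diff_const[OF Suc.prems] by simp
qed simp

lemma mean_pow: "mean ((P ^^ j) f) = mean f"
  by (induction j) (simp_all add: mean_P)

text \<open>The autocovariance formula; it transfers the contraction of mean-zero functions to
  \<open>f\<close> itself.\<close>

lemma ip_center:
  "ip (\<lambda>v. f v - mean f) ((P ^^ j) (\<lambda>v. f v - mean f)) = ip f ((P ^^ j) f) - (mean f)\<^sup>2"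
proof -
  have "ip (\<lambda>v. f v - mean f) ((P ^^ j) (\<lambda>v. f v - mean f))
      = mean (\<lambda>v. (f v * (P ^^ j) f v - mean f * f v) - (mean f * (P ^^ j) f v - (mean f)\<^sup>2))"
    unfolding ip_def by (rule mean_cong) (simp add: pow_diff_const algebra_simps power2_eq_square)
  also have "\<dots> = ip f ((P ^^ j) f) - (mean f)\<^sup>2"
    by (simp only: mean_diff mean_cmult mean_const mean_pow ip_def) (simp add: power2_eq_square)
  finally show ?thesis .
qed

end

section \<open>Moments along the stationary walk\<close>

context walk_graph
begin

definition edge_frac :: "'a set set \<Rightarrow> 'a \<Rightarrow> real" where
  "edge_frac Q v = P (\<lambda>u. of_bool ({v, u} \<in> Q)) v"

definition stat_exp :: "nat \<Rightarrow> ('a set list \<Rightarrow> real) \<Rightarrow> real" where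
  "stat_exp t g = mean (\<lambda>v. walk_exp V E t v g)"

lemma walk_exp_mono: "(\<And>fs. g fs \<le> h fs) \<Longrightarrow> walk_exp V E t v g \<le> walk_exp V E t v h"
  by (induction t arbitrary: v g h) (auto intro!: P_mono)

lemma walk_exp_add: "walk_exp V E t v (\<lambda>fs. g fs + h fs) = walk_exp V E t v g + walk_exp V E t v h"
  by (induction t arbitrary: v g h) (simp_all add: P_add)

lemma walk_exp_cmult: "walk_exp V E t v (\<lambda>fs. k * g fs) = k * walk_exp V E t v g"
  by (induction t arbitrary: v g) (simp_all add: P_cmult)

lemma walk_exp_const: "v \<in> V \<Longrightarrow> walk_exp V E t v (\<lambda>fs. k) = k"
proof (induction t arbitrary: v)
  case (Suc t)
  have "P (\<lambda>u. walk_exp V E t u (\<lambda>fs. k)) v = P (\<lambda>_. k) v" by (rule P_cong) (rule Suc.IH)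
  then show ?case using P_const[OF Suc.prems] by simp
qed simp

lemma stat_exp_mono: "(\<And>fs. g fs \<le> h fs) \<Longrightarrow> stat_exp t g \<le> stat_exp t h"
  unfolding stat_exp_def by (intro mean_mono walk_exp_mono)

lemma stat_exp_add: "stat_exp t (\<lambda>fs. g fs + h fs) = stat_exp t g + stat_exp t h"
  unfolding stat_exp_def by (simp add: walk_exp_add mean_add)

lemma stat_exp_cmult: "stat_exp t (\<lambda>fs. k * g fs) = k * stat_exp t g"
  unfolding stat_exp_def by (simp add: walk_exp_cmult mean_cmult)

lemma stat_exp_const: "stat_exp t (\<lambda>fs. k) = k"
proof -
  have "stat_exp t (\<lambda>fs. k) = mean (\<lambda>_. k)"
    unfolding stat_exp_def by (rule mean_cong) (rule walk_exp_const)
  then show ?thesis by simp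
qed

text \<open>Stationarity: without its first step the walk is again a stationary walk.\<close>

lemma stat_exp_tl: "stat_exp (Suc t) (\<lambda>fs. g (tl fs)) = stat_exp t g"
proof -
  have "walk_exp V E (Suc t) v (\<lambda>fs. g (tl fs)) = P (\<lambda>u. walk_exp V E t u g) v" for v
    by simp
  then show ?thesis unfolding stat_exp_def by (simp add: mean_P del: walk_exp.simps)
qed

lemma edge_frac_nonneg: "0 \<le> edge_frac Q v"
  unfolding edge_frac_def walk_op_def by (intro divide_nonneg_nonneg sum_nonneg) auto

lemma edge_frac_le_1: "edge_frac Q v \<le> 1"
proof -
  have "(\<Sum>u\<in>nb v. of_bool ({v, u} \<in> Q)) \<le> (\<Sum>u\<in>nb v. 1::real)" by (intro sum_mono) auto
  then show ?thesis unfolding edge_frac_def walk_op_def by (simp add: card_nb divide_le_eq_1) linarith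
qed

text \<open>Time reversal: a step into \<open>u\<close> through \<open>Q\<close> is as likely as a
  step out of \<open>u\<close> through \<open>Q\<close>, so a weight at the end point of the step
  can be moved to its start.\<close>

lemma mean_edge_frac_weighted: "mean (\<lambda>v. P (\<lambda>u. of_bool ({v, u} \<in> Q) * r u) v) = ip (edge_frac Q) r"
proof -
  have "mean (\<lambda>v. P (\<lambda>u. of_bool ({v, u} \<in> Q) * r u) v)
      = (\<Sum>v\<in>V. \<Sum>u\<in>nb v. of_bool ({v, u} \<in> Q) * r u) / (2 * real (card E))"
    unfolding mean_def by (simp add: \<mu>_P sum_divide_distrib)
  also have "\<dots> = (\<Sum>u\<in>V. \<Sum>v\<in>nb u. of_bool ({u, v} \<in> Q) * r u) / (2 * real (card E))"
    by (subst swap_nb) (simp add: insert_commute)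
  also have "\<dots> = (\<Sum>u\<in>V. \<mu> u * (edge_frac Q u * r u))"
    unfolding edge_frac_def by (simp add: \<mu>_P sum_divide_distrib sum_distrib_right flip: mult.assoc)
  finally show ?thesis by (simp add: ip_def mean_def)
qed

lemma mean_edge_frac: assumes "Q \<subseteq> E" shows "mean (edge_frac Q) = real (card Q) / real (card E)"
proof -
  have "mean (edge_frac Q) = (\<Sum>v\<in>V. \<Sum>u\<in>nb v. of_bool ({v, u} \<in> Q)) / (2 * real (card E))"
    unfolding mean_def edge_frac_def by (simp add: \<mu>_P sum_divide_distrib)
  also have "(\<Sum>v\<in>V. \<Sum>u\<in>nb v. of_bool ({v, u} \<in> Q)) = 2 * (\<Sum>e\<in>E. of_bool (e \<in> Q) :: real)"
    by (rule handshake)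
  also have "(\<Sum>e\<in>E. of_bool (e \<in> Q) :: real) = real (card Q)"
    using assms by (simp add: Int_absorb1 of_bool_def sum.If_cases)
  finally show ?thesis by simp
qed

abbreviation "Hexp Q t v \<equiv> walk_exp V E t v (\<lambda>fs. real (hits Q fs))"

lemma Hexp_Suc: "v \<in> V \<Longrightarrow> Hexp Q (Suc t) v = edge_frac Q v + P (Hexp Q t) v"
proof -
  assume v: "v \<in> V"
  have "Hexp Q (Suc t) v = P (\<lambda>u. walk_exp V E t u (\<lambda>fs. of_bool ({v, u} \<in> Q) + real (hits Q fs))) v"
    unfolding walk_exp.simps(2) by (intro P_cong arg_cong[where f = "walk_exp V E t _"] ext) simp
  also have "\<dots> = P (\<lambda>u. of_bool ({v, u} \<in> Q) + Hexp Q t u) v"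
    by (rule P_cong) (simp add: walk_exp_add walk_exp_const)
  finally show ?thesis by (simp add: P_add edge_frac_def)
qed

lemma Hexp_eq: "v \<in> V \<Longrightarrow> Hexp Q t v = (\<Sum>l<t. (P ^^ l) (edge_frac Q) v)"
proof (induction t arbitrary: v)
  case (Suc t)
  have "P (Hexp Q t) v = P (\<lambda>u. \<Sum>l<t. (P ^^ l) (edge_frac Q) u) v" by (rule P_cong) (rule Suc.IH)
  also have "\<dots> = (\<Sum>l<t. (P ^^ Suc l) (edge_frac Q) v)" by (simp add: P_sum)
  finally show ?case using Hexp_Suc[OF Suc.prems] by (simp add: sum.lessThan_Suc_shift del: sum.lessThan_Suc)
qed simp

lemma stat_exp_hits: "Q \<subseteq> E \<Longrightarrow> stat_exp t (\<lambda>fs. real (hits Q fs)) = real t * (real (card Q) / real (card E))"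
proof -
  assume Q: "Q \<subseteq> E"
  have "stat_exp t (\<lambda>fs. real (hits Q fs)) = mean (\<lambda>v. \<Sum>l<t. (P ^^ l) (edge_frac Q) v)"
    unfolding stat_exp_def by (rule mean_cong) (rule Hexp_eq)
  then show ?thesis by (simp add: mean_sum mean_pow mean_edge_frac[OF Q])
qed

text \<open>A first step in \<open>Q\<close> adds \<open>w\<close> times the remaining moment, which
  never exceeds \<open>K\<close>: this cap reproduces itself because
  \<open>1 + w * K * h \<le> K\<close>. Only the cap needs the worst-case \<open>h\<close>; the
  conclusion is linear in \<open>Hexp\<close>, so a stationary start brings in the much smaller mean
  number of hits.\<close>

lemma exp_moment:
  assumes w: "0 \<le> w" and Hm: "\<And>t' v. t' \<le> t \<Longrightarrow> v \<in> V \<Longrightarrow> Hexp Q t' v \<le> h"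
    and K: "1 + w * K * h \<le> K" "K \<ge> 0" and "v \<in> V"
  shows "walk_exp V E t v (\<lambda>fs. (1 + w) ^ hits Q fs) \<le> 1 + w * K * Hexp Q t v"
  using Hm \<open>v \<in> V\<close>
proof (induction t arbitrary: v)
  case 0
  then show ?case by simp
next
  case (Suc t)
  let ?F = "\<lambda>u. walk_exp V E t u (\<lambda>fs. (1 + w) ^ hits Q fs)"
  have F1: "?F u \<le> 1 + w * K * Hexp Q t u" if "u \<in> V" for u
    by (rule Suc.IH) (use Suc.prems(1) that in auto)
  have F2: "?F u \<le> K" if "u \<in> V" for u
  proof -
    have "w * K * Hexp Q t u \<le> w * K * h"
      using Suc.prems(1)[of t u] that w K by (intro mult_left_mono) auto
    then show ?thesis using F1[OF that] K by linarith
  qed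
  have "walk_exp V E (Suc t) v (\<lambda>fs. (1 + w) ^ hits Q fs)
      = P (\<lambda>u. ?F u + w * (of_bool ({v, u} \<in> Q) * ?F u)) v"
  proof -
    have "walk_exp V E t u (\<lambda>fs. (1 + w) ^ hits Q ({v, u} # fs)) = ?F u + w * (of_bool ({v, u} \<in> Q) * ?F u)" for u
      by (cases "{v, u} \<in> Q") (simp_all add: walk_exp_cmult walk_exp_add distrib_right)
    then show ?thesis by simp
  qed
  also have "\<dots> \<le> P (\<lambda>u. (1 + w * K * Hexp Q t u) + w * (of_bool ({v, u} \<in> Q) * K)) v"
  proof (rule P_mono)
    fix u assume "u \<in> V"
    then have "of_bool ({v, u} \<in> Q) * ?F u \<le> of_bool ({v, u} \<in> Q) * K" using F2 by (intro mult_left_mono) auto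
    then have "w * (of_bool ({v, u} \<in> Q) * ?F u) \<le> w * (of_bool ({v, u} \<in> Q) * K)" using w by (rule mult_left_mono)
    then show "?F u + w * (of_bool ({v, u} \<in> Q) * ?F u) \<le> (1 + w * K * Hexp Q t u) + w * (of_bool ({v, u} \<in> Q) * K)"
      using F1[OF \<open>u \<in> V\<close>] by linarith
  qed
  also have "\<dots> = 1 + w * K * P (Hexp Q t) v + w * K * edge_frac Q v"
  proof -
    have "P (\<lambda>u. (1 + w * K * Hexp Q t u) + w * (of_bool ({v, u} \<in> Q) * K)) v
      = P (\<lambda>u. (1 + w * K * Hexp Q t u) + (w * K) * of_bool ({v, u} \<in> Q)) v"
      by (simp only: mult_ac)
    then show ?thesis unfolding P_add P_cmult edge_frac_def using P_const[OF Suc.prems(2), of 1] by simp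
  qed
  finally show ?case unfolding Hexp_Suc[OF Suc.prems(2)] by (simp add: algebra_simps)
qed

text \<open>The first edge is paired with the hits from the third edge on. After time reversal,
  edges at distance \<open>j + 1\<close> contribute the correlation of \<open>edge_frac Q\<close> at
  lag \<open>j\<close>. Requiring distance at least two removes exactly lag 0, which is of the order
  of the density of \<open>Q\<close> when \<open>Q\<close> is a star.\<close>

lemma stat_exp_far_pairs_Suc:
  "stat_exp (Suc t) (\<lambda>fs. real (far_pairs Q fs))
    = (\<Sum>j\<in>{1..<t}. ip (edge_frac Q) ((P ^^ j) (edge_frac Q))) + stat_exp t (\<lambda>fs. real (far_pairs Q fs))"
proof -
  let ?r = "\<lambda>u. walk_exp V E t u (\<lambda>fs. real (hits Q (tl fs)))"
  have "walk_exp V E (Suc t) v (\<lambda>fs. real (far_pairs Q fs))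
      = P (\<lambda>u. of_bool ({v, u} \<in> Q) * ?r u) v + P (\<lambda>u. walk_exp V E t u (\<lambda>fs. real (far_pairs Q fs))) v" for v
  proof -
    have "walk_exp V E t u (\<lambda>fs. real (far_pairs Q ({v, u} # fs)))
      = of_bool ({v, u} \<in> Q) * ?r u + walk_exp V E t u (\<lambda>fs. real (far_pairs Q fs))" for u
      by (cases "{v, u} \<in> Q") (simp_all add: walk_exp_add)
    then show ?thesis by (simp add: P_add)
  qed
  then have "stat_exp (Suc t) (\<lambda>fs. real (far_pairs Q fs))
      = ip (edge_frac Q) ?r + stat_exp t (\<lambda>fs. real (far_pairs Q fs))"
    unfolding stat_exp_def by (simp add: mean_add mean_edge_frac_weighted mean_P del: walk_exp.simps)
  moreover have "ip (edge_frac Q) ?r = (\<Sum>j\<in>{1..<t}. ip (edge_frac Q) ((P ^^ j) (edge_frac Q)))"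
  proof (cases t)
    case 0
    then show ?thesis by (simp add: ip_def)
  next
    case (Suc t')
    have "?r u = P (Hexp Q t') u" for u by (simp add: Suc)
    also have "P (Hexp Q t') u = (\<Sum>j\<in>{1..<t}. (P ^^ j) (edge_frac Q) u)" for u
    proof -
      have "P (Hexp Q t') u = P (\<lambda>u. \<Sum>l<t'. (P ^^ l) (edge_frac Q) u) u" by (rule P_cong) (rule Hexp_eq)
      also have "\<dots> = (\<Sum>l<t'. (P ^^ Suc l) (edge_frac Q) u)" by (simp add: P_sum)
      also have "\<dots> = (\<Sum>j\<in>{1..<t}. (P ^^ j) (edge_frac Q) u)"
        by (simp only: Suc One_nat_def sum.shift_bounds_Suc_ivl atLeast0LessThan)
      finally show ?thesis .
    qed
    finally show ?thesis by (simp add: ip_def sum_distrib_left mean_sum)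
  qed
  ultimately show ?thesis by simp
qed

lemma stat_exp_far_pairs:
  assumes "\<And>t'. t' < t \<Longrightarrow> (\<Sum>j\<in>{1..<t'}. ip (edge_frac Q) ((P ^^ j) (edge_frac Q))) \<le> b"
  shows "stat_exp t (\<lambda>fs. real (far_pairs Q fs)) \<le> real t * b"
  using assms
proof (induction t)
  case 0
  then show ?case by (simp add: stat_exp_def)
next
  case (Suc t)
  then have "stat_exp t (\<lambda>fs. real (far_pairs Q fs)) \<le> real t * b" by simp
  moreover have "(\<Sum>j\<in>{1..<t}. ip (edge_frac Q) ((P ^^ j) (edge_frac Q))) \<le> b" using Suc.prems[of t] by simp
  ultimately show ?case unfolding stat_exp_far_pairs_Suc by (simp add: algebra_simps)
qed

definition open_frac :: "'a set set \<Rightarrow> 'a \<Rightarrow> real" where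
  "open_frac B v = P (\<lambda>u. of_bool ({v, u} \<notin> B)) v"

text \<open>The contribution of the first window of three edges. With stationarity, it turns the
  expected number of isolated steps into a multiple of one local probability.\<close>

fun starts_isolated :: "'a set set \<Rightarrow> 'a set set \<Rightarrow> 'a set list \<Rightarrow> nat" where
  "starts_isolated A B (f # g # h # fs) = (if f \<notin> B \<and> g \<in> A \<and> h \<notin> B then 1 else 0)"
| "starts_isolated A B _ = 0"

lemma isolated_tl: "isolated A B fs = starts_isolated A B fs + isolated A B (tl fs)"
  by (cases "(A, B, fs)" rule: isolated.cases) auto

text \<open>Under stationarity the middle step is a uniform oriented edge \<open>(u, x)\<close>.
  Given it, the reversed preceding step from \<open>u\<close> and the following step from
  \<open>x\<close> are independent, whence the product of the two open fractions.\<close>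

lemma stat_exp_starts_isolated:
  "stat_exp (Suc (Suc (Suc t))) (\<lambda>fs. real (starts_isolated A B fs))
    = (\<Sum>u\<in>V. \<Sum>x\<in>nb u. of_bool ({u, x} \<in> A) * open_frac B u * open_frac B x) / (2 * real (card E))"
proof -
  define \<psi> where "\<psi> u = P (\<lambda>x. of_bool ({u, x} \<in> A) * open_frac B x) u" for u
  have "walk_exp V E (Suc (Suc (Suc t))) v (\<lambda>fs. real (starts_isolated A B fs))
     = P (\<lambda>u. of_bool ({v, u} \<notin> B) * \<psi> u) v" for v
  proof -
    have 1: "walk_exp V E (Suc t) x (\<lambda>fs. real (starts_isolated A B ({v, u} # {u, x} # fs)))
       = of_bool ({v, u} \<notin> B) * (of_bool ({u, x} \<in> A) * open_frac B x)" if "x \<in> V" for u x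
    proof -
      have "walk_exp V E (Suc t) x (\<lambda>fs. real (starts_isolated A B ({v, u} # {u, x} # fs)))
        = P (\<lambda>y. (of_bool ({v, u} \<notin> B) * of_bool ({u, x} \<in> A)) * of_bool ({x, y} \<notin> B)) x"
        by (simp only: walk_exp.simps, rule P_cong) (simp add: walk_exp_const)
      then show ?thesis unfolding P_cmult open_frac_def by simp
    qed
    have 2: "walk_exp V E (Suc (Suc t)) u (\<lambda>fs. real (starts_isolated A B ({v, u} # fs)))
       = of_bool ({v, u} \<notin> B) * \<psi> u" for u
    proof -
      have "walk_exp V E (Suc (Suc t)) u (\<lambda>fs. real (starts_isolated A B ({v, u} # fs)))
        = P (\<lambda>x. walk_exp V E (Suc t) x (\<lambda>fs. real (starts_isolated A B ({v, u} # {u, x} # fs)))) u"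
        by (simp only: walk_exp.simps)
      also have "\<dots> = P (\<lambda>x. of_bool ({v, u} \<notin> B) * (of_bool ({u, x} \<in> A) * open_frac B x)) u"
        by (rule P_cong) (rule 1)
      finally show ?thesis by (simp add: P_cmult \<psi>_def)
    qed
    show ?thesis by (subst walk_exp.simps(2)) (simp only: 2)
  qed
  then have "stat_exp (Suc (Suc (Suc t))) (\<lambda>fs. real (starts_isolated A B fs))
     = (\<Sum>v\<in>V. \<Sum>u\<in>nb v. of_bool ({v, u} \<notin> B) * \<psi> u) / (2 * real (card E))"
    unfolding stat_exp_def mean_def by (simp add: \<mu>_P sum_divide_distrib del: walk_exp.simps)
  also have "\<dots> = (\<Sum>u\<in>V. \<Sum>v\<in>nb u. of_bool ({u, v} \<notin> B) * \<psi> u) / (2 * real (card E))"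
    by (subst swap_nb) (simp add: insert_commute)
  also have "\<dots> = (\<Sum>u\<in>V. \<Sum>x\<in>nb u. of_bool ({u, x} \<in> A) * open_frac B u * open_frac B x) / (2 * real (card E))"
  proof -
    have "(\<Sum>v\<in>nb u. of_bool ({u, v} \<notin> B) * \<psi> u) = (\<Sum>x\<in>nb u. of_bool ({u, x} \<in> A) * open_frac B u * open_frac B x)"
      if "u \<in> V" for u
    proof -
      have d: "real (dg u) > 0" using dg_pos[OF that] by simp
      have "(\<Sum>v\<in>nb u. of_bool ({u, v} \<notin> B) * \<psi> u) = (real (dg u) * open_frac B u) * \<psi> u"
        using d by (simp add: open_frac_def walk_op_def sum_distrib_right)
      also have "\<dots> = open_frac B u * (\<Sum>x\<in>nb u. of_bool ({u, x} \<in> A) * open_frac B x)"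
        using d by (simp add: \<psi>_def walk_op_def)
      finally show ?thesis unfolding sum_distrib_left
        by (simp only: mult_ac)
    qed
    then show ?thesis by simp
  qed
  finally show ?thesis .
qed

end

section \<open>Moment bounds for a mixing walk\<close>

lemma power_scaled_1:
  fixes a w :: real
  assumes "0 \<le> a" "a \<le> 1" "0 \<le> w"
  shows "(1 + a * w) ^ x \<le> 1 + a * ((1 + w) ^ x - 1)"
proof (induction x)
  case (Suc x)
  have "1 + a * w \<le> 1 + w" using assms by (simp add: mult_left_le_one_le)
  then have "(1 + a * w) ^ x \<le> (1 + w) ^ x" using assms by (intro power_mono) auto
  then have "(a * w) * (1 + a * w) ^ x \<le> (a * w) * (1 + w) ^ x" using assms by (intro mult_left_mono) auto
  with Suc show ?case by (simp add: algebra_simps)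
qed simp

text \<open>In the binomial expansion every term of order at least two carries a factor at most
  \<open>a\<^sup>2\<close>. A smaller rate thus shrinks the remainder relative to the linear
  term.\<close>

lemma power_scaled_2:
  fixes a w :: real
  assumes "0 \<le> a" "a \<le> 1" "0 \<le> w"
  shows "(1 + a * w) ^ x \<le> 1 + a * w * real x + a\<^sup>2 * ((1 + w) ^ x - 1 - w * real x)"
proof (induction x)
  case (Suc x)
  have "(a * w) * (1 + a * w) ^ x \<le> (a * w) * (1 + a * ((1 + w) ^ x - 1))"
    using assms power_scaled_1[OF assms] by (intro mult_left_mono) auto
  with Suc show ?case by (simp add: algebra_simps power2_eq_square)
qed simp

text \<open>\<open>low\<close> follows from near-regularity and converts sums over vertices into
  stationary means at cost \<open>c * n\<close>. Multiplied by \<open>mix_delta\<close> this leaves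
  \<open>1 / (4 * c * n)\<close>, the quantity that a power of \<kappa> has to dominate; the
  exponent is a power of two at least \<open>T\<close>, as \<open>one_step_contraction\<close>
  descends by halving.\<close>

locale mixing_graph = walk_graph V E for V :: "'a set" and E :: "'a set set" +
  fixes c \<kappa> :: real and T i :: nat
  assumes c1: "c \<ge> 1" and low: "\<And>v. v \<in> V \<Longrightarrow> 1 \<le> c * real (card V) * \<mu> v"
    and mix: "mixes V E (mix_delta c V) T" and T1: "T \<ge> 1"
    and \<kappa>: "0 \<le> \<kappa>" "1 / (4 * c * real (card V)) \<le> \<kappa> ^ (2 ^ i)" "T \<le> 2 ^ i"
begin

lemma card_V_pos: "card V > 0" using V_ne by (simp add: card_gt_0_iff)

lemma cn_pos: "c * real (card V) > 0" using card_V_pos c1 by simp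

lemma sum_le_mean: "(\<And>v. v \<in> V \<Longrightarrow> 0 \<le> g v) \<Longrightarrow> (\<Sum>v\<in>V. g v) \<le> c * real (card V) * mean g"
  unfolding mean_def sum_distrib_left
proof (rule sum_mono)
  fix v assume v: "v \<in> V" and g: "\<And>v. v \<in> V \<Longrightarrow> 0 \<le> g v"
  from mult_right_mono[OF low[OF v] g[OF v]]
  show "g v \<le> c * real (card V) * (\<mu> v * g v)" by (simp add: mult.assoc)
qed

lemma delta_cn: "mix_delta c V * (c * real (card V)) = 1 / (4 * c * real (card V))"
  using cn_pos by (simp add: mix_delta_def power2_eq_square field_simps)

lemma delta_nonneg: "0 \<le> mix_delta c V" by (simp add: mix_delta_def)

lemma small_le_1: "1 / (4 * c * real (card V)) \<le> 1"
proof -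
  have "1 * 1 \<le> c * real (card V)" using c1 card_V_pos by (intro mult_mono) auto
  then show ?thesis by (simp add: divide_le_eq mult.assoc)
qed

lemma mixed_dev:
  assumes "T \<le> j" "v \<in> V"
  shows "\<bar>(P ^^ j) g v - mean g\<bar> \<le> 1 / (4 * c * real (card V)) * mean (\<lambda>v. \<bar>g v\<bar>)"
proof -
  have "\<bar>(P ^^ j) g v - mean g\<bar> \<le> mix_delta c V * (\<Sum>w\<in>V. \<bar>g w\<bar>)" by (rule mixing[OF mix assms])
  also have "\<dots> \<le> mix_delta c V * (c * real (card V) * mean (\<lambda>v. \<bar>g v\<bar>))"
    by (intro mult_left_mono sum_le_mean delta_nonneg) auto
  also have "\<dots> = (mix_delta c V * (c * real (card V))) * mean (\<lambda>v. \<bar>g v\<bar>)" by simp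
  finally show ?thesis unfolding delta_cn .
qed

lemma pow_le_2mean:
  assumes "T \<le> j" "v \<in> V" "\<And>v. 0 \<le> g v"
  shows "(P ^^ j) g v \<le> 2 * mean g"
proof -
  have "mean (\<lambda>v. \<bar>g v\<bar>) = mean g" using assms(3) by simp
  moreover have "0 \<le> mean g" using mean_mono[of "\<lambda>_. 0" g] assms(3) by simp
  ultimately have "1 / (4 * c * real (card V)) * mean (\<lambda>v. \<bar>g v\<bar>) \<le> 1 * mean g"
    using small_le_1 by (intro mult_mono) auto
  then show ?thesis using mixed_dev[OF assms(1,2), of g] by linarith
qed

lemma mean_abs_sq: "(mean (\<lambda>v. \<bar>g v\<bar>))\<^sup>2 \<le> ip g g"
  using ip_CS[of "\<lambda>_. 1" "\<lambda>v. \<bar>g v\<bar>"] by (simp add: ip_def)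

text \<open>Centering \<open>q\<close> makes the mixed error relative to \<open>ip f f\<close>, so
  \<open>one_step_contraction\<close> yields factor \<kappa> at every lag from 1 on. Values in
  \<open>[0, 1]\<close> make the variance at most the mean, so the error is linear in
  \<open>mean q\<close>.\<close>

lemma decorrelation:
  assumes q: "\<And>v. 0 \<le> q v" "\<And>v. q v \<le> 1" and j: "j \<ge> 1"
  shows "ip q ((P ^^ j) q) \<le> (mean q)\<^sup>2 + \<kappa> * mean q"
proof -
  define f where "f v = q v - mean q" for v
  define b where "b = 1 / (4 * c * real (card V))"
  have b0: "0 \<le> b" using cn_pos by (simp add: b_def)
  have mf: "mean f = 0" unfolding f_def by (simp add: mean_diff)
  have "ip ((P ^^ (2 ^ i)) f) ((P ^^ (2 ^ i)) f) \<le> mean (\<lambda>_. b\<^sup>2 * ip f f)"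
    unfolding ip_def[of "(P ^^ (2 ^ i)) f"]
  proof (rule mean_mono)
    fix v assume "v \<in> V"
    then have "\<bar>(P ^^ (2 ^ i)) f v\<bar> \<le> b * mean (\<lambda>v. \<bar>f v\<bar>)"
      using mixed_dev[OF \<kappa>(3), of v f] by (simp add: mf b_def)
    then have "((P ^^ (2 ^ i)) f v)\<^sup>2 \<le> (b * mean (\<lambda>v. \<bar>f v\<bar>))\<^sup>2"
      by (metis abs_ge_zero power2_abs power_mono)
    also have "\<dots> \<le> b\<^sup>2 * ip f f" unfolding power_mult_distrib
      by (intro mult_left_mono mean_abs_sq) simp
    finally show "(P ^^ (2 ^ i)) f v * (P ^^ (2 ^ i)) f v \<le> b\<^sup>2 * ip f f" by (simp add: power2_eq_square)
  qed
  also have "\<dots> = b\<^sup>2 * ip f f" by simp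
  also have "\<dots> \<le> \<kappa> ^ (2 ^ Suc i) * ip f f"
  proof (rule mult_right_mono[OF _ ip_nonneg])
    have "b\<^sup>2 \<le> (\<kappa> ^ (2 ^ i))\<^sup>2" using \<kappa>(2) b0 unfolding b_def[symmetric] by (intro power_mono)
    then show "b\<^sup>2 \<le> \<kappa> ^ (2 ^ Suc i)" by (simp add: mult.commute flip: power_mult)
  qed
  finally have "ip (P f) (P f) \<le> \<kappa>\<^sup>2 * ip f f" by (rule one_step_contraction) (rule \<kappa>(1))
  then have 1: "ip ((P ^^ j) f) ((P ^^ j) f) \<le> \<kappa>\<^sup>2 * ip f f" using ip_pow_le[OF j, of f] by linarith
  have "(ip f ((P ^^ j) f))\<^sup>2 \<le> ip f f * (\<kappa>\<^sup>2 * ip f f)"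
    using ip_CS[of f "(P ^^ j) f"] mult_left_mono[OF 1 ip_nonneg] by (rule order_trans)
  also have "\<dots> = (\<kappa> * ip f f)\<^sup>2" by (simp add: power2_eq_square)
  finally have 2: "ip f ((P ^^ j) f) \<le> \<kappa> * ip f f"
    by (rule power2_le_imp_le) (use \<kappa> ip_nonneg in auto)
  have "ip f f = ip q q - (mean q)\<^sup>2" using ip_center[of q 0] by (simp add: f_def[abs_def])
  moreover have "ip q q \<le> mean q" unfolding ip_def by (rule mean_mono) (simp add: q mult_left_le)
  ultimately have "ip f f \<le> mean q" by (smt (verit) zero_le_power2)
  then have "\<kappa> * ip f f \<le> \<kappa> * mean q" using \<kappa>(1) by (rule mult_left_mono)
  then show ?thesis using 2 ip_center[of q j] by (simp add: f_def[abs_def])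
qed

definition dens :: "'a set set \<Rightarrow> real" where "dens Q = real (card Q) / real (card E)"

lemma dens_nonneg: "0 \<le> dens Q" by (simp add: dens_def)

lemma mean_edge_frac_dens: "Q \<subseteq> E \<Longrightarrow> mean (edge_frac Q) = dens Q"
  by (simp add: mean_edge_frac dens_def)

lemma pow_edge_frac_le_1: "v \<in> V \<Longrightarrow> (P ^^ j) (edge_frac Q) v \<le> 1"
proof (induction j arbitrary: v)
  case (Suc j)
  have "P ((P ^^ j) (edge_frac Q)) v \<le> P (\<lambda>_. 1) v" by (rule P_mono) (rule Suc.IH)
  then show ?case using P_const[OF Suc.prems] by simp
qed (simp add: edge_frac_le_1)

lemma sum_of_bool_less: "finite J \<Longrightarrow> (\<Sum>j\<in>J. of_bool (j < T)) \<le> real T"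
proof -
  assume J: "finite J"
  have "card {j\<in>J. j < T} \<le> card {..<T}" by (rule card_mono) auto
  moreover have "(\<Sum>j\<in>J. of_bool (j < T)) = real (card {j\<in>J. j < T})"
    using J by (simp add: Int_def)
  ultimately show ?thesis by simp
qed

text \<open>Each of the first \<open>T\<close> steps hits with probability at most 1; later steps
  are mixed and hit with probability at most twice the stationary one.\<close>

lemma Hexp_bound: assumes "Q \<subseteq> E" "v \<in> V" shows "Hexp Q t v \<le> real T + real t * (2 * dens Q)"
proof -
  have "Hexp Q t v \<le> (\<Sum>l<t. of_bool (l < T) + 2 * dens Q)"
    unfolding Hexp_eq[OF assms(2)]
  proof (rule sum_mono)
    fix l
    show "(P ^^ l) (edge_frac Q) v \<le> of_bool (l < T) + 2 * dens Q"
    proof (cases "l < T")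
      case True
      then show ?thesis using pow_edge_frac_le_1[OF assms(2), of l Q] dens_nonneg[of Q] by simp
    next
      case False
      then show ?thesis using pow_le_2mean[of l v "edge_frac Q"] assms edge_frac_nonneg mean_edge_frac_dens by simp
    qed
  qed
  also have "\<dots> \<le> real T + real t * (2 * dens Q)"
    using sum_of_bool_less[of "{..<t}"] by (simp only: sum.distrib) simp
  finally show ?thesis .
qed

text \<open>Decorrelation is applied only at lags below \<open>T\<close>, where it costs \<kappa>
  per lag; from \<open>T\<close> on mixing bounds the correlation by
  \<open>2 * (dens Q)\<^sup>2\<close>. The error is therefore \<open>real T * \<kappa>\<close> and
  not \<open>real t * \<kappa>\<close>.\<close>

lemma far_pairs_bound:
  assumes Q: "Q \<subseteq> E"
  shows "stat_exp t (\<lambda>fs. real (far_pairs Q fs)) \<le> real t * (dens Q * (2 * real t * dens Q + real T * \<kappa>))"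
proof (rule stat_exp_far_pairs)
  fix t' assume t': "t' < t"
  have "(\<Sum>j\<in>{1..<t'}. ip (edge_frac Q) ((P ^^ j) (edge_frac Q))) \<le> (\<Sum>j\<in>{1..<t'}. 2 * (dens Q)\<^sup>2 + of_bool (j < T) * (\<kappa> * dens Q))"
  proof (rule sum_mono)
    fix j assume j: "j \<in> {1..<t'}"
    show "ip (edge_frac Q) ((P ^^ j) (edge_frac Q)) \<le> 2 * (dens Q)\<^sup>2 + of_bool (j < T) * (\<kappa> * dens Q)"
    proof (cases "j < T")
      case True
      have "ip (edge_frac Q) ((P ^^ j) (edge_frac Q)) \<le> (dens Q)\<^sup>2 + \<kappa> * dens Q"
        using decorrelation[of "edge_frac Q" j] edge_frac_nonneg edge_frac_le_1 j mean_edge_frac_dens[OF Q] by simp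
      then have "ip (edge_frac Q) ((P ^^ j) (edge_frac Q)) \<le> 2 * (dens Q)\<^sup>2 + \<kappa> * dens Q"
        using zero_le_power2[of "dens Q"] by linarith
      then show ?thesis using True by simp
    next
      case False
      have "ip (edge_frac Q) ((P ^^ j) (edge_frac Q)) \<le> mean (\<lambda>v. (2 * dens Q) * edge_frac Q v)"
        unfolding ip_def
      proof (rule mean_mono)
        fix v assume "v \<in> V"
        then have "(P ^^ j) (edge_frac Q) v \<le> 2 * dens Q"
          using pow_le_2mean[of j v "edge_frac Q"] False edge_frac_nonneg mean_edge_frac_dens[OF Q] by simp
        from mult_left_mono[OF this edge_frac_nonneg[of Q v]]
        show "edge_frac Q v * (P ^^ j) (edge_frac Q) v \<le> (2 * dens Q) * edge_frac Q v"
          by (simp add: mult.commute)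
      qed
      then show ?thesis using False by (simp add: mean_cmult mean_edge_frac_dens[OF Q] power2_eq_square)
    qed
  qed
  also have "\<dots> = real (t' - 1) * (2 * (dens Q)\<^sup>2) + (\<Sum>j\<in>{1..<t'}. of_bool (j < T)) * (\<kappa> * dens Q)"
    by (simp only: sum.distrib sum_distrib_right[symmetric]) simp
  also have "\<dots> \<le> real t * (2 * (dens Q)\<^sup>2) + real T * (\<kappa> * dens Q)"
  proof (rule add_mono)
    show "real (t' - 1) * (2 * (dens Q)\<^sup>2) \<le> real t * (2 * (dens Q)\<^sup>2)"
      using t' by (intro mult_right_mono) auto
    show "(\<Sum>j\<in>{1..<t'}. of_bool (j < T)) * (\<kappa> * dens Q) \<le> real T * (\<kappa> * dens Q)"
      by (rule mult_right_mono[OF sum_of_bool_less]) (use \<kappa> dens_nonneg in auto)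
  qed
  finally show "(\<Sum>j\<in>{1..<t'}. ip (edge_frac Q) ((P ^^ j) (edge_frac Q))) \<le> dens Q * (2 * real t * dens Q + real T * \<kappa>)"
    by (simp add: algebra_simps power2_eq_square)
qed

text \<open>Khas'minskii's argument: the expected number of future visits is at most \<open>2 T\<close> from
  every vertex, so visits have exponential moments at scale \<open>1 / T\<close>. This is where the factor
  \<open>T(n)\<close> in the number of measurements is used.\<close>

lemma hits_moment:
  assumes Q: "Q \<subseteq> E" and tp: "2 * (real t * dens Q) \<le> 1"
  shows "stat_exp t (\<lambda>fs. (1 + 1 / (4 * real T)) ^ hits Q fs) \<le> 1 + 1 / (2 * real T) * (real t * dens Q)"
proof -
  have T0: "real T > 0" using T1 by simp
  have H: "Hexp Q t' v \<le> 2 * real T" if "t' \<le> t" "v \<in> V" for t' v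
  proof -
    have "real t' * (2 * dens Q) \<le> real t * (2 * dens Q)" using that dens_nonneg by (intro mult_right_mono) auto
    then show ?thesis using Hexp_bound[OF Q that(2), of t'] tp T1 by simp
  qed
  \<comment> \<open>Unification takes \<open>K = 2\<close>: with \<open>w = 1 / (4 T)\<close> and
    \<open>h = 2 T\<close> the condition \<open>1 + w * K * h \<le> K\<close> holds with
    equality.\<close>
  have "stat_exp t (\<lambda>fs. (1 + 1 / (4 * real T)) ^ hits Q fs)
    \<le> mean (\<lambda>v. 1 + 1 / (4 * real T) * 2 * Hexp Q t v)"
    unfolding stat_exp_def
    by (intro mean_mono exp_moment[where h = "2 * real T"]) (use T0 H in auto)
  also have "\<dots> = 1 + 1 / (4 * real T) * 2 * stat_exp t (\<lambda>fs. real (hits Q fs))"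
    by (simp only: mean_add mean_cmult mean_const stat_exp_def)
  finally show ?thesis using stat_exp_hits[OF Q, of t] by (simp add: dens_def)
qed

text \<open>The linear term is controlled by far pairs, which are rare; the higher terms by the
  exponential moment of all hits, which is not small but enters with the factor
  \<open>a\<^sup>2\<close>. Relative to the main scale the two errors are of order
  \<open>\<rho>\<close> and \<open>a\<close>.\<close>

lemma far_hits_moment:
  assumes Q: "Q \<subseteq> E" and tp: "2 * (real t * dens Q) \<le> 1" and a: "0 \<le> a" "a \<le> 1"
  shows "stat_exp t (\<lambda>fs. (1 + a / (4 * real T)) ^ far_hits Q fs)
    \<le> 1 + a / (4 * real T) * (real t * dens Q) * (3 * (2 * real t * dens Q + real T * \<kappa>) + 2 * a)"
proof -
  define w where "w = 1 / (4 * real T)"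
  have w0: "0 \<le> w" by (simp add: w_def)
  define \<rho> where "\<rho> = 2 * real t * dens Q + real T * \<kappa>"
  have pt: "(1 + a * w) ^ far_hits Q fs
      \<le> 1 + a * w * 3 * real (far_pairs Q fs) + a\<^sup>2 * ((1 + w) ^ hits Q fs + (- 1))" for fs
  proof -
    have "(1 + a * w) ^ far_hits Q fs \<le> 1 + a * w * real (far_hits Q fs)
        + a\<^sup>2 * ((1 + w) ^ far_hits Q fs - 1 - w * real (far_hits Q fs))"
      by (rule power_scaled_2[OF a w0])
    also have "\<dots> \<le> 1 + a * w * (3 * real (far_pairs Q fs)) + a\<^sup>2 * ((1 + w) ^ hits Q fs + (- 1))"
    proof (intro add_mono mult_left_mono)
      show "real (far_hits Q fs) \<le> 3 * real (far_pairs Q fs)"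
        using of_nat_mono[OF far_hits_le_far_pairs[of Q fs], where 'a = real] by simp
      have "(1 + w) ^ far_hits Q fs \<le> (1 + w) ^ hits Q fs"
        by (rule power_increasing[OF far_hits_le_hits]) (use w0 in auto)
      moreover have "0 \<le> w * real (far_hits Q fs)" using w0 by simp
      ultimately show "(1 + w) ^ far_hits Q fs - 1 - w * real (far_hits Q fs) \<le> (1 + w) ^ hits Q fs + (- 1)"
        by linarith
    qed (use a w0 in auto)
    finally show ?thesis by (simp add: mult.assoc)
  qed
  have "stat_exp t (\<lambda>fs. (1 + a * w) ^ far_hits Q fs)
    \<le> 1 + a * w * 3 * stat_exp t (\<lambda>fs. real (far_pairs Q fs)) + a\<^sup>2 * (stat_exp t (\<lambda>fs. (1 + w) ^ hits Q fs) + (- 1))"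
    using stat_exp_mono[OF pt, of t] by (simp only: stat_exp_add stat_exp_cmult stat_exp_const)
  also have "\<dots> \<le> 1 + a * w * 3 * (real t * (dens Q * \<rho>)) + a\<^sup>2 * (2 * w * (real t * dens Q))"
    using far_pairs_bound[OF Q, of t] hits_moment[OF Q tp] a w0
    by (intro add_mono mult_left_mono) (auto simp: \<rho>_def w_def)
  also have "\<dots> = 1 + a * w * (real t * dens Q) * (3 * \<rho> + 2 * a)"
    by (simp add: algebra_simps power2_eq_square)
  finally show ?thesis by (simp add: w_def \<rho>_def)
qed

end

section \<open>Isolated steps of the stationary walk\<close>

context walk_graph
begin

lemma open_frac_nonneg: "0 \<le> open_frac B v"
  unfolding open_frac_def walk_op_def by (intro divide_nonneg_nonneg sum_nonneg) auto

text \<open>At a vertex with almost all edges in \<open>B\<close>, disjointness makes \<open>A\<close> much smaller than \<open>B\<close>; as \<open>B\<close> is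
  at most \<open>40\<close> times as large as \<open>A\<close>, at least half of the edges in \<open>A\<close> avoid such vertices.\<close>

lemma isolated_start_bound:
  assumes A: "A \<subseteq> E" and B: "B \<subseteq> E" and disj: "A \<inter> B = {}" and le: "card B \<le> 40 * card A"
  shows "real (card A) / 161\<^sup>2 \<le>
    (\<Sum>u\<in>V. \<Sum>x\<in>nb u. of_bool ({u, x} \<in> A) * open_frac B u * open_frac B x)"
proof -
  \<comment> \<open>With threshold \<open>1 / 161\<close>, the degree into \<open>A\<close> at a bad
    vertex is at most \<open>1 / 160\<close> of the degree into \<open>B\<close>. Over all bad
    vertices this is at most \<open>2 * card B / 160\<close>, hence at most
    \<open>card A / 2\<close>. Removing this from each end of the \<open>2 * card A\<close> oriented
    edges of \<open>A\<close> leaves \<open>card A\<close> of them, each with product at least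
    \<open>1 / 161\<^sup>2\<close>.\<close>
  define bad where "bad u \<longleftrightarrow> open_frac B u < 1 / 161" for u
  define I :: "'a set set \<Rightarrow> 'a \<Rightarrow> 'a \<Rightarrow> real" where "I X u x = of_bool ({u, x} \<in> X)" for X u x
  have tot: "(\<Sum>u\<in>V. \<Sum>x\<in>nb u. I X u x) = 2 * real (card X)" if "X \<subseteq> E" for X
  proof -
    have "(\<Sum>e\<in>E. of_bool (e \<in> X)) = real (card X)"
      using that by (simp add: Int_absorb1 of_bool_def sum.If_cases)
    then show ?thesis using handshake[of "\<lambda>e. of_bool (e \<in> X)"] unfolding I_def by simp
  qed
  have badle: "(\<Sum>x\<in>nb u. I A u x) \<le> (\<Sum>x\<in>nb u. I B u x) / 160" if u: "u \<in> V" "bad u" for u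
  proof -
    define a where "a = (\<Sum>x\<in>nb u. I A u x)"
    define b where "b = (\<Sum>x\<in>nb u. I B u x)"
    have d: "real (dg u) > 0" using dg_pos[OF u(1)] by simp
    have "a + b \<le> (\<Sum>x\<in>nb u. 1)" unfolding a_def b_def sum.distrib[symmetric]
      by (rule sum_mono) (use disj in \<open>auto simp: I_def\<close>)
    then have ab: "a + b \<le> real (dg u)" by (simp add: card_nb)
    have "open_frac B u = (real (dg u) - b) / real (dg u)"
    proof -
      have "(\<Sum>x\<in>nb u. of_bool ({u, x} \<notin> B)) = (\<Sum>x\<in>nb u. 1 - I B u x)"
        by (rule sum.cong) (auto simp: I_def)
      also have "\<dots> = real (dg u) - b" unfolding sum_subtractf b_def by (simp add: card_nb)
      finally show ?thesis unfolding open_frac_def walk_op_def by simp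
    qed
    then have "(real (dg u) - b) / real (dg u) < 1 / 161" using u(2) by (simp add: bad_def)
    then have "real (dg u) - b < 1 / 161 * real (dg u)" using d by (simp only: pos_divide_less_eq)
    then show ?thesis using ab unfolding a_def[symmetric] b_def[symmetric] by simp
  qed
  have bsum: "(\<Sum>u\<in>V. \<Sum>x\<in>nb u. I A u x * of_bool (bad u)) \<le> real (card A) / 2"
  proof -
    have "(\<Sum>u\<in>V. \<Sum>x\<in>nb u. I A u x * of_bool (bad u)) \<le> (\<Sum>u\<in>V. (\<Sum>x\<in>nb u. I B u x) / 160)"
    proof (rule sum_mono)
      fix u assume u: "u \<in> V"
      show "(\<Sum>x\<in>nb u. I A u x * of_bool (bad u)) \<le> (\<Sum>x\<in>nb u. I B u x) / 160"
      proof (cases "bad u")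
        case True
        then show ?thesis using badle[OF u] by simp
      next
        case False
        have "0 \<le> (\<Sum>x\<in>nb u. I B u x)" by (rule sum_nonneg) (simp add: I_def)
        then show ?thesis using False by simp
      qed
    qed
    also have "\<dots> = 2 * real (card B) / 160" using tot[OF B] by (simp flip: sum_divide_distrib)
    also have "\<dots> \<le> real (card A) / 2" using le by simp
    finally show ?thesis .
  qed
  have bsum': "(\<Sum>u\<in>V. \<Sum>x\<in>nb u. I A u x * of_bool (bad x)) \<le> real (card A) / 2"
  proof -
    have "I A u x = I A x u" for u x by (simp add: I_def insert_commute)
    then show ?thesis using bsum by (subst swap_nb) simp
  qed
  have "real (card A) / 161\<^sup>2 \<le> 1 / 161\<^sup>2 * ((\<Sum>u\<in>V. \<Sum>x\<in>nb u. I A u x)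
      - (\<Sum>u\<in>V. \<Sum>x\<in>nb u. I A u x * of_bool (bad u)) - (\<Sum>u\<in>V. \<Sum>x\<in>nb u. I A u x * of_bool (bad x)))"
    using bsum bsum' tot[OF A] by simp
  also have "\<dots> = (\<Sum>u\<in>V. \<Sum>x\<in>nb u. 1 / 161\<^sup>2 * (I A u x - I A u x * of_bool (bad u) - I A u x * of_bool (bad x)))"
    by (simp only: sum_subtractf sum_distrib_left[symmetric])
  also have "\<dots> \<le> (\<Sum>u\<in>V. \<Sum>x\<in>nb u. I A u x * open_frac B u * open_frac B x)"
  proof (intro sum_mono)
    fix u x
    show "1 / 161\<^sup>2 * (I A u x - I A u x * of_bool (bad u) - I A u x * of_bool (bad x))
      \<le> I A u x * open_frac B u * open_frac B x"
    proof (cases "bad u \<or> bad x \<or> {u, x} \<notin> A")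
      case True
      have "1 / 161\<^sup>2 * (I A u x - I A u x * of_bool (bad u) - I A u x * of_bool (bad x)) \<le> 0"
        using True by (auto simp: I_def)
      also have "\<dots> \<le> I A u x * open_frac B u * open_frac B x"
        using open_frac_nonneg by (simp add: I_def)
      finally show ?thesis .
    next
      case False
      have "1 / 161 * (1 / 161) \<le> open_frac B u * open_frac B x"
        using False by (intro mult_mono) (auto simp: bad_def open_frac_nonneg)
      then show ?thesis using False by (simp add: I_def power2_eq_square)
    qed
  qed
  finally show ?thesis by (simp only: I_def)
qed

text \<open>A walk with \<open>t + 2\<close> steps has \<open>t\<close> interior steps, each
  contributing the same stationary probability; 51842 is \<open>2 * 161\<^sup>2\<close>.\<close>

lemma stat_exp_isolated:
  assumes "A \<subseteq> E" "B \<subseteq> E" "A \<inter> B = {}" "card B \<le> 40 * card A"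
  shows "real t * (real (card A) / 51842 / real (card E)) \<le> stat_exp (Suc (Suc t)) (\<lambda>fs. real (isolated A B fs))"
proof (induction t)
  case 0
  have "stat_exp (Suc (Suc 0)) (\<lambda>fs. 0) \<le> stat_exp (Suc (Suc 0)) (\<lambda>fs. real (isolated A B fs))"
    by (rule stat_exp_mono) simp
  then show ?case by (simp add: stat_exp_const)
next
  case (Suc t)
  have "stat_exp (Suc (Suc (Suc t))) (\<lambda>fs. real (isolated A B fs))
    = stat_exp (Suc (Suc (Suc t))) (\<lambda>fs. real (starts_isolated A B fs) + real (isolated A B (tl fs)))"
    by (subst isolated_tl) (simp only: of_nat_add)
  also have "\<dots> = stat_exp (Suc (Suc (Suc t))) (\<lambda>fs. real (starts_isolated A B fs)) +
      stat_exp (Suc (Suc t)) (\<lambda>fs. real (isolated A B fs))"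
    unfolding stat_exp_add by (subst stat_exp_tl) (rule refl)
  finally have "stat_exp (Suc (Suc (Suc t))) (\<lambda>fs. real (isolated A B fs)) =
      stat_exp (Suc (Suc (Suc t))) (\<lambda>fs. real (starts_isolated A B fs)) +
      stat_exp (Suc (Suc t)) (\<lambda>fs. real (isolated A B fs))" .
  moreover have "real (card A) / 51842 / real (card E) \<le> stat_exp (Suc (Suc (Suc t))) (\<lambda>fs. real (starts_isolated A B fs))"
  proof -
    have "(real (card A) / 161\<^sup>2) / (2 * real (card E)) \<le>
      (\<Sum>u\<in>V. \<Sum>x\<in>nb u. of_bool ({u, x} \<in> A) * open_frac B u * open_frac B x) / (2 * real (card E))"
      by (rule divide_right_mono[OF isolated_start_bound[OF assms]]) simp
    then show ?thesis unfolding stat_exp_starts_isolated by simp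
  qed
  moreover have "real (Suc t) * (real (card A) / 51842 / real (card E))
      = real (card A) / 51842 / real (card E) + real t * (real (card A) / 51842 / real (card E))"
    by (simp only: of_nat_Suc distrib_right mult_1)
  ultimately show ?case using Suc by linarith
qed

end

context mixing_graph
begin

text \<open>A second-moment argument through \<open>isolated_indicator\<close>. Since
  \<open>t - 2 \<ge> t / 3\<close>, the mean number of isolated steps is at least
  \<open>x / 155526\<close> with \<open>155526 = 3 * 51842\<close>; half of it exceeds
  \<open>32 / 10^7 * x\<close>, and the far-pair correction is negligible.\<close>

lemma isolated_prob:
  assumes AB: "A \<subseteq> E" "B \<subseteq> E" "A \<inter> B = {}" "card B \<le> 40 * card A" and t: "t \<ge> 3"
    and \<rho>: "2 * real t * dens A + real T * \<kappa> \<le> 1 / 10^11"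
  shows "16 / 10^7 * (real t * dens A) \<le> stat_exp t (\<lambda>fs. of_bool (isolated A B fs > 0))"
proof -
  obtain t' where t': "t = Suc (Suc t')" "real t' \<ge> real t / 3"
  proof -
    have "t = Suc (Suc (t - 2))" "real (t - 2) \<ge> real t / 3" using t by (auto simp: of_nat_diff)
    then show ?thesis by (rule that)
  qed
  define x where "x = real t * dens A"
  have x0: "0 \<le> x" using dens_nonneg by (simp add: x_def)
  have pt: "(1/2) * real (isolated A B fs) + (- 3/2) * real (far_pairs A fs) \<le> of_bool (isolated A B fs > 0)" for fs
    using isolated_indicator[of A B fs] by (auto split: if_splits)
  have "(1/2) * stat_exp t (\<lambda>fs. real (isolated A B fs)) + (- 3/2) * stat_exp t (\<lambda>fs. real (far_pairs A fs))
      \<le> stat_exp t (\<lambda>fs. of_bool (isolated A B fs > 0))"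
    using stat_exp_mono[OF pt, of t] by (simp only: stat_exp_add stat_exp_cmult)
  moreover have "x / 155526 \<le> stat_exp t (\<lambda>fs. real (isolated A B fs))"
  proof -
    have "x / 155526 = (real t / 3) * (dens A / 51842)" by (simp add: x_def)
    also have "\<dots> \<le> real t' * (dens A / 51842)" using t'(2) dens_nonneg by (intro mult_right_mono) auto
    also have "\<dots> \<le> stat_exp t (\<lambda>fs. real (isolated A B fs))"
      using stat_exp_isolated[OF AB, of t'] unfolding t'(1) dens_def by (simp add: mult.commute)
    finally show ?thesis .
  qed
  moreover have "stat_exp t (\<lambda>fs. real (far_pairs A fs)) \<le> x * (1 / 10^11)"
  proof -
    have "stat_exp t (\<lambda>fs. real (far_pairs A fs)) \<le> x * (2 * real t * dens A + real T * \<kappa>)"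
      using far_pairs_bound[OF AB(1), of t] by (simp add: x_def mult.assoc)
    also have "\<dots> \<le> x * (1 / 10^11)" by (rule mult_left_mono[OF \<rho> x0])
    finally show ?thesis .
  qed
  ultimately show ?thesis using x0 unfolding x_def[symmetric] by simp
qed

end

section \<open>Independent random walks\<close>

definition edge_list :: "'a list \<Rightarrow> 'a set list" where
  "edge_list p = map2 (\<lambda>a b. {a, b}) p (tl p)"

lemma edge_list_Cons: "p \<noteq> [] \<Longrightarrow> edge_list (v # p) = {v, hd p} # edge_list p"
  by (cases p) (auto simp: edge_list_def)

lemma edge_list_single [simp]: "edge_list [v] = []"
  by (simp add: edge_list_def)

lemma set_edge_list: "set (edge_list p) = walk_edges p"
proof -
  have len: "length (edge_list p) = length p - 1" by (simp add: edge_list_def)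
  have nth: "edge_list p ! j = {p ! j, p ! Suc j}" if "j < length p - 1" for j
    using that by (simp add: edge_list_def nth_tl)
  have "set (edge_list p) = {edge_list p ! j | j. j < length p - 1}" by (simp add: set_conv_nth len)
  also have "\<dots> = {{p ! j, p ! Suc j} | j. j < length p - 1}" using nth by metis
  also have "\<dots> = walk_edges p" by (simp add: walk_edges_def less_diff_conv)
  finally show ?thesis .
qed

lemma is_walk_Cons: "is_walk E p \<Longrightarrow> {v, hd p} \<in> E \<Longrightarrow> is_walk E (v # p)"
  unfolding is_walk_def by (auto simp: nth_Cons hd_conv_nth split: nat.splits)

lemma walk_edges_subset: "is_walk E p \<Longrightarrow> walk_edges p \<subseteq> E"
  by (auto simp: is_walk_def walk_edges_def)

lemma traversals_pos_iff: "traversals p e > 0 \<longleftrightarrow> e \<in> walk_edges p"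
proof -
  have "finite {i. Suc i < length p \<and> {p ! i, p ! Suc i} = e}"
    by (rule finite_subset[of _ "{..<length p}"]) auto
  then show ?thesis by (auto simp: traversals_def card_gt_0_iff walk_edges_def)
qed

lemma set_iid_pmf: "xs \<in> set_pmf (iid_pmf p m) \<Longrightarrow> length xs = m \<and> set xs \<subseteq> set_pmf p"
  by (induction m arbitrary: xs) (simp, fastforce)

lemma finite_iid_pmf: "finite (set_pmf p) \<Longrightarrow> finite (set_pmf (iid_pmf p m))"
  by (induction m) auto

section \<open>Exponential tails and counting of subsets\<close>

lemma iid_pmf_prod:
  fixes h :: "'b \<Rightarrow> real"
  assumes "finite (set_pmf p)"
  shows "measure_pmf.expectation (iid_pmf p m) (\<lambda>xs. prod_list (map h xs)) = (measure_pmf.expectation p h) ^ m"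
proof (induction m)
  case (Suc m)
  have "measure_pmf.expectation (iid_pmf p (Suc m)) (\<lambda>xs. prod_list (map h xs))
    = (\<Sum>a\<in>set_pmf p. pmf p a *\<^sub>R measure_pmf.expectation (map_pmf (\<lambda>xs. a # xs) (iid_pmf p m)) (\<lambda>xs. prod_list (map h xs)))"
    unfolding iid_pmf.simps
    by (rule pmf_expectation_bind) (use assms finite_iid_pmf in auto)
  also have "\<dots> = (\<Sum>a\<in>set_pmf p. pmf p a * h a) * measure_pmf.expectation (iid_pmf p m) (\<lambda>xs. prod_list (map h xs))"
    by (simp add: sum_distrib_right mult.assoc)
  also have "(\<Sum>a\<in>set_pmf p. pmf p a * h a) = measure_pmf.expectation p h"
    by (subst integral_measure_pmf[OF assms]) (auto simp: mult.commute)
  finally show ?case by (simp add: Suc)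
qed simp

text \<open>The rate and the sign are absorbed into \<open>g\<close>, so a single form serves for
  upper and lower tails.\<close>

lemma chernoff:
  fixes g :: "'b \<Rightarrow> real"
  assumes fin: "finite (set_pmf p)"
  shows "measure_pmf.prob (iid_pmf p m) {xs. R \<le> sum_list (map g xs)}
    \<le> exp (- R) * (measure_pmf.expectation p (\<lambda>x. exp (g x))) ^ m"
proof -
  have "measure_pmf.prob (iid_pmf p m) {xs. R \<le> sum_list (map g xs)}
    = measure_pmf.expectation (iid_pmf p m) (indicator {xs. R \<le> sum_list (map g xs)})"
    by simp
  also have "\<dots> \<le> measure_pmf.expectation (iid_pmf p m) (\<lambda>xs. exp (- R) * prod_list (map (\<lambda>x. exp (g x)) xs))"
  proof (rule integral_mono)
    fix xs :: "'b list"
    have "prod_list (map (\<lambda>x. exp (g x)) xs) = exp (sum_list (map g xs))"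
      by (induction xs) (auto simp: exp_add)
    then have "exp (- R) * prod_list (map (\<lambda>x. exp (g x)) xs) = exp (sum_list (map g xs) - R)"
      by (simp add: exp_diff exp_minus field_simps)
    then show "indicator {xs. R \<le> sum_list (map g xs)} xs \<le> exp (- R) * prod_list (map (\<lambda>x. exp (g x)) xs)"
      by (auto simp: indicator_def)
  qed (auto intro!: integrable_measure_pmf_finite finite_iid_pmf fin)
  also have "\<dots> = exp (- R) * (measure_pmf.expectation p (\<lambda>x. exp (g x))) ^ m"
    by (simp add: iid_pmf_prod[OF fin])
  finally show ?thesis .
qed

lemma sum_Pow_power:
  fixes z :: real
  assumes "finite X"
  shows "(\<Sum>A\<in>Pow X. z ^ card A) = (1 + z) ^ card X"
  using assms
proof (induction X)
  case (insert x X)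
  have inj: "inj_on (insert x) (Pow X)"
    using insert(2) by (auto simp: inj_on_def)
  have "(\<Sum>A\<in>Pow (insert x X). z ^ card A) = (\<Sum>A\<in>Pow X. z ^ card A) + (\<Sum>A\<in>insert x ` Pow X. z ^ card A)"
    unfolding Pow_insert by (rule sum.union_disjoint) (use insert in auto)
  also have "(\<Sum>A\<in>insert x ` Pow X. z ^ card A) = (\<Sum>A\<in>Pow X. z * z ^ card A)"
    unfolding sum.reindex[OF inj]
  proof (rule sum.cong[OF refl])
    fix A assume A: "A \<in> Pow X"
    then have "finite A" "x \<notin> A" using insert finite_subset by auto
    then show "((\<lambda>A. z ^ card A) \<circ> insert x) A = z * z ^ card A" by simp
  qed
  finally show ?case using insert by (simp add: sum_distrib_left[symmetric] algebra_simps)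
qed simp

text \<open>Evaluates a union bound over all nonempty sets when the failure probability is
  \<open>z\<close> to the size of the set: small sets dominate, and the total is of the order of the
  singletons.\<close>

lemma sum_nonempty_subsets:
  fixes z :: real
  assumes "finite X" "0 \<le> z" "real (card X) * z \<le> 1"
  shows "(\<Sum>A\<in>Pow X - {{}}. z ^ card A) \<le> 2 * (real (card X) * z)"
proof -
  have "(\<Sum>A\<in>Pow X - {{}}. z ^ card A) = (1 + z) ^ card X - 1"
    using sum_Pow_power[OF assms(1), of z] assms(1) by (subst sum_diff) auto
  also have "\<dots> \<le> exp (real (card X) * z) - 1"
  proof -
    have "(1 + z) ^ card X \<le> exp z ^ card X" using assms by (intro power_mono) auto
    also have "\<dots> = exp (real (card X) * z)" by (simp add: exp_of_nat_mult)
    finally show ?thesis by simp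
  qed
  also have "\<dots> \<le> 2 * (real (card X) * z)"
    using exp_bound[of "real (card X) * z"] assms
      mult_left_le_one_le[of "real (card X) * z" "real (card X) * z"] by (simp add: power2_eq_square)
  finally show ?thesis .
qed

text \<open>Each set counted has weight at least 1 under \<open>N ^ r * (1 / N) ^ card B\<close>,
  with \<open>N = card X\<close>; extended to all subsets, the weights sum to
  \<open>N ^ r * (1 + 1 / N) ^ N\<close>.\<close>

lemma card_small_subsets:
  assumes "finite X" "card X \<ge> 1"
  shows "real (card {B. B \<subseteq> X \<and> card B \<le> r}) \<le> 3 * real (card X) ^ r"
proof -
  let ?N = "real (card X)"
  have "real (card {B. B \<subseteq> X \<and> card B \<le> r}) = (\<Sum>B\<in>{B. B \<subseteq> X \<and> card B \<le> r}. 1)" by simp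
  also have "\<dots> \<le> (\<Sum>B\<in>{B. B \<subseteq> X \<and> card B \<le> r}. ?N ^ r * (1 / ?N) ^ card B)"
  proof (rule sum_mono)
    fix B assume "B \<in> {B. B \<subseteq> X \<and> card B \<le> r}"
    then have "?N ^ card B \<le> ?N ^ r" using assms by (intro power_increasing) auto
    then show "1 \<le> ?N ^ r * (1 / ?N) ^ card B" using assms by (simp add: power_divide le_divide_eq)
  qed
  also have "\<dots> \<le> (\<Sum>B\<in>Pow X. ?N ^ r * (1 / ?N) ^ card B)"
    using assms by (intro sum_mono2) auto
  also have "\<dots> = ?N ^ r * (1 + 1 / ?N) ^ card X"
    using sum_Pow_power[OF assms(1), of "1 / ?N"] by (simp add: sum_distrib_left[symmetric])
  also have "\<dots> \<le> ?N ^ r * 3"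
  proof (rule mult_left_mono)
    have "(1 + 1 / ?N) ^ card X \<le> exp (1 / ?N) ^ card X" by (intro power_mono) auto
    also have "\<dots> = exp 1" using assms by (cases "X = {}") (auto simp flip: exp_of_nat_mult)
    also have "\<dots> \<le> 3" by (rule exp_le)
    finally show "(1 + 1 / ?N) ^ card X \<le> 3" .
  qed simp
  finally show ?thesis by simp
qed

section \<open>From sampled walks to the walk operator\<close>

context walk_graph
begin

lemma walk_from_support:
  "v \<in> V \<Longrightarrow> p \<in> set_pmf (walk_from V E v t) \<Longrightarrow> p \<noteq> [] \<and> hd p = v \<and> is_walk E p"
proof (induction t arbitrary: v p)
  case 0
  then show ?case by (simp add: is_walk_def)
next
  case (Suc t)
  then obtain u p' where u: "u \<in> nb v" "p' \<in> set_pmf (walk_from V E u t)" "p = v # p'"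
    using nbrs_ne[of v] by auto
  have "p' \<noteq> [] \<and> hd p' = u \<and> is_walk E p'" using Suc.IH[OF nb_sub[OF u(1)] u(2)] .
  then show ?case using u nb_iff is_walk_Cons by auto
qed

lemma finite_walk_from: "v \<in> V \<Longrightarrow> finite (set_pmf (walk_from V E v t))"
proof (induction t arbitrary: v)
  case (Suc t)
  then show ?case using nbrs_ne[of v] nb_sub by auto
qed simp

lemma expectation_walk_from:
  "v \<in> V \<Longrightarrow> measure_pmf.expectation (walk_from V E v t) (\<lambda>p. g (edge_list p)) = walk_exp V E t v g"
proof (induction t arbitrary: v g)
  case (Suc t)
  have "measure_pmf.expectation (walk_from V E v (Suc t)) (\<lambda>p. g (edge_list p))
    = (\<Sum>u\<in>nb v. measure_pmf.expectation (map_pmf (\<lambda>p. v # p) (walk_from V E u t)) (\<lambda>p. g (edge_list p)) /\<^sub>R real (card (nb v)))"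
    unfolding walk_from.simps
    by (rule pmf_expectation_bind_pmf_of_set)
      (use nbrs_ne[OF Suc.prems] finite_walk_from nb_sub in auto)
  also have "\<dots> = (\<Sum>u\<in>nb v. walk_exp V E t u (\<lambda>fs. g ({v, u} # fs)) / real (dg v))"
  proof (rule sum.cong[OF refl])
    fix u assume u: "u \<in> nb v"
    have "measure_pmf.expectation (map_pmf (\<lambda>p. v # p) (walk_from V E u t)) (\<lambda>p. g (edge_list p))
      = measure_pmf.expectation (walk_from V E u t) (\<lambda>p. g (edge_list (v # p)))" by simp
    also have "\<dots> = measure_pmf.expectation (walk_from V E u t) (\<lambda>p. g ({v, u} # edge_list p))"
      by (rule integral_cong_AE)
        (auto simp: AE_measure_pmf_iff edge_list_Cons dest: walk_from_support[OF nb_sub[OF u]])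
    also have "\<dots> = walk_exp V E t u (\<lambda>fs. g ({v, u} # fs))"
      using Suc.IH[OF nb_sub[OF u], of "\<lambda>fs. g ({v, u} # fs)"] .
    finally show "measure_pmf.expectation (map_pmf (\<lambda>p. v # p) (walk_from V E u t)) (\<lambda>p. g (edge_list p)) /\<^sub>R real (card (nb v))
      = walk_exp V E t u (\<lambda>fs. g ({v, u} # fs)) / real (dg v)" by (simp add: card_nb divide_inverse mult.commute)
  qed
  finally show ?case by (simp add: walk_op_def sum_divide_distrib)
qed simp

lemma pmf_start: "pmf (start_pmf V E) v = (if v \<in> V then \<mu> v else 0)"
  unfolding start_pmf_def
proof (rule pmf_embed_pmf)
  show "(\<integral>\<^sup>+ x. ennreal (if x \<in> V then \<mu> x else 0) \<partial>count_space UNIV) = 1"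
  proof -
    have "(\<integral>\<^sup>+ x. ennreal (if x \<in> V then \<mu> x else 0) \<partial>count_space UNIV)
      = (\<Sum>x\<in>V. ennreal (if x \<in> V then \<mu> x else 0))"
      by (rule nn_integral_count_space') auto
    also have "\<dots> = ennreal (\<Sum>x\<in>V. \<mu> x)" by (subst sum_ennreal[symmetric]) (auto simp: \<mu>_nonneg)
    finally show ?thesis by (simp add: sum_\<mu>)
  qed
qed (simp add: \<mu>_nonneg)

lemma set_start: "set_pmf (start_pmf V E) \<subseteq> V"
  by (auto simp: set_pmf_iff pmf_start split: if_splits)

lemma good_start_walk_support: "p \<in> set_pmf (good_start_walk V E t) \<Longrightarrow> is_walk E p"
  using walk_from_support set_start by (auto simp: good_start_walk_def)

lemma finite_good_start_walk: "finite (set_pmf (good_start_walk V E t))"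
  using set_start finite_walk_from finite_subset[OF set_start finV] by (auto simp: good_start_walk_def)

lemma expectation_good_start_walk:
  "measure_pmf.expectation (good_start_walk V E t) (\<lambda>p. g (edge_list p)) = stat_exp t g"
proof -
  have "measure_pmf.expectation (good_start_walk V E t) (\<lambda>p. g (edge_list p))
    = (\<Sum>v\<in>V. pmf (start_pmf V E) v *\<^sub>R measure_pmf.expectation (walk_from V E v t) (\<lambda>p. g (edge_list p)))"
    unfolding good_start_walk_def
    by (rule pmf_expectation_bind) (use set_start finite_walk_from in auto)
  then show ?thesis by (simp add: pmf_start expectation_walk_from stat_exp_def mean_def)
qed

end

section \<open>Recovery\<close>

text \<open>Outside the support of \<open>x\<close> the null vector \<open>y - x\<close> coincides
  with \<open>y\<close>, so what \<open>y\<close> saves on the support is less than what it must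
  spend elsewhere.\<close>

lemma l1_recovers_if_null_space:
  fixes rs :: "'a list list"
  assumes fin: "finite E"
    and nsp: "\<And>y S. S \<subseteq> E \<Longrightarrow> real (card S) \<le> s \<Longrightarrow> (\<exists>e\<in>E. y e \<noteq> 0) \<Longrightarrow>
      (\<And>i. i < length rs \<Longrightarrow> (\<Sum>e\<in>E. real (traversals (rs ! i) e) * y e) = 0) \<Longrightarrow>
      2 * (\<Sum>e\<in>S. \<bar>y e\<bar>) < (\<Sum>e\<in>E. \<bar>y e\<bar>)"
  shows "l1_recovers E rs s"
  unfolding l1_recovers_def
proof (intro allI impI)
  fix x y :: "'a set \<Rightarrow> real"
  assume x: "(\<forall>e. e \<notin> E \<longrightarrow> x e = 0) \<and> real (card {e\<in>E. x e \<noteq> 0}) \<le> s"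
    and y: "(\<forall>e. e \<notin> E \<longrightarrow> y e = 0) \<and> y \<noteq> x \<and> (\<forall>i<length rs. meas E rs y i = meas E rs x i)"
  define S where "S = {e\<in>E. x e \<noteq> 0}"
  have SE: "S \<subseteq> E" by (auto simp: S_def)
  have "\<exists>e\<in>E. y e - x e \<noteq> 0"
  proof -
    obtain e where "y e \<noteq> x e" using y by blast
    then show ?thesis using x y by force
  qed
  moreover have "(\<Sum>e\<in>E. real (traversals (rs ! i) e) * (y e - x e)) = 0" if "i < length rs" for i
    using y that by (simp add: meas_def right_diff_distrib sum_subtractf)
  ultimately have n: "2 * (\<Sum>e\<in>S. \<bar>y e - x e\<bar>) < (\<Sum>e\<in>E. \<bar>y e - x e\<bar>)"
    using nsp[of S "\<lambda>e. y e - x e"] x SE unfolding S_def by blast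
  have spl: "(\<Sum>e\<in>E. g e) = (\<Sum>e\<in>S. g e) + (\<Sum>e\<in>E - S. g e)" for g :: "'a set \<Rightarrow> real"
    using sum.subset_diff[OF SE fin, of g] by simp
  have "(\<Sum>e\<in>E. \<bar>x e\<bar>) = (\<Sum>e\<in>S. \<bar>x e\<bar>)" unfolding spl by (simp add: S_def)
  also have "\<dots> \<le> (\<Sum>e\<in>S. \<bar>y e\<bar> + \<bar>y e - x e\<bar>)" by (rule sum_mono) linarith
  also have "\<dots> = (\<Sum>e\<in>S. \<bar>y e\<bar>) + (\<Sum>e\<in>S. \<bar>y e - x e\<bar>)" by (rule sum.distrib)
  also have "\<dots> < (\<Sum>e\<in>S. \<bar>y e\<bar>) + (\<Sum>e\<in>E - S. \<bar>y e - x e\<bar>)"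
    using n unfolding spl[of "\<lambda>e. \<bar>y e - x e\<bar>"] by simp
  also have "(\<Sum>e\<in>E - S. \<bar>y e - x e\<bar>) = (\<Sum>e\<in>E - S. \<bar>y e\<bar>)" by (rule sum.cong) (auto simp: S_def)
  finally show "(\<Sum>e\<in>E. \<bar>x e\<bar>) < (\<Sum>e\<in>E. \<bar>y e\<bar>)" unfolding spl[of "\<lambda>e. \<bar>y e\<bar>"] .
qed

lemma half_le_ln_1p:
  fixes x :: real
  assumes "0 \<le> x" "x \<le> 1"
  shows "x / 2 \<le> ln (1 + x)"
proof -
  have "exp (x / 2) \<le> 1 + x / 2 + (x / 2)\<^sup>2" using assms by (intro exp_bound) auto
  also have "\<dots> \<le> 1 + x" using assms mult_left_le_one_le[of x x] by (simp add: power2_eq_square)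
  finally show ?thesis by (subst ln_ge_iff) (use assms in auto)
qed

lemma exp_neg_ln:
  fixes x :: real
  assumes "x > 0"
  shows "exp (- (real a * ln x * real k)) = (1 / x ^ a) ^ k"
proof -
  have "exp (- (real a * ln x * real k)) = exp (real (a * k) * (- ln x))" by (simp add: mult_ac)
  also have "\<dots> = (exp (- ln x)) ^ (a * k)" by (rule exp_of_nat_mult)
  also have "exp (- ln x) = 1 / x" using assms by (simp add: exp_minus inverse_eq_divide)
  finally show ?thesis by (simp add: power_mult power_one_over)
qed

section \<open>Tail bounds for one set and the union bound\<close>

context mixing_graph
begin

lemma card_E_le: "real (card E) \<le> (real (card V))\<^sup>2"
proof -
  have "real (dg v) \<le> real (card V)" for v
    unfolding deg_def by (intro of_nat_mono card_mono) (auto dest: nb_sub)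
  then have "(\<Sum>v\<in>V. real (dg v)) \<le> (\<Sum>v\<in>V. real (card V))" by (intro sum_mono)
  then show ?thesis using sum_deg by (simp add: power2_eq_square)
qed

text \<open>With \<open>a = 1 / 10^11\<close> the moment has rate at most \<open>5 / 10^11\<close>,
  in units of \<open>\<theta> * x\<close>. The threshold contributes \<open>100 / 10^11\<close>,
  halved by the estimate of the logarithm, so \<open>45 / 10^11\<close> remains. As \<theta> is of
  order \<open>1 / T\<close>, the factor \<open>T\<close> in the lower bound on \<open>d\<close>
  cancels.\<close>

lemma few_far_hits_prob:
  assumes Q: "Q \<subseteq> E" and n2: "card V \<ge> 2"
    and \<rho>: "2 * real t * dens Q + real T * \<kappa> \<le> 1 / 10^11"
    and d: "d = real m * real t / real (card E)" "10^30 * real T * ln (real (card V)) \<le> d"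
  shows "measure_pmf.prob (iid_pmf (good_start_walk V E t) m)
      {ws. 1 / 10^9 * d * real (card Q) \<le> (\<Sum>w\<leftarrow>ws. real (far_hits Q (edge_list w)))}
    \<le> (1 / real (card V) ^ 4) ^ card Q"
proof -
  let ?p = "good_start_walk V E t"
  define \<theta> where "\<theta> = (1 / 10^11) / (4 * real T)"
  have T0: "real T \<ge> 1" using T1 by simp
  have \<theta>0: "0 < \<theta>" "\<theta> \<le> 1" using T0 by (auto simp: \<theta>_def field_simps)
  have l\<theta>: "\<theta> / 2 \<le> ln (1 + \<theta>)" by (rule half_le_ln_1p) (use \<theta>0 in auto)
  define x where "x = d * real (card Q)"
  have n0: "ln (real (card V)) \<ge> 0" using n2 by simp
  have d0: "0 \<le> d" by (simp add: d(1))
  have x0: "0 \<le> x" by (simp add: x_def d0)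
  have mx: "real m * (real t * dens Q) = x" by (simp add: x_def d(1) dens_def)
  have \<kappa>T: "0 \<le> real T * \<kappa>" using \<kappa> by simp
  have tp: "2 * (real t * dens Q) \<le> 1" using \<rho> \<kappa>T by simp
  have tp0: "0 \<le> real t * dens Q" using dens_nonneg by simp
  define M where "M = measure_pmf.expectation ?p (\<lambda>w. exp (ln (1 + \<theta>) * real (far_hits Q (edge_list w))))"
  have M0: "0 \<le> M" unfolding M_def by (rule Bochner_Integration.integral_nonneg) simp
  have "M = stat_exp t (\<lambda>fs. (1 + \<theta>) ^ far_hits Q fs)"
  proof -
    have "exp (ln (1 + \<theta>) * real (far_hits Q (edge_list w))) = (1 + \<theta>) ^ far_hits Q (edge_list w)" for w :: "'a list"
      using \<theta>0 exp_of_nat_mult[of "far_hits Q (edge_list w)" "ln (1 + \<theta>)"] by (simp add: mult.commute)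
    then show ?thesis unfolding M_def using expectation_good_start_walk[of t "\<lambda>fs. (1 + \<theta>) ^ far_hits Q fs"] by simp
  qed
  also have "\<dots> \<le> 1 + \<theta> * (real t * dens Q) * (3 * (2 * real t * dens Q + real T * \<kappa>) + 2 * (1 / 10^11))"
    unfolding \<theta>_def by (rule far_hits_moment[OF Q tp]) auto
  also have "\<dots> \<le> 1 + \<theta> * (real t * dens Q) * (5 / 10^11)"
    by (intro add_left_mono mult_left_mono) (use \<rho> tp0 \<theta>0 in auto)
  also have "\<dots> \<le> exp (\<theta> * (real t * dens Q) * (5 / 10^11))" by simp
  finally have "M ^ m \<le> exp (\<theta> * (real t * dens Q) * (5 / 10^11)) ^ m" by (rule power_mono[OF _ M0])
  also have "\<dots> = exp (\<theta> * (real m * (real t * dens Q)) * (5 / 10^11))"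
    by (simp flip: exp_of_nat_mult)
  finally have Mm: "M ^ m \<le> exp (\<theta> * x * (5 / 10^11))" unfolding mx .
  have lpos: "ln (1 + \<theta>) > 0" using \<theta>0 by simp
  have ev: "{ws. 1 / 10^9 * d * real (card Q) \<le> (\<Sum>w\<leftarrow>ws. real (far_hits Q (edge_list w)))}
    = {ws. ln (1 + \<theta>) * (1 / 10^9 * x) \<le> (\<Sum>w\<leftarrow>ws. ln (1 + \<theta>) * real (far_hits Q (edge_list w)))}"
    using lpos by (simp add: sum_list_const_mult x_def mult.assoc)
  have "measure_pmf.prob (iid_pmf ?p m) {ws. 1 / 10^9 * d * real (card Q) \<le> (\<Sum>w\<leftarrow>ws. real (far_hits Q (edge_list w)))}
    \<le> exp (- (ln (1 + \<theta>) * (1 / 10^9 * x))) * M ^ m"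
    unfolding M_def ev by (rule chernoff[OF finite_good_start_walk])
  also have "\<dots> \<le> exp (- (\<theta> / 2 * (1 / 10^9 * x))) * exp (\<theta> * x * (5 / 10^11))"
  proof (rule mult_mono[OF _ Mm])
    have "\<theta> / 2 * (1 / 10^9 * x) \<le> ln (1 + \<theta>) * (1 / 10^9 * x)" using l\<theta> x0 by (intro mult_right_mono) auto
    then show "exp (- (ln (1 + \<theta>) * (1 / 10^9 * x))) \<le> exp (- (\<theta> / 2 * (1 / 10^9 * x)))" by simp
  qed (use M0 in auto)
  also have "\<dots> = exp (- (\<theta> * x * (45 / 10^11)))" by (simp flip: exp_add)
  also have "\<dots> \<le> exp (- (4 * ln (real (card V)) * real (card Q)))"
  proof -
    have "\<theta> * d \<ge> \<theta> * (10^30 * real T * ln (real (card V)))" using d(2) \<theta>0 by (intro mult_left_mono) auto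
    also have "\<theta> * (10^30 * real T * ln (real (card V))) = 10^19 / 4 * ln (real (card V))"
      using T0 by (simp add: \<theta>_def)
    finally have "10^19 / 4 * ln (real (card V)) * (45 / 10^11) \<le> \<theta> * d * (45 / 10^11)" by simp
    then have "4 * ln (real (card V)) \<le> \<theta> * d * (45 / 10^11)" using n0 by simp
    then have "4 * ln (real (card V)) * real (card Q) \<le> \<theta> * d * (45 / 10^11) * real (card Q)"
      by (intro mult_right_mono) auto
    then show ?thesis by (simp add: x_def mult_ac)
  qed
  also have "\<dots> = (1 / real (card V) ^ 4) ^ card Q"
    using n2 exp_neg_ln[of "real (card V)" 4 "card Q"] by simp
  finally show ?thesis .
qed


text \<open>At rate 1 a probability \<open>q\<close> reduces the moment to at most
  \<open>1 - q / 2\<close>, which gives \<open>8 / 10^7\<close> in the exponent; half is spent on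
  the threshold. The power 84 is \<open>80 + 4\<close>: 80 for the choices of \<open>B\<close>, 4
  for those of \<open>A\<close>.\<close>

lemma many_isolated_prob:
  assumes AB: "A \<subseteq> E" "B \<subseteq> E" "A \<inter> B = {}" "card B \<le> 40 * card A" and n2: "card V \<ge> 2" and t: "t \<ge> 3"
    and \<rho>: "2 * real t * dens A + real T * \<kappa> \<le> 1 / 10^11"
    and d: "d = real m * real t / real (card E)" "10^30 * real T * ln (real (card V)) \<le> d"
  shows "measure_pmf.prob (iid_pmf (good_start_walk V E t) m)
      {ws. (\<Sum>w\<leftarrow>ws. of_bool (isolated A B (edge_list w) > 0)) \<le> 4 / 10^7 * d * real (card A)}
    \<le> (1 / real (card V) ^ 84) ^ card A"
proof -
  let ?p = "good_start_walk V E t"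
  have T0: "real T \<ge> 1" using T1 by simp
  define x where "x = d * real (card A)"
  have n0: "ln (real (card V)) \<ge> 0" using n2 by simp
  have mx: "real m * (real t * dens A) = x" by (simp add: x_def d(1) dens_def)
  define q where "q = stat_exp t (\<lambda>fs. of_bool (isolated A B fs > 0))"
  have q: "16 / 10^7 * (real t * dens A) \<le> q" unfolding q_def by (rule isolated_prob[OF AB t \<rho>])
  define M where "M = measure_pmf.expectation ?p (\<lambda>w. exp (- of_bool (isolated A B (edge_list w) > 0) :: real))"
  have M0: "0 \<le> M" unfolding M_def by (rule Bochner_Integration.integral_nonneg) simp
  have e2: "exp (- 1 :: real) \<le> 1 / 2"
    using exp_ge_add_one_self[of "1 :: real"] by (simp add: exp_minus field_simps)
  have "M = stat_exp t (\<lambda>fs. exp (- of_bool (isolated A B fs > 0)))"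
    unfolding M_def using expectation_good_start_walk[of t "\<lambda>fs. exp (- of_bool (isolated A B fs > 0))"] by simp
  also have "\<dots> \<le> stat_exp t (\<lambda>fs. 1 + (- 1/2) * of_bool (isolated A B fs > 0))"
    by (rule stat_exp_mono) (use e2 in auto)
  also have "\<dots> = 1 + (- 1/2) * q" by (simp only: stat_exp_add stat_exp_cmult stat_exp_const q_def)
  also have "\<dots> \<le> 1 + (- (8 / 10^7 * (real t * dens A)))" using q by simp
  also have "\<dots> \<le> exp (- (8 / 10^7 * (real t * dens A)))" by (rule exp_ge_add_one_self)
  finally have "M ^ m \<le> exp (- (8 / 10^7 * (real t * dens A))) ^ m" by (rule power_mono[OF _ M0])
  also have "\<dots> = exp (- (8 / 10^7 * (real m * (real t * dens A))))"
    by (simp flip: exp_of_nat_mult)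
  finally have Mm: "M ^ m \<le> exp (- (8 / 10^7 * x))" unfolding mx .
  have neg: "(\<Sum>w\<leftarrow>ws. - f w) = - (\<Sum>w\<leftarrow>ws. f w)" for ws and f :: "'a list \<Rightarrow> real"
    by (induction ws) auto
  have ev: "{ws. (\<Sum>w\<leftarrow>ws. of_bool (isolated A B (edge_list w) > 0)) \<le> 4 / 10^7 * d * real (card A)}
    = {ws. - (4 / 10^7 * x) \<le> (\<Sum>w\<leftarrow>ws. - of_bool (isolated A B (edge_list w) > 0))}"
    unfolding neg by (simp add: x_def mult.assoc)
  have "measure_pmf.prob (iid_pmf ?p m) {ws. (\<Sum>w\<leftarrow>ws. of_bool (isolated A B (edge_list w) > 0)) \<le> 4 / 10^7 * d * real (card A)}
    \<le> exp (- (- (4 / 10^7 * x))) * M ^ m"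
    unfolding M_def ev by (rule chernoff[OF finite_good_start_walk])
  also have "\<dots> \<le> exp (- (- (4 / 10^7 * x))) * exp (- (8 / 10^7 * x))"
    by (rule mult_left_mono[OF Mm]) simp
  also have "\<dots> = exp (- (4 / 10^7 * x))" by (simp flip: exp_add)
  also have "\<dots> \<le> exp (- (84 * ln (real (card V)) * real (card A)))"
  proof -
    have "10^30 * ln (real (card V)) \<le> 10^30 * real T * ln (real (card V))"
      using mult_right_mono[OF T0 n0] by simp
    then have "84 * ln (real (card V)) \<le> 4 / 10^7 * d" using d(2) n0 by simp
    then have "84 * ln (real (card V)) * real (card A) \<le> 4 / 10^7 * d * real (card A)"
      by (intro mult_right_mono) auto
    then show ?thesis by (simp add: x_def mult_ac)
  qed
  also have "\<dots> = (1 / real (card V) ^ 84) ^ card A"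
    using n2 exp_neg_ln[of "real (card V)" 84 "card A"] by simp
  finally show ?thesis .
qed

text \<open>A union bound over the finitely many events required by the null space property; hence
  one sample of walks serves all sparse vectors at once. Sets up to size \<open>2 * s\<close> are
  needed because blocks are joined with the support, and \<open>b < real s + 1\<close> makes the
  real sparsity bound an integral one.\<close>

lemma recovery_prob:
  fixes s :: nat and b :: real
  assumes n2: "card V \<ge> 2" and t: "t \<ge> 3"
    and \<rho>: "2 * real t * (2 * real s / real (card E)) + real T * \<kappa> \<le> 1 / 10^11"
    and d: "10^30 * real T * ln (real (card V)) \<le> real m * real t / real (card E)"
    and b: "b < real s + 1"
    and reg: "\<And>w. is_walk E w \<Longrightarrow> regularized_walk E w (r w)"
  shows "1 - 8 / (real (card V))\<^sup>2 \<le> measure_pmf.prob (iid_pmf (good_start_walk V E t) m)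
      {ws. l1_recovers E (map r ws) b}"
proof -
  let ?M = "iid_pmf (good_start_walk V E t) m"
  let ?n = "real (card V)"
  define d where "d = real m * real t / real (card E)"
  have dd: "10^30 * real T * ln ?n \<le> d" using d by (simp add: d_def)
  have dpos: "d > 0"
  proof -
    have "0 < 10^30 * real T * ln ?n" using n2 T1 by simp
    then show ?thesis using dd by linarith
  qed
  have \<rho>': "2 * real t * dens Q + real T * \<kappa> \<le> 1 / 10^11" if "card Q \<le> 2 * s" for Q
  proof -
    have "real (card Q) \<le> 2 * real s" using that by linarith
    then have "2 * real t * dens Q \<le> 2 * real t * (2 * real s / real (card E))"
      unfolding dens_def by (intro mult_left_mono divide_right_mono) auto
    then show ?thesis using \<rho> by linarith
  qed
  define BQ where "BQ Q = {ws. 1 / 10^9 * d * real (card Q) \<le> (\<Sum>w\<leftarrow>ws. real (far_hits Q (edge_list w)))}" for Q :: "'a set set"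
  define BA where "BA AB = {ws. (\<Sum>w\<leftarrow>ws. of_bool (isolated (fst AB) (snd AB) (edge_list w) > 0)) \<le> 4 / 10^7 * d * real (card (fst AB))}" for AB :: "'a set set \<times> 'a set set"
  define IQ where "IQ = {Q. Q \<subseteq> E \<and> Q \<noteq> {} \<and> card Q \<le> 2 * s}"
  define IA where "IA = {AB. fst AB \<subseteq> E \<and> snd AB \<subseteq> E \<and> fst AB \<noteq> {} \<and> fst AB \<inter> snd AB = {} \<and>
     card (fst AB) \<le> s \<and> card (snd AB) \<le> 40 * card (fst AB)}"
  have fIQ: "finite IQ" by (rule finite_subset[of _ "Pow E"]) (auto simp: IQ_def)
  have fIA: "finite IA" by (rule finite_subset[of _ "Pow E \<times> Pow E"]) (auto simp: IA_def mem_Times_iff)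
  have N1: "real (card E) * (1 / ?n ^ 4) \<le> 1 / ?n\<^sup>2"
  proof -
    have "real (card E) * (1 / ?n ^ 4) \<le> ?n\<^sup>2 * (1 / ?n ^ 4)" by (rule mult_right_mono[OF card_E_le]) simp
    also have "\<dots> = 1 / ?n\<^sup>2" using n2 by (simp add: power4_eq_xxxx power2_eq_square)
    finally show ?thesis .
  qed
  have "1 \<le> ?n\<^sup>2" using n2 by (intro one_le_power) simp
  then have N2: "1 / ?n\<^sup>2 \<le> 1" by (intro divide_le_eq_1_pos[THEN iffD2]) linarith+
  have geo: "(\<Sum>A\<in>Pow E - {{}}. (1 / ?n ^ 4) ^ card A) \<le> 2 / ?n\<^sup>2"
    using sum_nonempty_subsets[OF finE, of "1 / ?n ^ 4"] N1 N2 by simp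
  have "measure_pmf.prob ?M (\<Union>Q\<in>IQ. BQ Q) \<le> (\<Sum>Q\<in>IQ. measure_pmf.prob ?M (BQ Q))"
    by (rule measure_pmf.finite_measure_subadditive_finite[OF fIQ]) auto
  also have "\<dots> \<le> (\<Sum>Q\<in>IQ. (1 / ?n ^ 4) ^ card Q)"
  proof (rule sum_mono)
    fix Q assume "Q \<in> IQ"
    then show "measure_pmf.prob ?M (BQ Q) \<le> (1 / ?n ^ 4) ^ card Q"
      unfolding BQ_def IQ_def by (intro few_far_hits_prob[OF _ n2 \<rho>' d_def dd]) auto
  qed
  also have "\<dots> \<le> (\<Sum>A\<in>Pow E - {{}}. (1 / ?n ^ 4) ^ card A)"
    by (rule sum_mono2) (auto simp: IQ_def)
  finally have PQ: "measure_pmf.prob ?M (\<Union>Q\<in>IQ. BQ Q) \<le> 2 / ?n\<^sup>2" using geo by linarith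
  have "measure_pmf.prob ?M (\<Union>AB\<in>IA. BA AB) \<le> (\<Sum>AB\<in>IA. measure_pmf.prob ?M (BA AB))"
    by (rule measure_pmf.finite_measure_subadditive_finite[OF fIA]) auto
  also have "\<dots> \<le> (\<Sum>AB\<in>IA. (1 / ?n ^ 84) ^ card (fst AB))"
  proof (rule sum_mono)
    fix AB assume "AB \<in> IA"
    then show "measure_pmf.prob ?M (BA AB) \<le> (1 / ?n ^ 84) ^ card (fst AB)"
      unfolding BA_def IA_def by (intro many_isolated_prob[OF _ _ _ _ n2 t \<rho>' d_def dd]) auto
  qed
  also have "\<dots> \<le> (\<Sum>AB\<in>Sigma (Pow E - {{}}) (\<lambda>A. {B. B \<subseteq> E \<and> card B \<le> 40 * card A}). (1 / ?n ^ 84) ^ card (fst AB))"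
    by (rule sum_mono2) (auto simp: IA_def intro: finite_subset[of _ "Pow E"])
  also have "\<dots> = (\<Sum>A\<in>Pow E - {{}}. \<Sum>B\<in>{B. B \<subseteq> E \<and> card B \<le> 40 * card A}. (1 / ?n ^ 84) ^ card A)"
    by (subst sum.Sigma) (auto simp: case_prod_unfold intro: finite_subset[of _ "Pow E"])
  \<comment> \<open>There are at most \<open>3 * n ^ (80 * card A)\<close> choices of
    \<open>B\<close>, since \<open>card E \<le> n\<^sup>2\<close>. After paying for them,
    \<open>n ^ (- 4)\<close> per edge of \<open>A\<close> is left, the same geometric sum as for the
    far hits.\<close>
  also have "\<dots> \<le> (\<Sum>A\<in>Pow E - {{}}. 3 * (1 / ?n ^ 4) ^ card A)"
  proof (rule sum_mono)
    fix A
    have "real (card {B. B \<subseteq> E \<and> card B \<le> 40 * card A}) \<le> 3 * real (card E) ^ (40 * card A)"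
      by (rule card_small_subsets) (use card_E_pos in auto)
    also have "\<dots> \<le> 3 * ((?n\<^sup>2) ^ (40 * card A))" by (intro mult_left_mono power_mono card_E_le) auto
    also have "\<dots> = 3 * (?n ^ 80) ^ card A" by (simp flip: power_mult)
    finally have "real (card {B. B \<subseteq> E \<and> card B \<le> 40 * card A}) * (1 / ?n ^ 84) ^ card A
      \<le> 3 * (?n ^ 80) ^ card A * (1 / ?n ^ 84) ^ card A" by (rule mult_right_mono) simp
    also have "\<dots> = 3 * (?n ^ 80 * (1 / ?n ^ 84)) ^ card A" by (simp only: power_mult_distrib mult.assoc)
    also have "?n ^ 80 * (1 / ?n ^ 84) = 1 / ?n ^ 4"
    proof -
      have eq: "?n ^ 84 = ?n ^ 80 * ?n ^ 4" by (simp flip: power_add)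
      have cancel: "a * (1 / (a * b)) = 1 / b" if "a \<noteq> 0" for a b :: real using that by simp
      show ?thesis unfolding eq by (rule cancel) (use V_ne in simp)
    qed
    finally show "(\<Sum>B\<in>{B. B \<subseteq> E \<and> card B \<le> 40 * card A}. (1 / ?n ^ 84) ^ card A) \<le> 3 * (1 / ?n ^ 4) ^ card A" by simp
  qed
  also have "\<dots> \<le> 6 / ?n\<^sup>2" using geo unfolding sum_distrib_left[symmetric] by simp
  finally have PA: "measure_pmf.prob ?M (\<Union>AB\<in>IA. BA AB) \<le> 6 / ?n\<^sup>2" .
  define Bad where "Bad = (\<Union>Q\<in>IQ. BQ Q) \<union> (\<Union>AB\<in>IA. BA AB)"
  have PB: "measure_pmf.prob ?M Bad \<le> 8 / ?n\<^sup>2"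
    unfolding Bad_def using measure_Un_le[of "\<Union>Q\<in>IQ. BQ Q" "measure_pmf ?M" "\<Union>AB\<in>IA. BA AB"] PQ PA by simp
  have good: "l1_recovers E (map r ws) b" if ws: "ws \<in> set_pmf ?M" "ws \<notin> Bad" for ws
  proof (rule l1_recovers_if_null_space[OF finE])
    fix y S assume S: "S \<subseteq> E" "real (card S) \<le> b" and nz: "\<exists>e\<in>E. y e \<noteq> 0"
      and null: "\<And>i. i < length (map r ws) \<Longrightarrow> (\<Sum>e\<in>E. real (traversals (map r ws ! i) e) * y e) = 0"
    have walk: "is_walk E (ws ! i)" if "i < length ws" for i
      using set_iid_pmf[OF ws(1)] nth_mem[OF that] good_start_walk_support by blast
    have regw: "regularized_walk E (ws ! i) (r (ws ! i))" if "i < length ws" for i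
      using reg walk that by blast
    show "2 * (\<Sum>e\<in>S. \<bar>y e\<bar>) < (\<Sum>e\<in>E. \<bar>y e\<bar>)"
    proof (rule null_space_property[where s = s and d = d and m = "length ws" and
          fs = "\<lambda>i. edge_list (ws ! i)" and a = "\<lambda>i. traversals (r (ws ! i))"])
      show "finite E" "S \<subseteq> E" "0 < d" "\<exists>e\<in>E. y e \<noteq> 0" using S nz dpos by auto
      show "card S \<le> s" using S b by linarith
      fix i assume i: "i < length ws"
      show "set (edge_list (ws ! i)) \<subseteq> E"
        using walk_edges_subset[OF walk[OF i]] by (simp add: set_edge_list)
      show "traversals (r (ws ! i)) e \<le> 2" for e
        using regw[OF i] by (simp add: regularized_walk_def)
      show "(0 < traversals (r (ws ! i)) e) = (e \<in> set (edge_list (ws ! i)))" for e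
        using regw[OF i] by (simp add: regularized_walk_def traversals_pos_iff set_edge_list)
      show "(\<Sum>e\<in>E. real (traversals (r (ws ! i)) e) * y e) = 0" using null[of i] i by simp
    next
      fix A B assume AB: "A \<subseteq> E" "B \<subseteq> E" "A \<noteq> {}" "A \<inter> B = {}" "card A \<le> s" "card B \<le> 40 * card A"
      have "(A, B) \<in> IA" using AB by (simp add: IA_def)
      then have "ws \<notin> BA (A, B)" using ws(2) unfolding Bad_def by blast
      then have "4 / 10^7 * d * real (card A) \<le> (\<Sum>w\<leftarrow>ws. of_bool (isolated A B (edge_list w) > 0))"
        by (simp add: BA_def)
      also have "\<dots> = (\<Sum>i<length ws. of_bool (isolated A B (edge_list (ws ! i)) > 0))"
        by (simp add: sum_list_sum_nth atLeast0LessThan)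
      also have "\<dots> = real (card {i. i < length ws \<and> isolated A B (edge_list (ws ! i)) > 0})"
        by (simp add: Int_def)
      finally show "4 / 10^7 * d * real (card A) \<le> real (card {i. i < length ws \<and> 0 < isolated A B (edge_list (ws ! i))})" .
    next
      fix Q assume Q: "Q \<subseteq> E" "Q \<noteq> {}" "card Q \<le> 2 * s"
      have "Q \<in> IQ" using Q by (simp add: IQ_def)
      then have "ws \<notin> BQ Q" using ws(2) unfolding Bad_def by blast
      then have "(\<Sum>w\<leftarrow>ws. real (far_hits Q (edge_list w))) \<le> 1 / 10^9 * d * real (card Q)"
        by (simp add: BQ_def)
      then show "(\<Sum>i<length ws. real (far_hits Q (edge_list (ws ! i)))) \<le> 1 / 10^9 * d * real (card Q)"
        by (simp add: sum_list_sum_nth atLeast0LessThan)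
    qed
  qed
  have "1 - 8 / ?n\<^sup>2 \<le> 1 - measure_pmf.prob ?M Bad" using PB by linarith
  also have "\<dots> = measure_pmf.prob ?M (UNIV - Bad)" using measure_pmf.prob_compl[of Bad ?M] by simp
  also have "\<dots> \<le> measure_pmf.prob ?M {ws. l1_recovers E (map r ws) b}"
    by (rule measure_pmf.finite_measure_mono_AE) (auto simp: AE_measure_pmf_iff good)
  finally show ?thesis .
qed

end

section \<open>Choice of constants and passage to the limit\<close>

lemma recovery_eventually:
  fixes c :: real
  assumes c: "c \<ge> 1"
  shows "\<exists>n0. \<forall>(V :: 'a set) E D k r.
    graph V E \<and> uniform_graph V E D c \<and> D \<ge> 1 \<and> card V \<ge> n0 \<and>
    (\<exists>t. mixes V E (mix_delta c V) t) \<and> mixing_time V E (mix_delta c V) \<le> B \<and>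
    1 \<le> k \<and> k \<le> card E \<and> (\<forall>w. is_walk E w \<longrightarrow> regularized_walk E w (r w)) \<longrightarrow>
    1 - 8 / (real (card V))\<^sup>2 \<le> measure_pmf.prob
      (iid_pmf (good_start_walk V E (nat \<lceil>3 * real (card E) / real k\<rceil>))
        (nat \<lceil>10^30 * real (mixing_time V E (mix_delta c V)) * real k * ln (real (card V))\<rceil>))
      {ws. l1_recovers E (map r ws) (1 / 10^13 * real k)}"
proof -
  define \<kappa> :: real where "\<kappa> = 1 / (2 * 10^11 * (real B + 1))"
  have \<kappa>0: "\<kappa> > 0" by (simp add: \<kappa>_def)
  \<comment> \<open>The first term makes \<open>1 / (4 * c * n)\<close> at most
    \<open>\<kappa> ^ (2 ^ B)\<close>, the second excludes mixing time 0, and the last makes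
    \<open>ln n\<close> positive.\<close>
  define n0 where "n0 = nat \<lceil>1 / \<kappa> ^ (2 ^ B)\<rceil> + nat \<lceil>4 * c\<rceil> + 2"
  show ?thesis
  proof (intro exI[of _ n0] allI impI, elim conjE)
    fix V :: "'a set" and E D k r
    assume gr: "graph V E" and uni: "uniform_graph V E D c" and D: "D \<ge> 1" and n: "card V \<ge> n0"
      and mx: "\<exists>t. mixes V E (mix_delta c V) t" and TB: "mixing_time V E (mix_delta c V) \<le> B"
      and k1: "1 \<le> k" and kE: "k \<le> card E"
      and reg: "\<forall>w. is_walk E w \<longrightarrow> regularized_walk E w (r w)"
    define T where "T = mixing_time V E (mix_delta c V)"
    have n2: "card V \<ge> 2" and nc: "real (card V) \<ge> 4 * c" and n\<kappa>: "real (card V) \<ge> 1 / \<kappa> ^ (2 ^ B)"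
      using n unfolding n0_def by linarith+
    have Vne: "V \<noteq> {}" using n2 by auto
    have degD: "D \<le> real (deg V E v)" "real (deg V E v) \<le> c * D" if "v \<in> V" for v
      using uni that by (auto simp: uniform_graph_def)
    interpret walk_graph V E
    proof
      fix v assume "v \<in> V"
      then have "deg V E v \<noteq> 0" using degD(1)[of v] D by auto
      then show "nbrs V E v \<noteq> {}" by (auto simp: deg_def)
    qed (use gr Vne in auto)
    have E0: "real (card E) > 0" using card_E_pos by simp
    have Ene: "E \<noteq> {}" using card_E_pos by auto
    have Elow: "real (card V) * D \<le> 2 * real (card E)"
      using sum_mono[of V "\<lambda>_. D" "\<lambda>v. real (deg V E v)"] degD sum_deg by simp
    have Ehigh: "2 * real (card E) \<le> real (card V) * (c * D)"
      using sum_mono[of V "\<lambda>v. real (deg V E v)" "\<lambda>_. c * D"] degD sum_deg by simp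
    have mixT: "mixes V E (mix_delta c V) T"
      unfolding T_def mixing_time_def using mx by (rule LeastI_ex)
    \<comment> \<open>Mixing time 0 would leave no walks at all. It is impossible: every stationary
      weight is at most \<open>1 / 4\<close>, far from a point mass, while \<open>mix_delta\<close>
      is at most \<open>1 / 4\<close>.\<close>
    have T1: "T \<ge> 1"
    proof (rule ccontr)
      assume "\<not> T \<ge> 1"
      then have m0: "mixes V E (mix_delta c V) 0" using mixT by (cases T) auto
      obtain v where v: "v \<in> V" using Vne by blast
      have "4 * real (deg V E v) \<le> 4 * c * D" using degD[OF v] by simp
      also have "\<dots> \<le> real (card V) * D" using nc D by (intro mult_right_mono) auto
      also have "\<dots> \<le> 2 * real (card E)" by (rule Elow)
      finally have "stat_dist V E v \<le> 1 / 4" using E0 by (simp add: stat_dist_def divide_le_eq)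
      moreover have "\<bar>stat_dist V E v - 1\<bar> \<le> mix_delta c V"
        using m0 v unfolding mixes_def by (metis step_dist.simps(1))
      moreover have "mix_delta c V \<le> 1 / 4"
      proof -
        have "2 \<le> 2 * c * real (card V)" using c n2 mult_mono[of 1 c 1 "real (card V)"] by simp
        then have "2\<^sup>2 \<le> (2 * c * real (card V))\<^sup>2" by (rule power_mono) simp
        then show ?thesis unfolding mix_delta_def by (intro frac_le) auto
      qed
      ultimately show False by linarith
    qed
    interpret mixing_graph V E c \<kappa> T B
    proof
      fix v assume v: "v \<in> V"
      have "2 * real (card E) \<le> c * real (card V) * real (deg V E v)"
      proof -
        have "real (card V) * (c * D) \<le> real (card V) * (c * real (deg V E v))"
          using degD(1)[OF v] c by (intro mult_left_mono) auto
        then show ?thesis using Ehigh by (simp add: mult_ac)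
      qed
      then show "1 \<le> c * real (card V) * stat_dist V E v" using E0 by (simp add: stat_dist_def le_divide_eq)
    next
      have p: "0 < \<kappa> ^ (2 ^ B)" using \<kappa>0 by simp
      have "1 / (4 * c * real (card V)) \<le> 1 / real (card V)"
      proof (rule frac_le)
        have "1 * real (card V) \<le> 4 * c * real (card V)" using c by (intro mult_right_mono) auto
        then show "real (card V) \<le> 4 * c * real (card V)" by simp
      qed (use n2 in auto)
      also have "\<dots> \<le> \<kappa> ^ (2 ^ B)" using n\<kappa> p n2 by (simp add: field_simps)
      finally show "1 / (4 * c * real (card V)) \<le> \<kappa> ^ (2 ^ B)" .
      show "T \<le> 2 ^ B" using TB less_exp[of B] unfolding T_def by linarith
    qed (use c mixT T1 \<kappa>0 in auto)
    define t where "t = nat \<lceil>3 * real (card E) / real k\<rceil>"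
    define m where "m = nat \<lceil>10^30 * real T * real k * ln (real (card V))\<rceil>"
    define s where "s = nat \<lfloor>1 / 10^13 * real k\<rfloor>"
    have k0: "real k > 0" using k1 by simp
    have tlow: "3 * real (card E) / real k \<le> real t" unfolding t_def by linarith
    have ratio: "1 \<le> real (card E) / real k" using k0 kE by (simp add: le_divide_eq)
    have t3: "t \<ge> 3" using tlow ratio by simp
    have thigh: "real t \<le> 4 * (real (card E) / real k)"
    proof -
      have "real t \<le> 3 * real (card E) / real k + 1" unfolding t_def using E0 k0
        by (smt (verit) ceiling_correct divide_nonneg_nonneg of_nat_nat zero_le_ceiling)
      then show ?thesis using ratio by simp
    qed
    have shigh: "real s \<le> 1 / 10^13 * real k" unfolding s_def by (rule of_nat_floor) simp
    have "1 - 8 / (real (card V))\<^sup>2 \<le> measure_pmf.prob (iid_pmf (good_start_walk V E t) m)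
      {ws. l1_recovers E (map r ws) (1 / 10^13 * real k)}"
    proof (rule recovery_prob[OF n2 t3, where s = s])
      \<comment> \<open>The budget \<open>1 / 10^11\<close> is shared: \<kappa> was chosen to give
        \<open>real T * \<kappa>\<close> at most one half of it, and
        \<open>t \<le> 4 * card E / k\<close> with \<open>s \<le> k / 10^13\<close> makes the
        density term at most \<open>16 / 10^13\<close>.\<close>
      have "2 * real t * (2 * real s / real (card E)) \<le>
          2 * (4 * (real (card E) / real k)) * (2 * (1 / 10^13 * real k) / real (card E))"
        using thigh shigh E0 k0 by (intro mult_mono divide_right_mono) auto
      also have "\<dots> = 16 / 10^13" using Ene k0 by simp
      finally have "2 * real t * (2 * real s / real (card E)) \<le> 16 / 10^13" .
      moreover have "real T * \<kappa> \<le> (real B + 1) * \<kappa>" using TB \<kappa>0 unfolding T_def by (intro mult_right_mono) auto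
      moreover have "(real B + 1) * \<kappa> = 1 / (2 * 10^11)"
      proof -
        have "x * (1 / (y * x)) = 1 / y" if "x \<noteq> 0" for x y :: real using that by simp
        moreover have "real B + 1 \<noteq> 0" by linarith
        ultimately show ?thesis unfolding \<kappa>_def by blast
      qed
      ultimately show "2 * real t * (2 * real s / real (card E)) + real T * \<kappa> \<le> 1 / 10^11" by simp
      have ln0: "0 \<le> ln (real (card V))" using n2 by simp
      have "10^30 * real T * ln (real (card V))
          = (10^30 * real T * real k * ln (real (card V))) * (real (card E) / real k) / real (card E)"
        using Ene k0 by simp
      also have "\<dots> \<le> real m * real t / real (card E)"
      proof (intro divide_right_mono mult_mono)
        show "10^30 * real T * real k * ln (real (card V)) \<le> real m" unfolding m_def by linarith
        show "real (card E) / real k \<le> real t" using tlow ratio by simp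
      qed (use E0 k0 in auto)
      finally show "10^30 * real T * ln (real (card V)) \<le> real m * real t / real (card E)" .
      show "1 / 10^13 * real k < real s + 1" unfolding s_def by linarith
    qed (use reg in auto)
    then show "1 - 8 / (real (card V))\<^sup>2 \<le> measure_pmf.prob
      (iid_pmf (good_start_walk V E (nat \<lceil>3 * real (card E) / real k\<rceil>))
        (nat \<lceil>10^30 * real (mixing_time V E (mix_delta c V)) * real k * ln (real (card V))\<rceil>))
      {ws. l1_recovers E (map r ws) (1 / 10^13 * real k)}"
      unfolding t_def m_def T_def .
  qed
qed

theorem theorem9:
  fixes c :: real
  assumes "c \<ge> 1"
  shows "\<exists>\<alpha>>0. \<exists>\<beta>>0. \<exists>\<gamma>>0.
    \<forall>(V :: nat \<Rightarrow> 'a set) (E :: nat \<Rightarrow> 'a set set) (D :: nat \<Rightarrow> real)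
      (k :: nat \<Rightarrow> nat) (r :: nat \<Rightarrow> 'a list \<Rightarrow> 'a list).
      (\<forall>j. graph (V j) (E j) \<and> connected_graph (V j) (E j) \<and> uniform_graph (V j) (E j) (D j) c)
      \<and> filterlim (\<lambda>j. card (V j)) at_top sequentially
      \<and> filterlim D at_top sequentially
      \<and> (\<forall>j. \<exists>t. mixes (V j) (E j) (mix_delta c (V j)) t)
      \<and> (\<exists>B. \<forall>j. mixing_time (V j) (E j) (mix_delta c (V j)) \<le> B)
      \<and> (\<forall>j. 1 \<le> k j \<and> k j \<le> card (E j))
      \<and> (\<forall>j w. is_walk (E j) w \<longrightarrow> regularized_walk (E j) w (r j w))
      \<longrightarrow>
      (\<lambda>j. measure_pmf.prob
              (iid_pmf
                 (good_start_walk (V j) (E j)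
                    (nat \<lceil>\<beta> * real (card (E j)) / real (k j)\<rceil>))
                 (nat \<lceil>\<alpha> * real (mixing_time (V j) (E j) (mix_delta c (V j)))
                        * real (k j) * ln (real (card (V j)))\<rceil>))
              {ws. l1_recovers (E j) (map (r j) ws) (\<gamma> * real (k j))})
      \<longlonglongrightarrow> 1"
\<comment> \<open>The witnesses are absolute; \<open>c\<close> and the bound \<open>B\<close> on the
  mixing times affect only the size from which the estimate holds. With
  \<open>k \<le> card E\<close>, the factor 3 ensures at least three steps, the least number with an
  interior one.\<close>
proof (rule exI[of _ "10^30"], rule conjI, simp, rule exI[of _ 3], rule conjI, simp,
    rule exI[of _ "1 / 10^13"], rule conjI, simp, intro allI impI, elim conjE exE)
  fix V :: "nat \<Rightarrow> 'a set" and E :: "nat \<Rightarrow> 'a set set" and D :: "nat \<Rightarrow> real"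
    and k :: "nat \<Rightarrow> nat" and r :: "nat \<Rightarrow> 'a list \<Rightarrow> 'a list" and B :: nat
  assume gr: "\<forall>j. graph (V j) (E j) \<and> connected_graph (V j) (E j) \<and> uniform_graph (V j) (E j) (D j) c"
    and n: "filterlim (\<lambda>j. card (V j)) at_top sequentially"
    and D: "filterlim D at_top sequentially"
    and mx: "\<forall>j. \<exists>t. mixes (V j) (E j) (mix_delta c (V j)) t"
    and B: "\<forall>j. mixing_time (V j) (E j) (mix_delta c (V j)) \<le> B"
    and k: "\<forall>j. 1 \<le> k j \<and> k j \<le> card (E j)"
    and reg: "\<forall>j w. is_walk (E j) w \<longrightarrow> regularized_walk (E j) w (r j w)"
  let ?p = "\<lambda>j. measure_pmf.prob
      (iid_pmf (good_start_walk (V j) (E j) (nat \<lceil>3 * real (card (E j)) / real (k j)\<rceil>))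
        (nat \<lceil>10^30 * real (mixing_time (V j) (E j) (mix_delta c (V j))) * real (k j) * ln (real (card (V j)))\<rceil>))
      {ws. l1_recovers (E j) (map (r j) ws) (1 / 10^13 * real (k j))}"
  obtain n0 where n0: "\<And>(V :: 'a set) E D k r.
    graph V E \<and> uniform_graph V E D c \<and> D \<ge> 1 \<and> card V \<ge> n0 \<and>
    (\<exists>t. mixes V E (mix_delta c V) t) \<and> mixing_time V E (mix_delta c V) \<le> B \<and>
    1 \<le> k \<and> k \<le> card E \<and> (\<forall>w. is_walk E w \<longrightarrow> regularized_walk E w (r w)) \<Longrightarrow>
    1 - 8 / (real (card V))\<^sup>2 \<le> measure_pmf.prob
      (iid_pmf (good_start_walk V E (nat \<lceil>3 * real (card E) / real k\<rceil>))
        (nat \<lceil>10^30 * real (mixing_time V E (mix_delta c V)) * real k * ln (real (card V))\<rceil>))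
      {ws. l1_recovers E (map r ws) (1 / 10^13 * real k)}"
    using recovery_eventually[OF assms, where B = B and ?'a = 'a] by blast
  have low: "eventually (\<lambda>j. 1 - 8 / (real (card (V j)))\<^sup>2 \<le> ?p j) sequentially"
    using filterlim_at_top[THEN iffD1, OF n, rule_format, of n0]
      filterlim_at_top[THEN iffD1, OF D, rule_format, of 1]
  proof eventually_elim
    case (elim j)
    show ?case
      by (rule n0[where D = "D j"]) (use gr mx B k reg elim in blast)
  qed
  have "(\<lambda>j. 1 - 8 / (real (card (V j)))\<^sup>2) \<longlonglongrightarrow> 1 - 0"
  proof (intro tendsto_diff tendsto_const)
    have "filterlim (\<lambda>j. real (card (V j))) at_top sequentially"
      by (rule filterlim_compose[OF filterlim_real_sequentially n])
    then have "filterlim (\<lambda>j. (real (card (V j)))\<^sup>2) at_top sequentially"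
      by (rule filterlim_pow_at_top[rotated]) simp
    then show "(\<lambda>j. 8 / (real (card (V j)))\<^sup>2) \<longlonglongrightarrow> 0"
      by (rule tendsto_divide_0[OF tendsto_const filterlim_at_top_imp_at_infinity])
  qed
  then have "(\<lambda>j. 1 - 8 / (real (card (V j)))\<^sup>2) \<longlonglongrightarrow> 1" by simp
  from tendsto_sandwich[OF low _ this tendsto_const]
  show "?p \<longlonglongrightarrow> 1" by simp
qed

end
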